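(* Let $(\pi,\mathcal H)$ be a unitary representation of a Lie group $G$ on a separable Hilbert space. Let $\zeta\in\mathcal H^{-\infty}$. Then there is a unique continuous $G$-equivariant map $\mathcal M_\zeta:(\mathcal H^* )^{-\infty}\to \mathbf D'(G)$ such that for all $v\in(\mathcal H^* )^\infty$, the distribution $\mathcal M_\zeta(v)$ can be identified with the function $$\mathcal M_{\zeta,v}(g)=\langle \pi(g)\zeta,v\rangle=\zeta(\pi^c(g^{-1})v)\qquad(g\in G).$$ In addition, for any $h\in G$ and $\eta\in(\mathcal H^* )^{-\infty}$, $\mathcal M_\zeta(\pi^c(h)\eta)=L(h)\mathcal M_\zeta(\eta)$, where $L$ denotes the left regular action of $G$ on $\mathbf D'(G)$. If $\pi$ is irreducible and $\zeta\neq0$, then the map $\mathcal M_\zeta$ is injective.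
   Context: $\mathfrak g$ is the Lie algebra of $G$, $U(\mathfrak g)$ its universal enveloping algebra, $dg$ a left Haar measure on $G$. $\mathcal H^\infty$ is the space of smooth vectors of $\mathcal H$ (those $v$ with $g\mapsto\pi(g)v$ smooth), a Frechet space with the seminorms $v\mapsto\|\pi(D)v\|$, $D\in U(\mathfrak g)$. $(\pi^c,\mathcal H^* )$ is the contragredient unitary representation on the Hilbert space dual, $\langle\pi^c(g)u,v\rangle=\langle u,\pi(g^{-1})v\rangle$, and $(\mathcal H^* )^\infty$ is its Frechet space of smooth vectors. $(\mathcal H^* )^{-\infty}$ is the topological dual of $\mathcal H^\infty$, and $\mathcal H^{-\infty}$ is the topological dual of $(\mathcal H^* )^\infty$, both with the weak-* topology; $\mathcal H^*\subset(\mathcal H^* )^{-\infty}$ and $\mathcal H\subset\mathcal H^{-\infty}$. $G$ acts on them by $\langle\pi^c(g)\psi,v\rangle=\langle\psi,\pi(g^{-1})v\rangle$ ($\psi\in(\mathcal H^* )^{-\infty}$, $v\in\mathcal H^\infty$) and $\langle\pi(g)\phi,v\rangle=\langle\phi,\pi^c(g^{-1})v\rangle$ ($\phi\in\mathcal H^{-\infty}$, $v\in(\mathcal H^* )^\infty$). $\mathbf D'(G)$ is the space of distributions on $G$, i.e. the topological dual of $C_c^\infty(G)$, with the weak-* topology. A function $F$ on $G$ is identified with the distribution $f\mapsto\int_G F(g)f(g)\,dg$. The left regular action is $(L(h)f)(g)=f(h^{-1}g)$ on functions and $\langle L(h)F,f\rangle=\langle F,L(h^{-1})f\rangle$ on distributions.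 $G$-equivariance is with respect to $\pi^c$ on $(\mathcal H^* )^{-\infty}$ and $L$ on $\mathbf D'(G)$. *)

theory Defs
  imports "HOL-Analysis.Analysis" "HOL-Algebra.Group" "HOL-Library.Function_Algebras"
begin

section \<open>Complex vector spaces and Hilbert spaces\<close>

class complex_vector = ab_group_add +
  fixes scaleC :: "complex \<Rightarrow> 'a \<Rightarrow> 'a"
  assumes scaleC_add_right: "scaleC a (x + y) = scaleC a x + scaleC a y"
    and scaleC_add_left: "scaleC (a + b) x = scaleC a x + scaleC b x"
    and scaleC_scaleC: "scaleC a (scaleC b x) = scaleC (a * b) x"
    and scaleC_one: "scaleC 1 x = x"

class complex_normed_vector = real_normed_vector + complex_vector +
  assumes scaleR_scaleC: "scaleR r x = scaleC (complex_of_real r) x"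
    and norm_scaleC: "norm (scaleC a x) = cmod a * norm x"

text \<open>The underlying real inner product of a complex Hilbert space is the real part of the
  Hermitian one, so that norm and topology are those of the library. Dimension 0 is allowed.\<close>

class complex_hilbert_space = complex_normed_vector + real_inner + complete_space +
  fixes cinner :: "'a \<Rightarrow> 'a \<Rightarrow> complex"
  assumes cinner_commute: "cinner x y = cnj (cinner y x)"
    and cinner_add_left: "cinner (x + y) z = cinner x z + cinner y z"
    and cinner_scaleC_left: "cinner (scaleC a x) y = a * cinner x y"
    and Re_cinner: "Re (cinner x y) = inner x y"

instantiation complex :: complex_normed_vector
begin

definition scaleC_complex :: "complex \<Rightarrow> complex \<Rightarrow> complex" where
  "scaleC_complex c x = c * x"

instance
  by standard (simp_all add: scaleC_complex_def algebra_simps norm_mult scaleR_conv_of_real)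

end

instantiation "fun" :: (type, complex_vector) complex_vector
begin

definition scaleC_fun :: "complex \<Rightarrow> ('a \<Rightarrow> 'b) \<Rightarrow> 'a \<Rightarrow> 'b" where
  "scaleC_fun c f = (\<lambda>x. scaleC c (f x))"

instance
  by standard
    (auto simp: scaleC_fun_def scaleC_add_right scaleC_add_left scaleC_scaleC scaleC_one)

end

lemma bounded_linear_scaleC: "bounded_linear (scaleC c :: 'a::complex_normed_vector \<Rightarrow> 'a)"
proof (rule bounded_linear_intro)
  show "scaleC c (x + y) = scaleC c x + scaleC c y" for x y :: 'a
    by (rule scaleC_add_right)
  show "scaleC c (r *\<^sub>R x) = r *\<^sub>R scaleC c x" for r and x :: 'a
    by (simp add: scaleR_scaleC scaleC_scaleC mult.commute)
  show "norm (scaleC c x) \<le> norm x * cmod c" for x :: 'a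
    by (simp add: norm_scaleC mult.commute)
qed

instantiation blinfun :: (real_normed_vector, complex_normed_vector) complex_vector
begin

definition scaleC_blinfun :: "complex \<Rightarrow> ('a \<Rightarrow>\<^sub>L 'b) \<Rightarrow> 'a \<Rightarrow>\<^sub>L 'b" where
  "scaleC_blinfun c u = Blinfun (scaleC c) o\<^sub>L u"

instance
  by standard
    (auto intro!: blinfun_eqI simp: scaleC_blinfun_def bounded_linear_Blinfun_apply
      bounded_linear_scaleC blinfun.add_left scaleC_add_right scaleC_add_left scaleC_scaleC
      scaleC_one)

end

definition csubspace :: "'v::complex_vector set \<Rightarrow> bool" where
  "csubspace V \<longleftrightarrow> 0 \<in> V \<and> (\<forall>x\<in>V. \<forall>y\<in>V. x + y \<in> V) \<and> (\<forall>c. \<forall>x\<in>V. scaleC c x \<in> V)"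

definition clinear_on :: "'v::complex_vector set \<Rightarrow> ('v \<Rightarrow> 'w::complex_vector) \<Rightarrow> bool" where
  "clinear_on V f \<longleftrightarrow>
     (\<forall>x\<in>V. \<forall>y\<in>V. f (x + y) = f x + f y) \<and> (\<forall>c. \<forall>x\<in>V. f (scaleC c x) = scaleC c (f x))"


section \<open>Topologies given by seminorms, and topological duals\<close>

definition seminorm_topology :: "'v::complex_vector set \<Rightarrow> ('v \<Rightarrow> real) set \<Rightarrow> 'v topology" where
  "seminorm_topology V P =
     topology_generated_by (insert V {{y \<in> V. p (y - x) < \<epsilon>} | p x \<epsilon>. p \<in> P \<and> x \<in> V \<and> 0 < \<epsilon>})"

definition seminorm_on :: "'v::complex_vector set \<Rightarrow> ('v \<Rightarrow> real) \<Rightarrow> bool" where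
  "seminorm_on V p \<longleftrightarrow>
     (\<forall>x\<in>V. \<forall>y\<in>V. p (x + y) \<le> p x + p y) \<and> (\<forall>c. \<forall>x\<in>V. p (scaleC c x) = cmod c * p x)"

definition zero_extend :: "'v set \<Rightarrow> ('v \<Rightarrow> complex) \<Rightarrow> 'v \<Rightarrow> complex" where
  "zero_extend V f = (\<lambda>x. if x \<in> V then f x else 0)"

text \<open>Functionals on a subspace \<open>V\<close> of a type are represented by their extension by 0 outside \<open>V\<close>.
  On such functions the product topology of the type \<open>'v \<Rightarrow> complex\<close> is pointwise convergence on
  \<open>V\<close>; hence the weak-* topology of the dual is the subspace topology coming from the type.\<close>

definition top_dual :: "'v::complex_vector topology \<Rightarrow> ('v \<Rightarrow> complex) set" where
  "top_dual T = {\<psi>. clinear_on (topspace T) \<psi> \<and> continuous_map T euclidean \<psi> \<and>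
                    (\<forall>x. x \<notin> topspace T \<longrightarrow> \<psi> x = 0)}"


section \<open>Smooth maps and Lie groups\<close>

fun iterated_deriv ::
  "'e::real_normed_vector list \<Rightarrow> ('e \<Rightarrow> 'b::real_normed_vector) \<Rightarrow> 'e \<Rightarrow> 'b" where
  "iterated_deriv [] f = f"
| "iterated_deriv (\<xi> # \<xi>s) f = (\<lambda>x. frechet_derivative (iterated_deriv \<xi>s f) (at x) \<xi>)"

text \<open>For open \<open>S\<close> in a finite-dimensional space this is the class of infinitely often differentiable
  maps.\<close>

definition smooth_on ::
  "'e::real_normed_vector set \<Rightarrow> ('e \<Rightarrow> 'b::real_normed_vector) \<Rightarrow> bool" where
  "smooth_on S f \<longleftrightarrow> (\<forall>\<xi>s. \<forall>x\<in>S. iterated_deriv \<xi>s f differentiable (at x))"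

type_synonym ('g, 'e) chart = "'g set \<times> ('g \<Rightarrow> 'e)"

text \<open>The manifold structure is given by a (not necessarily maximal) atlas \<open>A\<close> on the type \<open>'g\<close>, which
  carries the topology of the group and is the whole carrier. The model space is a
  finite-dimensional normed space instead of a \<open>euclidean_space\<close>, as the latter is never
  0-dimensional and would exclude discrete groups.\<close>

locale lie_group = group G
  for G :: "('g::{t2_space,second_countable_topology}) monoid" (structure) +
  fixes A :: "('g, 'e::real_normed_vector) chart set"
  assumes carrier_UNIV: "carrier G = UNIV"
    and finite_dim: "\<exists>B::'e set. finite B \<and> span B = UNIV"
    and chart_open: "(U, \<phi>) \<in> A \<Longrightarrow> open U \<and> open (\<phi> ` U)"
    and chart_homeomorphism: "(U, \<phi>) \<in> A \<Longrightarrow> homeomorphism U (\<phi> ` U) \<phi> (inv_into U \<phi>)"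
    and charts_cover: "(\<Union>(U, \<phi>)\<in>A. U) = UNIV"
    and charts_compatible: "(U, \<phi>) \<in> A \<Longrightarrow> (V, \<psi>) \<in> A \<Longrightarrow>
          smooth_on (\<phi> ` (U \<inter> V)) (\<psi> \<circ> inv_into U \<phi>)"
    and continuous_mult: "continuous_on UNIV (\<lambda>(x, y). x \<otimes> y)"
    and smooth_mult: "(U, \<phi>) \<in> A \<Longrightarrow> (V, \<psi>) \<in> A \<Longrightarrow> (W, \<theta>) \<in> A \<Longrightarrow>
          smooth_on {(a, b). a \<in> \<phi> ` U \<and> b \<in> \<psi> ` V \<and> inv_into U \<phi> a \<otimes> inv_into V \<psi> b \<in> W}
            (\<lambda>(a, b). \<theta> (inv_into U \<phi> a \<otimes> inv_into V \<psi> b))"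
    and continuous_inv: "continuous_on UNIV (\<lambda>x. inv x)"
    and smooth_inv: "(U, \<phi>) \<in> A \<Longrightarrow> (V, \<psi>) \<in> A \<Longrightarrow>
          smooth_on {a \<in> \<phi> ` U. inv (inv_into U \<phi> a) \<in> V} (\<lambda>a. \<psi> (inv (inv_into U \<phi> a)))"

definition smooth_fun ::
  "('g, 'e::real_normed_vector) chart set \<Rightarrow> ('g \<Rightarrow> 'b::real_normed_vector) \<Rightarrow> bool" where
  "smooth_fun A f \<longleftrightarrow> (\<forall>(U, \<phi>)\<in>A. smooth_on (\<phi> ` U) (f \<circ> inv_into U \<phi>))"

text \<open>By second countability, a Borel measure on \<open>G\<close> that is finite on compact sets is automatically
  regular.\<close>

definition left_haar_measure :: "('g::topological_space) monoid \<Rightarrow> 'g measure \<Rightarrow> bool" where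
  "left_haar_measure G \<mu> \<longleftrightarrow>
     sets \<mu> = sets borel \<and>
     (\<forall>K. compact K \<longrightarrow> emeasure \<mu> K < \<infinity>) \<and>
     emeasure \<mu> UNIV \<noteq> 0 \<and>
     (\<forall>g. \<forall>X\<in>sets borel. emeasure \<mu> ((\<lambda>x. g \<otimes>\<^bsub>G\<^esub> x) ` X) = emeasure \<mu> X)"


section \<open>Unitary representations and smooth vectors\<close>

definition unitary_rep ::
  "('g::topological_space) monoid \<Rightarrow> ('g \<Rightarrow> 'h \<Rightarrow>\<^sub>L 'h::complex_hilbert_space) \<Rightarrow> bool" where
  "unitary_rep G \<pi> \<longleftrightarrow>
     \<pi> \<one>\<^bsub>G\<^esub> = id_blinfun \<and>
     (\<forall>g h. \<pi> (g \<otimes>\<^bsub>G\<^esub> h) = \<pi> g o\<^sub>L \<pi> h) \<and>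
     (\<forall>g c x. \<pi> g (scaleC c x) = scaleC c (\<pi> g x)) \<and>
     (\<forall>g x y. cinner (\<pi> g x) (\<pi> g y) = cinner x y) \<and>
     (\<forall>x. continuous_on UNIV (\<lambda>g. \<pi> g x))"

definition irreducible_rep :: "('g \<Rightarrow> 'h \<Rightarrow>\<^sub>L 'h::complex_hilbert_space) \<Rightarrow> bool" where
  "irreducible_rep \<pi> \<longleftrightarrow>
     (\<exists>x::'h. x \<noteq> 0) \<and>
     (\<forall>W. closed W \<and> csubspace W \<and> (\<forall>g. \<forall>x\<in>W. \<pi> g x \<in> W) \<longrightarrow> W = {0} \<or> W = UNIV)"

text \<open>The Hilbert space dual, as the closed subspace of complex-linear functionals among the bounded
  real-linear ones; its norm is the operator norm. The pairing of \<open>u\<close> in the dual with \<open>v\<close> is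
  \<open>u v\<close>.\<close>

definition hilbert_dual :: "('h::complex_hilbert_space \<Rightarrow>\<^sub>L complex) set" where
  "hilbert_dual = {u. clinear_on UNIV (blinfun_apply u)}"

definition contragredient ::
  "'g monoid \<Rightarrow> ('g \<Rightarrow> 'h \<Rightarrow>\<^sub>L 'h) \<Rightarrow> 'g \<Rightarrow> ('h::complex_hilbert_space \<Rightarrow>\<^sub>L complex) \<Rightarrow> ('h \<Rightarrow>\<^sub>L complex)"
  where "contragredient G \<pi> g u = u o\<^sub>L \<pi> (inv\<^bsub>G\<^esub> g)"

text \<open>The following notions are used both for \<open>\<pi>\<close> acting on the whole type \<open>'h\<close> and for the
  contragredient acting on the subspace \<open>hilbert_dual\<close>; so \<open>\<rho>\<close> is an action of the group on a
  subspace \<open>V\<close> of a type.\<close>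

definition smooth_vectors ::
  "('g, 'e::real_normed_vector) chart set \<Rightarrow> 'v::real_normed_vector set \<Rightarrow> ('g \<Rightarrow> 'v \<Rightarrow> 'v) \<Rightarrow> 'v set"
  where "smooth_vectors A V \<rho> = {v \<in> V. smooth_fun A (\<lambda>g. \<rho> g v)}"

definition id_chart :: "'g monoid \<Rightarrow> ('g, 'e) chart set \<Rightarrow> ('g, 'e) chart" where
  "id_chart G A = (SOME c. c \<in> A \<and> \<one>\<^bsub>G\<^esub> \<in> fst c)"

text \<open>The Lie algebra, i.e. the tangent space of \<open>G\<close> at the identity, is identified with the model
  space \<open>'e\<close> by a chart at the identity. The operator of \<open>\<xi>\<close> is the derivative of the orbit map at
  the identity in the direction of \<open>\<xi>\<close>, which for a smooth vector \<open>v\<close> is the derivative of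
  \<open>\<rho> (exp (t \<xi>)) v\<close> at \<open>t = 0\<close>.\<close>

definition lie_rep ::
  "'g monoid \<Rightarrow> ('g, 'e::real_normed_vector) chart set \<Rightarrow> ('g \<Rightarrow> 'v \<Rightarrow> 'v) \<Rightarrow> 'e \<Rightarrow> 'v \<Rightarrow> 'v::real_normed_vector"
  where "lie_rep G A \<rho> \<xi> v =
    (case id_chart G A of (U, \<phi>) \<Rightarrow>
       frechet_derivative (\<lambda>a. \<rho> (inv_into U \<phi> a) v) (at (\<phi> \<one>\<^bsub>G\<^esub>)) \<xi>)"

text \<open>An element of the universal enveloping algebra is represented by a finite formal sum
  \<open>\<Sum>i. c\<^sub>i \<xi>\<^sub>i\<^sub>1 \<cdots> \<xi>\<^sub>i\<^sub>k\<close> of words in the Lie algebra. The enveloping algebra is a quotient of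
  the algebra of these sums, and the operator on smooth vectors depends only on the class; so the
  operators \<open>uea_rep G A \<rho> D\<close> on smooth vectors are exactly those of the elements of the enveloping
  algebra, and no quotient is formed.\<close>

type_synonym 'e uea = "(real \<times> 'e list) list"

definition uea_rep ::
  "'g monoid \<Rightarrow> ('g, 'e::real_normed_vector) chart set \<Rightarrow> ('g \<Rightarrow> 'v \<Rightarrow> 'v) \<Rightarrow> 'e uea \<Rightarrow> 'v \<Rightarrow> 'v::real_normed_vector"
  where "uea_rep G A \<rho> D v = (\<Sum>(c, \<xi>s)\<leftarrow>D. c *\<^sub>R foldr (lie_rep G A \<rho>) \<xi>s v)"

definition smooth_vector_topology ::
  "'g monoid \<Rightarrow> ('g, 'e::real_normed_vector) chart set \<Rightarrow> 'v set \<Rightarrow> ('g \<Rightarrow> 'v \<Rightarrow> 'v)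
     \<Rightarrow> 'v::{real_normed_vector,complex_vector} topology"
  where "smooth_vector_topology G A V \<rho> =
    seminorm_topology (smooth_vectors A V \<rho>) (range (\<lambda>D v. norm (uea_rep G A \<rho> D v)))"

text \<open>The action on functionals on \<open>V\<close> that is dual to an action \<open>\<rho>\<close> on \<open>V\<close>.\<close>

definition dual_action ::
  "'g monoid \<Rightarrow> 'v set \<Rightarrow> ('g \<Rightarrow> 'v \<Rightarrow> 'v) \<Rightarrow> 'g \<Rightarrow> ('v \<Rightarrow> complex) \<Rightarrow> 'v \<Rightarrow> complex" where
  "dual_action G V \<rho> g \<psi> = zero_extend V (\<lambda>v. \<psi> (\<rho> (inv\<^bsub>G\<^esub> g) v))"

text \<open>In the names below, \<open>dual\<close> marks the objects attached to the contragredient representation: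
  the smooth vectors of the dual Hilbert space, and \<open>dual_distribution_vectors\<close>, the distribution
  vectors of the dual Hilbert space (the topological dual of the smooth vectors of \<open>\<pi>\<close>).\<close>

definition pi_smooth ::
  "('g, 'e::real_normed_vector) chart set \<Rightarrow> ('g \<Rightarrow> 'h \<Rightarrow>\<^sub>L 'h) \<Rightarrow> 'h::complex_hilbert_space set" where
  "pi_smooth A \<pi> = smooth_vectors A UNIV (\<lambda>g. blinfun_apply (\<pi> g))"

definition dual_smooth ::
  "'g monoid \<Rightarrow> ('g, 'e::real_normed_vector) chart set \<Rightarrow> ('g \<Rightarrow> 'h \<Rightarrow>\<^sub>L 'h)
     \<Rightarrow> ('h::complex_hilbert_space \<Rightarrow>\<^sub>L complex) set" where
  "dual_smooth G A \<pi> = smooth_vectors A hilbert_dual (contragredient G \<pi>)"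

definition distribution_vectors ::
  "'g monoid \<Rightarrow> ('g, 'e::real_normed_vector) chart set \<Rightarrow> ('g \<Rightarrow> 'h \<Rightarrow>\<^sub>L 'h)
     \<Rightarrow> (('h::complex_hilbert_space \<Rightarrow>\<^sub>L complex) \<Rightarrow> complex) set" where
  "distribution_vectors G A \<pi> =
     top_dual (smooth_vector_topology G A hilbert_dual (contragredient G \<pi>))"

definition dual_distribution_vectors ::
  "'g monoid \<Rightarrow> ('g, 'e::real_normed_vector) chart set \<Rightarrow> ('g \<Rightarrow> 'h \<Rightarrow>\<^sub>L 'h)
     \<Rightarrow> ('h::complex_hilbert_space \<Rightarrow> complex) set" where
  "dual_distribution_vectors G A \<pi> =
     top_dual (smooth_vector_topology G A UNIV (\<lambda>g. blinfun_apply (\<pi> g)))"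

definition act_distribution_vector ::
  "'g monoid \<Rightarrow> ('g, 'e::real_normed_vector) chart set \<Rightarrow> ('g \<Rightarrow> 'h \<Rightarrow>\<^sub>L 'h) \<Rightarrow> 'g
     \<Rightarrow> (('h::complex_hilbert_space \<Rightarrow>\<^sub>L complex) \<Rightarrow> complex) \<Rightarrow> ('h \<Rightarrow>\<^sub>L complex) \<Rightarrow> complex" where
  "act_distribution_vector G A \<pi> = dual_action G (dual_smooth G A \<pi>) (contragredient G \<pi>)"

definition act_dual_distribution_vector ::
  "'g monoid \<Rightarrow> ('g, 'e::real_normed_vector) chart set \<Rightarrow> ('g \<Rightarrow> 'h \<Rightarrow>\<^sub>L 'h) \<Rightarrow> 'g
     \<Rightarrow> ('h::complex_hilbert_space \<Rightarrow> complex) \<Rightarrow> 'h \<Rightarrow> complex" where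
  "act_dual_distribution_vector G A \<pi> =
     dual_action G (pi_smooth A \<pi>) (\<lambda>g. blinfun_apply (\<pi> g))"

text \<open>The inclusion of the dual Hilbert space into its distribution vectors.\<close>

definition embed_dual ::
  "('g, 'e::real_normed_vector) chart set \<Rightarrow> ('g \<Rightarrow> 'h \<Rightarrow>\<^sub>L 'h)
     \<Rightarrow> ('h::complex_hilbert_space \<Rightarrow>\<^sub>L complex) \<Rightarrow> 'h \<Rightarrow> complex" where
  "embed_dual A \<pi> u = zero_extend (pi_smooth A \<pi>) (blinfun_apply u)"


section \<open>Test functions and distributions on \<open>G\<close>\<close>

definition test_functions_in ::
  "('g::topological_space, 'e::real_normed_vector) chart set \<Rightarrow> 'g set \<Rightarrow> ('g \<Rightarrow> complex) set" where
  "test_functions_in A K = {f. smooth_fun A f \<and> closure {g. f g \<noteq> 0} \<subseteq> K}"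

definition test_functions ::
  "('g::topological_space, 'e::real_normed_vector) chart set \<Rightarrow> ('g \<Rightarrow> complex) set" where
  "test_functions A = {f. smooth_fun A f \<and> compact (closure {g. f g \<noteq> 0})}"

definition deriv_seminorm ::
  "('g, 'e::real_normed_vector) chart \<Rightarrow> 'g set \<Rightarrow> 'e list \<Rightarrow> ('g \<Rightarrow> complex) \<Rightarrow> real" where
  "deriv_seminorm c L \<xi>s f =
     (case c of (U, \<phi>) \<Rightarrow> SUP a\<in>\<phi> ` L. cmod (iterated_deriv \<xi>s (f \<circ> inv_into U \<phi>) a))"

text \<open>The Frechet topology of uniform convergence of all derivatives on compact sets.\<close>

definition test_topology_in ::
  "('g::topological_space, 'e::real_normed_vector) chart set \<Rightarrow> 'g set \<Rightarrow> ('g \<Rightarrow> complex) topology"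
  where "test_topology_in A K =
    seminorm_topology (test_functions_in A K)
      {deriv_seminorm c L \<xi>s | c L \<xi>s. c \<in> A \<and> compact L \<and> L \<noteq> {} \<and> L \<subseteq> fst c}"

text \<open>The locally convex inductive limit topology over the compact sets \<open>K\<close>: it is generated by all
  seminorms whose restrictions to the spaces of test functions supported in \<open>K\<close> are continuous.\<close>

definition test_topology ::
  "('g::topological_space, 'e::real_normed_vector) chart set \<Rightarrow> ('g \<Rightarrow> complex) topology" where
  "test_topology A =
     seminorm_topology (test_functions A)
       {p. seminorm_on (test_functions A) p \<and>
           (\<forall>K. compact K \<longrightarrow> continuous_map (test_topology_in A K) euclideanreal p)}"

definition distributions ::
  "('g::topological_space, 'e::real_normed_vector) chart set \<Rightarrow> (('g \<Rightarrow> complex) \<Rightarrow> complex) set" where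
  "distributions A = top_dual (test_topology A)"

definition left_translate :: "'g monoid \<Rightarrow> 'g \<Rightarrow> ('g \<Rightarrow> complex) \<Rightarrow> 'g \<Rightarrow> complex" where
  "left_translate G h f = (\<lambda>g. f (inv\<^bsub>G\<^esub> h \<otimes>\<^bsub>G\<^esub> g))"

definition left_translate_distribution ::
  "('g::topological_space) monoid \<Rightarrow> ('g, 'e::real_normed_vector) chart set \<Rightarrow> 'g
     \<Rightarrow> (('g \<Rightarrow> complex) \<Rightarrow> complex) \<Rightarrow> ('g \<Rightarrow> complex) \<Rightarrow> complex" where
  "left_translate_distribution G A = dual_action G (test_functions A) (left_translate G)"

text \<open>Integrability is required explicitly because the integral of a non-integrable function is 0.\<close>

definition identified_with_function ::
  "('g::topological_space, 'e::real_normed_vector) chart set \<Rightarrow> 'g measure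
     \<Rightarrow> (('g \<Rightarrow> complex) \<Rightarrow> complex) \<Rightarrow> ('g \<Rightarrow> complex) \<Rightarrow> bool" where
  "identified_with_function A \<mu> T F \<longleftrightarrow>
     (\<forall>f\<in>test_functions A. integrable \<mu> (\<lambda>g. F g * f g) \<and> T f = (\<integral>g. F g * f g \<partial>\<mu>))"


section \<open>The matrix coefficient map\<close>

definition matrix_coefficient_map ::
  "('g::topological_space) monoid \<Rightarrow> ('g, 'e::real_normed_vector) chart set \<Rightarrow> 'g measure
     \<Rightarrow> ('g \<Rightarrow> 'h \<Rightarrow>\<^sub>L 'h) \<Rightarrow> (('h::complex_hilbert_space \<Rightarrow>\<^sub>L complex) \<Rightarrow> complex)
     \<Rightarrow> (('h \<Rightarrow> complex) \<Rightarrow> ('g \<Rightarrow> complex) \<Rightarrow> complex) \<Rightarrow> bool" where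
  "matrix_coefficient_map G A \<mu> \<pi> \<zeta> M \<longleftrightarrow>
     M ` dual_distribution_vectors G A \<pi> \<subseteq> distributions A \<and>
     continuous_on (dual_distribution_vectors G A \<pi>) M \<and>
     (\<forall>h. \<forall>\<eta>\<in>dual_distribution_vectors G A \<pi>.
        M (act_dual_distribution_vector G A \<pi> h \<eta>) = left_translate_distribution G A h (M \<eta>)) \<and>
     (\<forall>v\<in>dual_smooth G A \<pi>.
        (\<forall>g. act_distribution_vector G A \<pi> g \<zeta> v = \<zeta> (contragredient G \<pi> (inv\<^bsub>G\<^esub> g) v)) \<and>
        identified_with_function A \<mu> (M (embed_dual A \<pi> v))
          (\<lambda>g. act_distribution_vector G A \<pi> g \<zeta> v))"

end

theory Submission
  imports Defs
begin

text \<open>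
  A functional on smooth vectors that is continuous for finitely many of the seminorms
  \<open>v \<mapsto> \<parallel>D\<^sub>i v\<parallel>\<close> has the form \<open>v \<mapsto> \<Sum>\<^sub>i \<langle>D\<^sub>i v, y\<^sub>i\<rangle>\<close> with \<open>y\<^sub>i \<in> H\<close>. Apply this to \<open>\<zeta>\<close>, and use
  \<open>D \<pi>(g\<inverse>) v = \<Sum>\<^sub>j c\<^sub>j(g) \<pi>(g\<inverse>) D\<^sub>j v\<close> with smooth coefficients \<open>c\<^sub>j\<close> (the adjoint action): for a test
  function \<open>f\<close>, the functional \<open>v \<mapsto> \<integral> f(g) \<zeta>(\<pi>\<^sup>c(g\<inverse>) v) dg\<close> is then given by the vector
  \<open>\<pi>(f) \<zeta> = \<Sum>\<^sub>j D\<^sub>j\<^sup>t \<pi>(f c\<^sub>j) x\<^sub>j\<close>, a sum of derivatives of smeared vectors of \<open>H\<close>. Hence it is smooth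
  and depends continuously on \<open>f\<close>, and the map is \<open>M \<eta> f = \<eta> (\<pi>(f) \<zeta>)\<close>. No modular function is
  needed, since the coefficients \<open>c\<^sub>j\<close> replace an integration by parts on the right.

  Uniqueness follows from weak-* density of the smooth vectors of the dual: in the representation of
  \<open>\<eta>\<close>, approximate the \<open>y\<^sub>i\<close> by smooth vectors. For injectivity, suppose that \<open>\<eta>\<close> vanishes on all
  \<open>\<pi>(f) \<zeta>\<close>. These vectors are dense in \<open>H\<close> by irreducibility, and \<open>x \<mapsto> \<eta> (\<pi>(f) x)\<close> is continuous on
  \<open>H\<close> and vanishes on them, so it is zero; letting \<open>f\<close> approximate the unit mass at the identity gives
  \<open>\<eta> = 0\<close>.
\<close>

section \<open>Calculus of smooth maps\<close>

text \<open>The obstacle is that the operators of the Lie algebra are unbounded, while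
  \<open>\<zeta>\<close> and \<open>\<eta>\<close> are continuous only for norms that involve them.
  Such an operator is therefore never left on a vector that is merely in H. On a smeared vector it
  becomes a differential operator on the test function, because pi(k) pi(f) x = pi(L(k) f) x by left
  invariance of the measure; between smooth vectors it crosses the inner product by skew-symmetry.
  Continuity in f then rests on the fact that the operators obtained on test functions have smooth
  coefficients in every chart.

  Vectors such as pi(f) x are defined through their pairings, so that only complex-valued functions
  are integrated, and identities between vectors are checked on pairings with a dense set. The dual
  Hilbert space is identified with H by the Riesz map. As this map is conjugate-linear,
  \<open>\<zeta>\<close> becomes conjugate-linear in the vector of H, whereas \<open>\<eta>\<close>
  stays linear.\<close>

lemma frechet_derivative_cong_open:
  assumes "open S" "x \<in> S" "\<And>y. y \<in> S \<Longrightarrow> f y = g y"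
  shows "frechet_derivative f (at x) = frechet_derivative g (at x)"
proof -
  have "(f has_derivative d) (at x) \<longleftrightarrow> (g has_derivative d) (at x)" for d
    using assms by (metis has_derivative_transform_within_open)
  then show ?thesis by (simp add: frechet_derivative_def)
qed

lemma differentiable_cong_open:
  assumes "open S" "x \<in> S" "\<And>y. y \<in> S \<Longrightarrow> f y = g y"
  shows "f differentiable (at x) \<longleftrightarrow> g differentiable (at x)"
  using assms unfolding differentiable_def by (metis has_derivative_transform_within_open)

text \<open>The head of the list is differentiated last, so its final entry acts directly on
  \<open>f\<close>. An induction on the order can therefore replace \<open>f\<close> by one of its
  derivatives.\<close>

lemma iterated_deriv_snoc:
  "iterated_deriv (\<xi>s @ [\<xi>]) f = iterated_deriv \<xi>s (\<lambda>x. frechet_derivative f (at x) \<xi>)"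
  by (induction \<xi>s) auto

lemma iterated_deriv_cong_open:
  assumes "open S" "\<And>y. y \<in> S \<Longrightarrow> f y = g y" "x \<in> S"
  shows "iterated_deriv \<xi>s f x = iterated_deriv \<xi>s g x"
  using assms(3)
proof (induction \<xi>s arbitrary: x)
  case (Cons \<xi> \<xi>s)
  then show ?case
    using frechet_derivative_cong_open[OF assms(1), of x "iterated_deriv \<xi>s f" "iterated_deriv \<xi>s g"]
    by simp
qed (use assms in auto)

text \<open>Directional derivatives of order up to \<open>k\<close> exist and are differentiable. This form, which peels
  off the innermost derivative, is the one on which the calculus rules can be proved by induction.\<close>

primrec diff_upto ::
  "nat \<Rightarrow> 'e::real_normed_vector set \<Rightarrow> ('e \<Rightarrow> 'b::real_normed_vector) \<Rightarrow> bool" where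
  "diff_upto 0 S f \<longleftrightarrow> (\<forall>x\<in>S. f differentiable (at x))"
| "diff_upto (Suc k) S f \<longleftrightarrow> (\<forall>x\<in>S. f differentiable (at x)) \<and>
     (\<forall>\<xi>. diff_upto k S (\<lambda>x. frechet_derivative f (at x) \<xi>))"

lemma diff_upto_iff:
  "diff_upto k S f \<longleftrightarrow> (\<forall>\<xi>s. length \<xi>s \<le> k \<longrightarrow> (\<forall>x\<in>S. iterated_deriv \<xi>s f differentiable (at x)))"
proof (induction k arbitrary: f)
  case (Suc k)
  show ?case
  proof
    assume L: "diff_upto (Suc k) S f"
    show "\<forall>\<xi>s. length \<xi>s \<le> Suc k \<longrightarrow> (\<forall>x\<in>S. iterated_deriv \<xi>s f differentiable (at x))"
    proof (intro allI impI)
      fix \<xi>s :: "'a list" assume l: "length \<xi>s \<le> Suc k"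
      show "\<forall>x\<in>S. iterated_deriv \<xi>s f differentiable (at x)"
      proof (cases \<xi>s rule: rev_cases)
        case (snoc ys y)
        then have "length ys \<le> k" using l by simp
        then show ?thesis using L Suc unfolding snoc iterated_deriv_snoc by simp
      qed (use L in simp)
    qed
  next
    assume R: "\<forall>\<xi>s. length \<xi>s \<le> Suc k \<longrightarrow> (\<forall>x\<in>S. iterated_deriv \<xi>s f differentiable (at x))"
    have "\<forall>x\<in>S. f differentiable (at x)" using R[rule_format, of "[]"] by simp
    moreover have "diff_upto k S (\<lambda>x. frechet_derivative f (at x) \<xi>)" for \<xi>
      unfolding Suc
    proof (intro allI impI)
      fix \<xi>s :: "'a list" assume "length \<xi>s \<le> k"
      then show "\<forall>x\<in>S. iterated_deriv \<xi>s (\<lambda>x. frechet_derivative f (at x) \<xi>) differentiable (at x)"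
        using R[rule_format, of "\<xi>s @ [\<xi>]"] by (simp add: iterated_deriv_snoc)
    qed
    ultimately show "diff_upto (Suc k) S f" by simp
  qed
qed simp

lemma smooth_on_iff_diff_upto: "smooth_on S f \<longleftrightarrow> (\<forall>k. diff_upto k S f)"
  unfolding smooth_on_def diff_upto_iff by blast

lemma diff_upto_differentiable: "diff_upto k S f \<Longrightarrow> x \<in> S \<Longrightarrow> f differentiable (at x)"
  by (cases k) auto

lemma diff_upto_Suc: "diff_upto (Suc k) S f \<Longrightarrow> diff_upto k S f"
  by (simp only: diff_upto_iff) auto

lemma diff_upto_cong:
  assumes "open S" "\<And>y. y \<in> S \<Longrightarrow> f y = g y" "diff_upto k S f"
  shows "diff_upto k S g"
  using assms(2,3)
proof (induction k arbitrary: f g)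
  case 0
  then show ?case using differentiable_cong_open[OF assms(1), of _ f g] by auto
next
  case (Suc k)
  have "diff_upto k S (\<lambda>x. frechet_derivative g (at x) \<xi>)" for \<xi>
    by (rule Suc.IH[of "\<lambda>x. frechet_derivative f (at x) \<xi>"])
      (use Suc.prems frechet_derivative_cong_open[OF assms(1), of _ f g] in auto)
  then show ?case using Suc.prems differentiable_cong_open[OF assms(1), of _ f g] by auto
qed

text \<open>Any explicit formula for the derivative on the open set may be used, since
  \<open>diff_upto\<close> does not change when a function is altered off that set.\<close>

lemma diff_upto_SucI:
  assumes "open S"
    and "\<And>x. x \<in> S \<Longrightarrow> (f has_derivative f' x) (at x)"
    and "\<And>\<xi>. diff_upto k S (\<lambda>x. f' x \<xi>)"
  shows "diff_upto (Suc k) S f"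
proof -
  have "diff_upto k S (\<lambda>x. frechet_derivative f (at x) \<xi>)" for \<xi>
    by (rule diff_upto_cong[OF assms(1) _ assms(3)[of \<xi>]])
      (use assms(2) frechet_derivative_at in metis)
  then show ?thesis using assms(2) by (auto simp: differentiable_def)
qed

lemma diff_upto_has_derivative:
  "diff_upto k S f \<Longrightarrow> x \<in> S \<Longrightarrow> (f has_derivative frechet_derivative f (at x)) (at x)"
  using diff_upto_differentiable frechet_derivative_works by blast

lemma diff_upto_const: "open S \<Longrightarrow> diff_upto k S (\<lambda>x. c)"
proof (induction k arbitrary: c)
  case (Suc k)
  then show ?case
    by (intro diff_upto_SucI[where f'="\<lambda>x \<xi>. 0"]) auto
qed simp

lemma diff_upto_bounded_linear:
  assumes "bounded_linear L" "open S" "diff_upto k S f"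
  shows "diff_upto k S (\<lambda>x. L (f x))"
  using assms(3)
proof (induction k arbitrary: f)
  case 0
  then show ?case
    by (auto simp: differentiable_def intro: bounded_linear.has_derivative[OF assms(1)])
next
  case (Suc k)
  show ?case
    by (rule diff_upto_SucI[OF assms(2)
          bounded_linear.has_derivative[OF assms(1) diff_upto_has_derivative[OF Suc.prems]]])
      (use Suc in auto)
qed

lemma diff_upto_add:
  assumes "open S" "diff_upto k S f" "diff_upto k S g"
  shows "diff_upto k S (\<lambda>x. f x + g x)"
  using assms(2,3)
proof (induction k arbitrary: f g)
  case 0
  then show ?case by (auto intro: differentiable_add)
next
  case (Suc k)
  show ?case
    by (rule diff_upto_SucI[OF assms(1) has_derivative_add])
      (use Suc diff_upto_has_derivative[OF Suc.prems(1)] diff_upto_has_derivative[OF Suc.prems(2)] in auto)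
qed

lemma diff_upto_sum:
  assumes "open S" "\<And>i. i \<in> I \<Longrightarrow> diff_upto k S (f i)"
  shows "diff_upto k S (\<lambda>x. \<Sum>i\<in>I. f i x)"
  using assms
  by (induction I rule: infinite_finite_induct) (auto intro: diff_upto_add diff_upto_const)

lemma diff_upto_bilinear:
  assumes "bounded_bilinear bil" "open S" "diff_upto k S f" "diff_upto k S g"
  shows "diff_upto k S (\<lambda>x. bil (f x) (g x))"
  using assms(3,4)
proof (induction k arbitrary: f g)
  case 0
  then show ?case
    unfolding diff_upto.simps differentiable_def
    using bounded_bilinear.FDERIV[OF assms(1), of f _ _ UNIV g] by blast
next
  case (Suc k)
  show ?case
    by (rule diff_upto_SucI[OF assms(2) bounded_bilinear.FDERIV[OF assms(1)
          diff_upto_has_derivative[OF Suc.prems(1)] diff_upto_has_derivative[OF Suc.prems(2)]]])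
      (use Suc.prems Suc.prems[THEN diff_upto_Suc] in \<open>auto intro!: diff_upto_add Suc.IH assms(2)\<close>)
qed

text \<open>This stands for a basis together with its dual basis. Boundedness of the coordinates
  makes them smooth, and the expansion reduces linear maps to their values in finitely many fixed
  directions.\<close>

definition frame :: "'e::real_normed_vector set \<Rightarrow> ('e \<Rightarrow> 'e \<Rightarrow> real) \<Rightarrow> bool" where
  "frame B c \<longleftrightarrow> finite B \<and> (\<forall>b. bounded_linear (c b)) \<and> (\<forall>x. (\<Sum>b\<in>B. c b x *\<^sub>R b) = x)"

lemma frame_apply:
  assumes "frame B c" "linear f"
  shows "f x = (\<Sum>b\<in>B. c b x *\<^sub>R f b)"
proof -
  have "f x = f (\<Sum>b\<in>B. c b x *\<^sub>R b)" using assms by (simp add: frame_def)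
  then show ?thesis using assms(2) by (simp add: linear_sum linear_scale)
qed

text \<open>In the chain rule the direction in which \<open>f\<close> is differentiated itself
  depends on \<open>x\<close>. Expanding that direction along the frame leaves a finite sum of a
  coordinate of the derivative of \<open>g\<close> times a derivative of \<open>f\<close> in a fixed
  direction, composed with \<open>g\<close>, and the induction hypothesis covers the latter.\<close>

lemma diff_upto_compose:
  fixes g :: "'x::real_normed_vector \<Rightarrow> 'y::real_normed_vector"
  assumes fr: "frame (B :: 'y set) c" and S: "open S" and T: "open T" and gS: "g ` S \<subseteq> T"
    and "diff_upto k S g" "diff_upto k T f"
  shows "diff_upto k S (\<lambda>x. f (g x))"
  using assms(5,6)
proof (induction k arbitrary: f)
  case 0
  then show ?case using gS differentiable_chain_at[of g _ f] by (auto simp: o_def)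
next
  case (Suc k)
  have d: "((\<lambda>x. f (g x)) has_derivative
     (\<lambda>\<xi>. \<Sum>b\<in>B. c b (frechet_derivative g (at x) \<xi>) *\<^sub>R frechet_derivative f (at (g x)) b)) (at x)"
    if "x \<in> S" for x
  proof -
    have "g x \<in> T" using that gS by auto
    then have f': "(f has_derivative frechet_derivative f (at (g x))) (at (g x))"
      using diff_upto_has_derivative[OF Suc.prems(2)] by blast
    then have l: "linear (frechet_derivative f (at (g x)))" by (rule has_derivative_linear)
    show ?thesis
      using diff_chain_at[OF diff_upto_has_derivative[OF Suc.prems(1) that] f']
      by (subst frame_apply[OF fr l, symmetric]) (simp add: o_def)
  qed
  show ?case
  proof (rule diff_upto_SucI[OF S d])
    fix \<xi>
    show "diff_upto k S (\<lambda>x. \<Sum>b\<in>B. c b (frechet_derivative g (at x) \<xi>) *\<^sub>R frechet_derivative f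
        (at (g x)) b)"
    proof (intro diff_upto_sum S diff_upto_bilinear[OF bounded_bilinear_scaleR S])
      fix b
      have "bounded_linear (c b)" using fr by (simp add: frame_def)
      moreover have "diff_upto k S (\<lambda>x. frechet_derivative g (at x) \<xi>)"
        using Suc.prems(1) by simp
      ultimately show "diff_upto k S (\<lambda>x. c b (frechet_derivative g (at x) \<xi>))"
        by (rule diff_upto_bounded_linear[OF _ S])
      have "diff_upto k T (\<lambda>y. frechet_derivative f (at y) b)" using Suc.prems(2) by simp
      then show "diff_upto k S (\<lambda>x. frechet_derivative f (at (g x)) b)"
        by (rule Suc.IH[OF diff_upto_Suc[OF Suc.prems(1)]])
    qed
  qed
qed

lemma smooth_on_subset: "smooth_on S f \<Longrightarrow> T \<subseteq> S \<Longrightarrow> smooth_on T f"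
  by (auto simp: smooth_on_def)

text \<open>Derivatives are taken at \<open>x\<close> in the whole space, so smoothness on a set is
  a condition on each of its points.\<close>

lemma smooth_on_local:
  "(\<And>x. x \<in> S \<Longrightarrow> \<exists>T. x \<in> T \<and> smooth_on T f) \<Longrightarrow> smooth_on S f"
  unfolding smooth_on_def by blast

lemma smooth_on_cong:
  assumes "open S" "smooth_on S f" "\<And>y. y \<in> S \<Longrightarrow> f y = g y"
  shows "smooth_on S g"
  using assms diff_upto_cong[OF assms(1,3)] by (auto simp: smooth_on_iff_diff_upto)

lemma smooth_on_deriv: "smooth_on S f \<Longrightarrow> smooth_on S (\<lambda>x. frechet_derivative f (at x) \<xi>)"
  unfolding smooth_on_iff_diff_upto by (metis diff_upto.simps(2))

lemma smooth_on_iterated_deriv: "smooth_on S f \<Longrightarrow> smooth_on S (iterated_deriv \<xi>s f)"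
  by (induction \<xi>s) (auto intro: smooth_on_deriv)

lemma smooth_on_differentiable: "smooth_on S f \<Longrightarrow> x \<in> S \<Longrightarrow> f differentiable (at x)"
  unfolding smooth_on_iff_diff_upto using diff_upto_differentiable by blast

lemma smooth_on_has_derivative:
  "smooth_on S f \<Longrightarrow> x \<in> S \<Longrightarrow> (f has_derivative frechet_derivative f (at x)) (at x)"
  using smooth_on_differentiable frechet_derivative_works by blast

lemma smooth_on_continuous: "smooth_on S f \<Longrightarrow> continuous_on S f"
  by (meson continuous_at_imp_continuous_on differentiable_imp_continuous_within smooth_on_differentiable)

lemma smooth_on_const: "open S \<Longrightarrow> smooth_on S (\<lambda>x. c)"
  by (simp add: smooth_on_iff_diff_upto diff_upto_const)

lemma smooth_on_linear_compose:
  "bounded_linear L \<Longrightarrow> open S \<Longrightarrow> smooth_on S f \<Longrightarrow> smooth_on S (\<lambda>x. L (f x))"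
  by (simp add: smooth_on_iff_diff_upto diff_upto_bounded_linear)

lemma smooth_on_ident: "open S \<Longrightarrow> smooth_on S (\<lambda>x. x)"
  unfolding smooth_on_iff_diff_upto
proof
  fix k assume S: "open S"
  show "diff_upto k S (\<lambda>x. x)"
  proof (cases k)
    case (Suc j)
    show ?thesis unfolding Suc
      by (rule diff_upto_SucI[OF S, where f'="\<lambda>x \<xi>. \<xi>"]) (auto intro: diff_upto_const S)
  qed simp
qed

lemma smooth_on_bounded_linear: "bounded_linear L \<Longrightarrow> open S \<Longrightarrow> smooth_on S L"
  using smooth_on_linear_compose[OF _ _ smooth_on_ident] by fastforce

lemma smooth_on_add:
  "open S \<Longrightarrow> smooth_on S f \<Longrightarrow> smooth_on S g \<Longrightarrow> smooth_on S (\<lambda>x. f x + g x)"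
  by (simp add: smooth_on_iff_diff_upto diff_upto_add)

lemma smooth_on_sum:
  "open S \<Longrightarrow> (\<And>i. i \<in> I \<Longrightarrow> smooth_on S (f i)) \<Longrightarrow> smooth_on S (\<lambda>x. \<Sum>i\<in>I. f i x)"
  by (simp add: smooth_on_iff_diff_upto diff_upto_sum)

lemma smooth_on_bilinear:
  "bounded_bilinear bil \<Longrightarrow> open S \<Longrightarrow> smooth_on S f \<Longrightarrow> smooth_on S g \<Longrightarrow>
    smooth_on S (\<lambda>x. bil (f x) (g x))"
  by (simp add: smooth_on_iff_diff_upto diff_upto_bilinear)

lemma smooth_on_Pair:
  assumes "open S" "smooth_on S f" "smooth_on S g"
  shows "smooth_on S (\<lambda>x. (f x, g x))"
proof -
  have "smooth_on S (\<lambda>x. (f x, 0) + (0, g x))"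
    by (intro smooth_on_add smooth_on_linear_compose[of "\<lambda>y. (y, 0)"]
        smooth_on_linear_compose[of "\<lambda>y. (0, y)"] assms bounded_linear_Pair
        bounded_linear_ident bounded_linear_zero)
  then show ?thesis by simp
qed

text \<open>Bootstrapping: a class of differentiable functions that contains its own directional
  derivatives, up to equality on \<open>S\<close>, consists of smooth functions. It serves the
  functions \<open>flat p\<close> and the smeared families.\<close>

lemma smooth_on_family:
  assumes "open S" "P f"
    and "\<And>f x. P f \<Longrightarrow> x \<in> S \<Longrightarrow> f differentiable (at x)"
    and "\<And>f \<xi>. P f \<Longrightarrow> \<exists>f'. P f' \<and> (\<forall>x\<in>S. f' x = frechet_derivative f (at x) \<xi>)"
  shows "smooth_on S f"
  unfolding smooth_on_iff_diff_upto
proof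
  fix k
  show "diff_upto k S f" using assms(2)
  proof (induction k arbitrary: f)
    case (Suc k)
    have "diff_upto k S (\<lambda>x. frechet_derivative f (at x) \<xi>)" for \<xi>
    proof -
      obtain f' where "P f'" "\<forall>x\<in>S. f' x = frechet_derivative f (at x) \<xi>"
        using assms(4) Suc.prems by blast
      then show ?thesis
        using diff_upto_cong[OF assms(1) _ Suc.IH[of f'], of "\<lambda>x. frechet_derivative f (at x) \<xi>"] by simp
    qed
    then show ?case using assms(3) Suc.prems by auto
  qed (use assms in auto)
qed

section \<open>Finite-dimensional normed spaces\<close>

definition fin_dim :: "'e::real_normed_vector itself \<Rightarrow> bool" where
  "fin_dim _ \<longleftrightarrow> (\<exists>B::'e set. finite B \<and> span B = UNIV)"

text \<open>Induction on \<open>B\<close>. If a new vector \<open>a\<close> had distance 0 from the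
  span of \<open>B\<close>, the coordinates of a sequence in that span tending to \<open>a\<close>
  would be Cauchy by the bound for \<open>B\<close>, and their limits would put \<open>a\<close>
  into the span. The positive distance \<open>d\<close> then controls the coefficient of
  \<open>a\<close>.\<close>

lemma independent_coordinates_bounded:
  fixes B :: "'e::real_normed_vector set"
  assumes "finite B" "independent B"
  shows "\<exists>C>0. \<forall>u. (\<Sum>b\<in>B. \<bar>u b\<bar>) \<le> C * norm (\<Sum>b\<in>B. u b *\<^sub>R b)"
  using assms
proof (induction B)
  case empty
  show ?case by (rule exI[of _ 1]) simp
next
  case (insert a B)
  then have ind: "independent B" "a \<notin> span B" by (auto simp: independent_insert)
  obtain C where C: "C > 0" "\<And>u. (\<Sum>b\<in>B. \<bar>u b\<bar>) \<le> C * norm (\<Sum>b\<in>B. u b *\<^sub>R b)"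
    using insert.IH[OF ind(1)] by auto
  have "\<exists>d>0. \<forall>y\<in>span B. d \<le> norm (a - y)"
  proof (rule ccontr)
    assume "\<not> ?thesis"
    then have "\<forall>n. \<exists>y\<in>span B. norm (a - y) < inverse (Suc n)"
      by (metis not_le inverse_positive_iff_positive of_nat_0_less_iff zero_less_Suc)
    then obtain y where y: "\<And>n. y n \<in> span B" "\<And>n. norm (a - y n) < inverse (Suc n)" by metis
    have "\<forall>n. \<exists>u. y n = (\<Sum>b\<in>B. u b *\<^sub>R b)"
      using y(1) insert.hyps(1) by (auto simp: span_finite)
    then obtain u where u: "\<And>n. y n = (\<Sum>b\<in>B. u n b *\<^sub>R b)" by metis
    have ya: "y \<longlonglongrightarrow> a"
    proof (rule LIMSEQ_I)
      fix r :: real assume "r > 0"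
      then obtain N where "inverse (Suc N) < r" using reals_Archimedean by blast
      then have "norm (y n - a) < r" if "n \<ge> N" for n
        using y(2)[of n] that by (smt (verit) inverse_le_iff_le norm_minus_commute of_nat_le_iff
            of_nat_0_less_iff zero_less_Suc Suc_le_mono)
      then show "\<exists>no. \<forall>n\<ge>no. norm (y n - a) < r" by blast
    qed
    have cu: "convergent (\<lambda>n. u n b)" if "b \<in> B" for b
    proof -
      have "Cauchy (\<lambda>n. u n b)"
      proof (rule metric_CauchyI)
        fix e :: real assume e: "e > 0"
        have "Cauchy y" using ya by (rule LIMSEQ_imp_Cauchy)
        then obtain M where M: "\<And>m n. m \<ge> M \<Longrightarrow> n \<ge> M \<Longrightarrow> dist (y m) (y n) < e / C"
          using e C(1) by (meson metric_CauchyD divide_pos_pos)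
        have "dist (u m b) (u n b) < e" if "m \<ge> M" "n \<ge> M" for m n
        proof -
          have "\<bar>u m b - u n b\<bar> \<le> (\<Sum>b\<in>B. \<bar>u m b - u n b\<bar>)"
            using \<open>b \<in> B\<close> insert.hyps(1) by (intro member_le_sum) auto
          also have "\<dots> \<le> C * norm (y m - y n)"
            using C(2)[of "\<lambda>b. u m b - u n b"] by (simp add: u scaleR_diff_left sum_subtractf)
          also have "\<dots> < e" using M[OF that] C(1)
            by (simp add: dist_norm field_simps)
          finally show ?thesis by (simp add: dist_real_def)
        qed
        then show "\<exists>M. \<forall>m\<ge>M. \<forall>n\<ge>M. dist (u m b) (u n b) < e" by blast
      qed
      then show ?thesis by (simp add: Cauchy_convergent_iff)
    qed
    have "y \<longlonglongrightarrow> (\<Sum>b\<in>B. lim (\<lambda>n. u n b) *\<^sub>R b)"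
      unfolding u using cu by (intro tendsto_intros) (auto simp: convergent_LIMSEQ_iff)
    then have "a = (\<Sum>b\<in>B. lim (\<lambda>n. u n b) *\<^sub>R b)" using ya LIMSEQ_unique by blast
    moreover have "(\<Sum>b\<in>B. lim (\<lambda>n. u n b) *\<^sub>R b) \<in> span B"
      by (intro span_sum span_scale span_base)
    ultimately have "a \<in> span B" by simp
    then show False using ind(2) by simp
  qed
  then obtain d where d: "d > 0" "\<And>y. y \<in> span B \<Longrightarrow> d \<le> norm (a - y)" by auto
  \<comment> \<open>\<open>1/d\<close> bounds the coefficient of \<open>a\<close>. What remains of
    the vector has norm at most \<open>1 + norm a / d\<close> times that of the whole, and the
    constant \<open>C\<close> for \<open>B\<close> applies to it.\<close>
  define K where "K = 1/d + C * (1 + norm a / d)"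
  have "(\<Sum>b\<in>insert a B. \<bar>u b\<bar>) \<le> K * norm (\<Sum>b\<in>insert a B. u b *\<^sub>R b)" for u
  proof -
    define s where "s = (\<Sum>b\<in>B. u b *\<^sub>R b)"
    define v where "v = u a *\<^sub>R a + s"
    have s: "s \<in> span B" unfolding s_def by (intro span_sum span_scale span_base)
    have ua: "\<bar>u a\<bar> \<le> norm v / d"
    proof (cases "u a = 0")
      case False
      have "d \<le> norm (a - (- inverse (u a)) *\<^sub>R s)" by (rule d(2)) (intro span_scale s)
      also have "a - (- inverse (u a)) *\<^sub>R s = inverse (u a) *\<^sub>R v"
        using False by (simp add: v_def scaleR_add_right)
      also have "norm \<dots> = norm v / \<bar>u a\<bar>" by (simp add: divide_inverse mult.commute)
      finally show ?thesis using False d(1) by (simp add: field_simps)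
    qed (use d in simp)
    have "norm s \<le> norm v + \<bar>u a\<bar> * norm a"
      using norm_triangle_ineq4[of v "u a *\<^sub>R a"] by (simp add: v_def)
    also have "\<dots> \<le> norm v + norm v / d * norm a" using ua by (intro add_mono mult_right_mono) auto
    finally have "C * norm s \<le> C * (norm v + norm v / d * norm a)" using C(1) by simp
    then have "\<bar>u a\<bar> + (\<Sum>b\<in>B. \<bar>u b\<bar>) \<le> norm v / d + C * (norm v + norm v / d * norm a)"
      using ua C(2)[of u] by (simp add: s_def)
    also have "\<dots> = K * norm v" by (simp add: K_def algebra_simps)
    finally show ?thesis using insert.hyps by (simp add: v_def s_def)
  qed
  moreover have "K > 0" using C(1) d(1) by (simp add: K_def add_pos_nonneg)
  ultimately show ?case by blast
qed

lemma fin_dim_frame: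
  assumes "fin_dim TYPE('e::real_normed_vector)"
  obtains B :: "'e::real_normed_vector set" and c where "frame B c"
proof -
  obtain B' :: "'e set" where B': "finite B'" "span B' = UNIV" using assms by (auto simp: fin_dim_def)
  obtain B where B: "B \<subseteq> B'" "independent B" "B' \<subseteq> span B"
    using maximal_independent_subset by blast
  have fin: "finite B" using B B' finite_subset by blast
  have sp: "span B = UNIV" using B B' by (metis span_mono span_span top.extremum_uniqueI)
  obtain C where C: "C > 0" "\<And>u. (\<Sum>b\<in>B. \<bar>u b\<bar>) \<le> C * norm (\<Sum>b\<in>B. u b *\<^sub>R b)"
    using independent_coordinates_bounded[OF fin B(2)] by auto
  define c where "c b x = representation B x b" for b x
  have sum: "(\<Sum>b\<in>B. c b x *\<^sub>R b) = x" for x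
    unfolding c_def using sum_representation_eq[OF B(2), of x B] fin sp by auto
  have "bounded_linear (c b)" for b
  proof (rule bounded_linear_intro)
    show "c b (x + y) = c b x + c b y" for x y
      by (simp add: c_def representation_add B(2) sp)
    show "c b (r *\<^sub>R x) = r *\<^sub>R c b x" for r x
      by (simp add: c_def representation_scale B(2) sp)
    show "norm (c b x) \<le> norm x * C" for x
    proof (cases "b \<in> B")
      case True
      have "\<bar>c b x\<bar> \<le> (\<Sum>b\<in>B. \<bar>c b x\<bar>)" using True fin by (intro member_le_sum) auto
      also have "\<dots> \<le> C * norm x" using C(2)[of "\<lambda>b. c b x"] by (simp add: sum)
      finally show ?thesis by (simp add: mult.commute)
    next
      case False
      then have "c b x = 0" unfolding c_def using representation_ne_zero by blast
      then show ?thesis using C(1) by simp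
    qed
  qed
  then show thesis using that[of B c] fin sum by (simp add: frame_def)
qed

lemma fin_dim_prod:
  assumes "fin_dim TYPE('x::real_normed_vector)" "fin_dim TYPE('y::real_normed_vector)"
  shows "fin_dim TYPE('x \<times> 'y)"
proof -
  obtain B :: "'x set" and B' :: "'y set"
    where B: "finite B" "span B = UNIV" "finite B'" "span B' = UNIV"
    using assms by (auto simp: fin_dim_def)
  let ?D = "(\<lambda>b. (b, 0)) ` B \<union> (\<lambda>b. (0, b)) ` B'"
  have "(x, y) \<in> span ?D" for x y
  proof -
    have l: "linear (\<lambda>b::'x. (b, 0::'y))" "linear (\<lambda>b::'y. (0::'x, b))"
      by (auto intro!: linearI)
    have "(x, 0::'y) \<in> span ((\<lambda>b. (b, 0)) ` B)" "(0::'x, y) \<in> span ((\<lambda>b. (0, b)) ` B')"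
      unfolding linear_span_image[OF l(1)] linear_span_image[OF l(2)] B by simp_all
    then have "(x, 0) + (0, y) \<in> span ?D"
      by (intro span_add) (meson Un_upper1 Un_upper2 span_mono subsetD)+
    then show ?thesis by simp
  qed
  then have "span ?D = UNIV" by auto
  then show ?thesis unfolding fin_dim_def using B by (metis finite_Un finite_imageI)
qed

lemma fin_dim_real: "fin_dim TYPE(real)"
  unfolding fin_dim_def
proof (intro exI conjI)
  show "span {1::real} = UNIV"
    by (auto simp: span_singleton)
qed simp

lemma smooth_on_compose:
  fixes g :: "'x::real_normed_vector \<Rightarrow> 'y::real_normed_vector"
  assumes "fin_dim TYPE('y)" "open S" "open T" "g ` S \<subseteq> T" "smooth_on S g" "smooth_on T f"
  shows "smooth_on S (\<lambda>x. f (g x))"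
proof -
  obtain B :: "'y set" and c where "frame B c" using fin_dim_frame assms(1) by blast
  from diff_upto_compose[OF this assms(2-4)] show ?thesis
    using assms(5,6) unfolding smooth_on_iff_diff_upto by blast
qed

lemma frechet_derivative_partial:
  assumes "F differentiable (at (x, y))"
  shows "((\<lambda>x. F (x, y)) has_derivative (\<lambda>\<xi>. frechet_derivative F (at (x, y)) (\<xi>, 0))) (at x)"
    and "((\<lambda>y. F (x, y)) has_derivative (\<lambda>\<xi>. frechet_derivative F (at (x, y)) (0, \<xi>))) (at y)"
proof -
  have F: "(F has_derivative frechet_derivative F (at (x, y))) (at (x, y))"
    using assms frechet_derivative_works by blast
  have "((\<lambda>x. (x, y)) has_derivative (\<lambda>\<xi>. (\<xi>, 0))) (at x)"
    "((\<lambda>y. (x, y)) has_derivative (\<lambda>\<xi>. (0, \<xi>))) (at y)"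
    by (auto intro!: derivative_eq_intros)
  from diff_chain_at[OF this(1) F] diff_chain_at[OF this(2) F]
  show "((\<lambda>x. F (x, y)) has_derivative (\<lambda>\<xi>. frechet_derivative F (at (x, y)) (\<xi>, 0))) (at x)"
    "((\<lambda>y. F (x, y)) has_derivative (\<lambda>\<xi>. frechet_derivative F (at (x, y)) (0, \<xi>))) (at y)"
    by (simp_all add: o_def)
qed

text \<open>A partial derivative is the full derivative in a direction with one zero component,
  hence smooth in both variables jointly. This yields smooth dependence on a parameter of
  derivatives taken at a fixed point, such as the identity of the group.\<close>

lemma smooth_on_partial:
  assumes "open S" "smooth_on S F"
  shows "smooth_on S (\<lambda>(x, y). frechet_derivative (\<lambda>x. F (x, y)) (at x) \<xi>)"
    and "smooth_on S (\<lambda>(x, y). frechet_derivative (\<lambda>y. F (x, y)) (at y) \<xi>')"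
proof -
  have "frechet_derivative (\<lambda>x. F (x, y)) (at x) \<xi> = frechet_derivative F (at (x, y)) (\<xi>, 0)"
   "frechet_derivative (\<lambda>y. F (x, y)) (at y) \<xi>' = frechet_derivative F (at (x, y)) (0, \<xi>')"
    if "(x, y) \<in> S" for x y
    using frechet_derivative_partial[OF smooth_on_differentiable[OF assms(2) that]]
      frechet_derivative_at by metis+
  then show "smooth_on S (\<lambda>(x, y). frechet_derivative (\<lambda>x. F (x, y)) (at x) \<xi>)"
    "smooth_on S (\<lambda>(x, y). frechet_derivative (\<lambda>y. F (x, y)) (at y) \<xi>')"
    using smooth_on_cong[OF assms(1) smooth_on_deriv[OF assms(2)], of "(\<xi>, 0)"]
      smooth_on_cong[OF assms(1) smooth_on_deriv[OF assms(2)], of "(0, \<xi>')"] by auto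
qed

section \<open>Smooth maps into a Lie group\<close>

lemma compact_closed_subset:
  assumes "compact K" "closed C" "C \<subseteq> K"
  shows "compact C"
  using compact_Int_closed[OF assms(1,2)] assms(3) by (simp add: inf.absorb2)

text \<open>For \<open>p = 1\<close> this is the usual flat function exp(-1/t). The polynomial in
  1/t makes the class closed under differentiation.\<close>

definition flat :: "real poly \<Rightarrow> real \<Rightarrow> real" where
  "flat p t = (if t > 0 then poly p (inverse t) * exp (- inverse t) else 0)"

text \<open>With s = 1/t this is the decay of p(s) exp(-s) at infinity.\<close>

lemma flat_tendsto_0: "(flat p \<longlongrightarrow> 0) (at_right 0)"
proof -
  have "((\<lambda>s. \<Sum>i\<le>degree p. coeff p i * (s ^ i / exp s)) \<longlongrightarrow> (\<Sum>i\<le>degree p. coeff p i * 0)) at_top"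
    by (intro tendsto_intros tendsto_power_div_exp_0)
  then have "((\<lambda>s. poly p s * exp (- s)) \<longlongrightarrow> 0) at_top"
    by (simp add: poly_altdef sum_distrib_right exp_minus divide_inverse mult.assoc)
  then have "((\<lambda>t. poly p (inverse t) * exp (- inverse t)) \<longlongrightarrow> 0) (at_right 0)"
    using filterlim_inverse_at_top_right by (rule filterlim_compose)
  moreover have "\<forall>\<^sub>F t in at_right (0::real). poly p (inverse t) * exp (- inverse t) = flat p t"
    by (auto simp: flat_def eventually_at_filter)
  ultimately show ?thesis by (rule Lim_transform_eventually)
qed

text \<open>For t > 0 the derivative of p(1/t) exp(-1/t) is (p - p')(1/t) exp(-1/t) / t^2, and the
  factor \<open>[:0, 0, 1:]\<close> is 1/t^2. At 0 the right difference quotient is again a function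
  of the class, which tends to 0.\<close>

lemma flat_has_derivative:
  "(flat p has_field_derivative flat ((p - pderiv p) * [:0, 0, 1:]) t) (at t)"
proof -
  consider "t > 0" | "t < 0" | "t = 0" by linarith
  then show ?thesis
  proof cases
    case 1
    have "((\<lambda>t. poly p (inverse t) * exp (- inverse t)) has_field_derivative
        flat ((p - pderiv p) * [:0, 0, 1:]) t) (at t)"
      using 1 by (auto intro!: derivative_eq_intros DERIV_chain2[OF poly_DERIV]
          simp: flat_def field_simps power2_eq_square)
    then show ?thesis
      by (rule has_field_derivative_transform_within_open[where S="{0<..}"])
        (use 1 in \<open>auto simp: flat_def\<close>)
  next
    case 2
    have "((\<lambda>t. 0) has_field_derivative 0) (at t)" by simp
    then have "(flat p has_field_derivative 0) (at t)"
      by (rule has_field_derivative_transform_within_open[where S="{..<0}"])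
        (use 2 in \<open>auto simp: flat_def\<close>)
    then show ?thesis using 2 by (simp add: flat_def)
  next
    case 3
    have "((\<lambda>y. (flat p y - flat p 0) / (y - 0)) \<longlongrightarrow> 0) (at_left 0)"
      by (rule tendsto_eventually) (auto simp: flat_def eventually_at_filter)
    moreover have "((\<lambda>y. (flat p y - flat p 0) / (y - 0)) \<longlongrightarrow> 0) (at_right 0)"
    proof (rule Lim_transform_eventually[OF flat_tendsto_0[of "p * [:0, 1:]"]])
      show "\<forall>\<^sub>F y in at_right 0. flat (p * [:0, 1:]) y = (flat p y - flat p 0) / (y - 0)"
        by (auto simp: flat_def eventually_at_filter divide_inverse)
    qed
    ultimately have "((\<lambda>y. (flat p y - flat p 0) / (y - 0)) \<longlongrightarrow> 0) (at 0)"
      using filterlim_split_at by blast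
    then show ?thesis using 3 by (simp add: has_field_derivative_iff flat_def)
  qed
qed

lemma smooth_on_flat: "smooth_on UNIV (flat p)"
proof (rule smooth_on_family[where P="\<lambda>f. \<exists>p. f = flat p"])
  fix f :: "real \<Rightarrow> real" and \<xi> assume "\<exists>p. f = flat p"
  then obtain p where p: "f = flat p" by blast
  let ?q = "(p - pderiv p) * [:0, 0, 1:]"
  have "frechet_derivative f (at x) \<xi> = flat (smult \<xi> ?q) x" for x
  proof -
    have "(f has_derivative (\<lambda>h. flat ?q x * h)) (at x)"
      using flat_has_derivative[of p x] unfolding p has_field_derivative_def .
    then have "frechet_derivative f (at x) \<xi> = flat ?q x * \<xi>"
      using frechet_derivative_at by metis
    then show ?thesis by (simp add: flat_def)
  qed
  then show "\<exists>f'. (\<exists>p. f' = flat p) \<and> (\<forall>x\<in>UNIV. f' x = frechet_derivative f (at x) \<xi>)"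
    by (intro exI[of _ "flat (smult \<xi> ?q)"]) auto
next
  fix f :: "real \<Rightarrow> real" and x assume "\<exists>p. f = flat p"
  then show "f differentiable at x"
    using flat_has_derivative unfolding has_field_derivative_def differentiable_def by blast
qed auto

text \<open>The box is closed and lies in a translate of a sum of segments \<open>[-r, r]\<close> in
  the frame directions; such a sum is compact by induction on \<open>B\<close>. This is the source
  of local compactness of the group.\<close>

lemma compact_coordinate_box:
  fixes B :: "'e::real_normed_vector set"
  assumes "frame B c"
  shows "compact {y. \<forall>b\<in>B. \<bar>c b (y - x)\<bar> \<le> r}"
proof -
  have fin: "finite B" and bl: "\<And>b. bounded_linear (c b)"
    and sum: "\<And>x. (\<Sum>b\<in>B. c b x *\<^sub>R b) = x"
    using assms by (auto simp: frame_def)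
  have "\<exists>K. compact K \<and> (\<forall>u. (\<forall>b\<in>B. \<bar>u b\<bar> \<le> r) \<longrightarrow> (\<Sum>b\<in>B. u b *\<^sub>R b) \<in> K)"
    using fin
  proof (induction B)
    case empty
    show ?case by (rule exI[of _ "{0}"]) simp
  next
    case (insert a B)
    then obtain K where K: "compact K" "\<And>u. (\<forall>b\<in>B. \<bar>u b\<bar> \<le> r) \<Longrightarrow> (\<Sum>b\<in>B. u b *\<^sub>R b) \<in> K"
      by auto
    have "compact ((\<lambda>t. t *\<^sub>R a) ` {-r..r})"
      by (intro compact_continuous_image continuous_intros) auto
    then have "compact {x + y |x y. x \<in> (\<lambda>t. t *\<^sub>R a) ` {-r..r} \<and> y \<in> K}"
      using K(1) by (rule compact_sums)
    moreover have "(\<Sum>b\<in>insert a B. u b *\<^sub>R b) \<in> {x + y |x y. x \<in> (\<lambda>t. t *\<^sub>R a) ` {-r..r} \<and> y \<in> K}"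
      if "\<forall>b\<in>insert a B. \<bar>u b\<bar> \<le> r" for u
      using K(2)[of u] that insert.hyps by (fastforce simp: abs_le_iff)
    ultimately show ?case by blast
  qed
  then obtain K where K: "compact K" "\<And>u. (\<forall>b\<in>B. \<bar>u b\<bar> \<le> r) \<Longrightarrow> (\<Sum>b\<in>B. u b *\<^sub>R b) \<in> K" by auto
  have "compact ((\<lambda>y. x + y) ` K)"
    by (intro compact_continuous_image continuous_intros K(1))
  moreover have "closed {y. \<forall>b\<in>B. \<bar>c b (y - x)\<bar> \<le> r}"
    unfolding Collect_ball_eq
    by (intro closed_INT ballI closed_Collect_le continuous_intros bounded_linear.continuous_on[OF bl])
  moreover have "{y. \<forall>b\<in>B. \<bar>c b (y - x)\<bar> \<le> r} \<subseteq> (\<lambda>y. x + y) ` K"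
  proof
    fix y assume "y \<in> {y. \<forall>b\<in>B. \<bar>c b (y - x)\<bar> \<le> r}"
    then have "y - x \<in> K" using K(2)[of "\<lambda>b. c b (y - x)"] by (simp add: sum)
    then show "y \<in> (\<lambda>y. x + y) ` K" by force
  qed
  ultimately show ?thesis by (rule compact_closed_subset)
qed

lemma coordinate_box_subset:
  fixes V :: "'e::real_normed_vector set"
  assumes "frame B c" "open V" "x \<in> V"
  obtains \<epsilon> where "\<epsilon> > 0" "{y. \<forall>b\<in>B. \<bar>c b (y - x)\<bar> \<le> \<epsilon>} \<subseteq> V"
proof -
  have sum: "\<And>x. (\<Sum>b\<in>B. c b x *\<^sub>R b) = x" and fin: "finite B" using assms by (auto simp: frame_def)
  obtain e where e: "e > 0" "ball x e \<subseteq> V" using assms openE by blast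
  \<comment> \<open>The summand 1 keeps \<open>s\<close> positive in dimension 0.\<close>
  define s where "s = (\<Sum>b\<in>B. norm b) + 1"
  have s: "s > 0" unfolding s_def by (simp add: add_nonneg_pos sum_nonneg)
  have "y \<in> V" if "\<forall>b\<in>B. \<bar>c b (y - x)\<bar> \<le> e / (2 * s)" for y
  proof -
    have "norm (y - x) \<le> (\<Sum>b\<in>B. norm (c b (y - x) *\<^sub>R b))"
      using norm_sum[of "\<lambda>b. c b (y - x) *\<^sub>R b" B] by (simp add: sum)
    also have "\<dots> \<le> (\<Sum>b\<in>B. e / (2 * s) * norm b)"
      unfolding norm_scaleR real_norm_def using that by (intro sum_mono mult_right_mono) auto
    also have "\<dots> = e / (2 * s) * (\<Sum>b\<in>B. norm b)" by (simp add: sum_distrib_left)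
    also have "\<dots> \<le> e / (2 * s) * s" using e(1) s by (intro mult_left_mono) (auto simp: s_def)
    also have "\<dots> < e" using e(1) s by simp
    finally show ?thesis using e(2) by (auto simp: dist_norm norm_minus_commute)
  qed
  then show thesis using that[of "e / (2 * s)"] e(1) s by auto
qed

lemma fin_dim_compact_nbhd:
  fixes V :: "'e::real_normed_vector set"
  assumes "fin_dim TYPE('e)" "open V" "x \<in> V"
  obtains T L where "open T" "x \<in> T" "T \<subseteq> L" "compact L" "L \<subseteq> V"
proof -
  obtain B :: "'e set" and c where fr: "frame B c" using assms(1) by (rule fin_dim_frame)
  then have fin: "finite B" and bl: "\<And>b. bounded_linear (c b)" by (auto simp: frame_def)
  obtain \<epsilon> where \<epsilon>: "\<epsilon> > 0" "{y. \<forall>b\<in>B. \<bar>c b (y - x)\<bar> \<le> \<epsilon>} \<subseteq> V"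
    using coordinate_box_subset[OF fr assms(2,3)] by blast
  have "open (\<Inter>b\<in>B. {y. \<bar>c b (y - x)\<bar> < \<epsilon>})"
    using fin by (intro open_INT ballI open_Collect_less continuous_intros
        bounded_linear.continuous_on[OF bl])
  then show thesis
    using \<epsilon> compact_coordinate_box[OF fr, of x \<epsilon>]
    by (intro that[of "\<Inter>b\<in>B. {y. \<bar>c b (y - x)\<bar> < \<epsilon>}" "{y. \<forall>b\<in>B. \<bar>c b (y - x)\<bar> \<le> \<epsilon>}"])
      (auto simp: bounded_linear.linear[OF bl] linear_0 less_imp_le)
qed

section \<open>Smooth maps into the group and smooth functions on it\<close>

context lie_group
begin

lemma fin_dim_model: "fin_dim TYPE('e)"
  using finite_dim by (simp add: fin_dim_def)

lemma group_UNIV [simp]: "x \<in> carrier G"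
  by (simp add: carrier_UNIV)

lemma chart_at: obtains U \<phi> where "(U, \<phi>) \<in> A" "x \<in> U"
proof -
  have "x \<in> (\<Union>(U, \<phi>)\<in>A. U)" using charts_cover by simp
  then show thesis using that by blast
qed

lemma chart_inv [simp]: "(U, \<phi>) \<in> A \<Longrightarrow> x \<in> U \<Longrightarrow> inv_into U \<phi> (\<phi> x) = x"
  using chart_homeomorphism unfolding homeomorphism_def by blast

lemma chart_inv_mem: "a \<in> \<phi> ` U \<Longrightarrow> inv_into U \<phi> a \<in> U"
  by (rule inv_into_into)

lemma continuous_chart: "(U, \<phi>) \<in> A \<Longrightarrow> continuous_on U \<phi>"
  and continuous_chart_inv: "(U, \<phi>) \<in> A \<Longrightarrow> continuous_on (\<phi> ` U) (inv_into U \<phi>)"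
  using chart_homeomorphism unfolding homeomorphism_def by blast+

definition gsmooth :: "'x::real_normed_vector set \<Rightarrow> ('x \<Rightarrow> 'g) \<Rightarrow> bool" where
  "gsmooth S m \<longleftrightarrow> open S \<and> continuous_on S m \<and> (\<forall>(W, \<theta>)\<in>A. smooth_on (S \<inter> m -` W) (\<lambda>x. \<theta> (m x)))"

lemma gsmooth_open_preimage: "gsmooth S m \<Longrightarrow> open W \<Longrightarrow> open (S \<inter> m -` W)"
  unfolding gsmooth_def using continuous_open_preimage by blast

lemma gsmooth_open: "gsmooth S m \<Longrightarrow> open S"
  and gsmooth_continuous: "gsmooth S m \<Longrightarrow> continuous_on S m"
  and gsmooth_smooth: "gsmooth S m \<Longrightarrow> (W, \<theta>) \<in> A \<Longrightarrow> smooth_on (S \<inter> m -` W) (\<lambda>x. \<theta> (m x))"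
  by (auto simp: gsmooth_def)

lemma gsmooth_chart:
  assumes "(U, \<phi>) \<in> A"
  shows "gsmooth (\<phi> ` U) (inv_into U \<phi>)"
  unfolding gsmooth_def
proof (intro conjI ballI)
  show "open (\<phi> ` U)" "continuous_on (\<phi> ` U) (inv_into U \<phi>)"
    using chart_open[OF assms] continuous_chart_inv[OF assms] by auto
  fix p assume "p \<in> A"
  then obtain W \<theta> where p: "p = (W, \<theta>)" "(W, \<theta>) \<in> A" by (cases p) auto
  have "\<phi> ` U \<inter> inv_into U \<phi> -` W = \<phi> ` (U \<inter> W)" using assms by (auto simp: image_iff)
  then show "case p of (W, \<theta>) \<Rightarrow> smooth_on (\<phi> ` U \<inter> inv_into U \<phi> -` W) (\<lambda>x. \<theta> (inv_into U \<phi> x))"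
    using charts_compatible[OF assms p(2)] p by (simp add: o_def)
qed

lemma gsmooth_const:
  assumes "open S"
  shows "gsmooth S (\<lambda>x. g)"
proof -
  have "smooth_on (S \<inter> (\<lambda>x. g) -` W) (\<lambda>x. \<theta> g)" for W and \<theta> :: "'g \<Rightarrow> 'e"
    by (rule smooth_on_subset[OF smooth_on_const[OF assms]]) auto
  then show ?thesis using assms by (auto simp: gsmooth_def)
qed

lemma gsmooth_compose:
  fixes m :: "'x::real_normed_vector \<Rightarrow> 'g" and p :: "'y::real_normed_vector \<Rightarrow> 'x"
  assumes "fin_dim TYPE('x)" "gsmooth S m" "open T" "smooth_on T p" "p ` T \<subseteq> S"
  shows "gsmooth T (\<lambda>y. m (p y))"
proof -
  have cont: "continuous_on T (\<lambda>y. m (p y))"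
    using continuous_on_compose2[OF gsmooth_continuous[OF assms(2)] smooth_on_continuous[OF
        assms(4)] assms(5)] .
  have "smooth_on (T \<inter> (\<lambda>y. m (p y)) -` W) (\<lambda>y. \<theta> (m (p y)))" if W: "(W, \<theta>) \<in> A" for W \<theta>
  proof (rule smooth_on_compose[OF assms(1) _ _ _ _ gsmooth_smooth[OF assms(2) W]])
    show "open (T \<inter> (\<lambda>y. m (p y)) -` W)"
      using continuous_open_preimage[OF cont assms(3)] chart_open[OF W] by blast
    show "open (S \<inter> m -` W)"
      using gsmooth_open_preimage[OF assms(2)] chart_open[OF W] by blast
    show "p ` (T \<inter> (\<lambda>y. m (p y)) -` W) \<subseteq> S \<inter> m -` W" using assms(5) by auto
    show "smooth_on (T \<inter> (\<lambda>y. m (p y)) -` W) p"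
      by (rule smooth_on_subset[OF assms(4)]) auto
  qed
  then show ?thesis using cont assms(3) by (auto simp: gsmooth_def)
qed

lemma continuous_on_mult:
  "continuous_on S f \<Longrightarrow> continuous_on S h \<Longrightarrow> continuous_on S (\<lambda>x. f x \<otimes> h x)"
  using continuous_on_compose2[OF continuous_mult continuous_on_Pair, of S f h] by simp

lemma continuous_on_inv: "continuous_on S f \<Longrightarrow> continuous_on S (\<lambda>x. inv (f x))"
  using continuous_on_compose2[OF continuous_inv, of S f] by simp

text \<open>Near a given point both factors stay in fixed charts. There the product is the group law
  in coordinates, applied to the pair of coordinate maps, and \<open>smooth_mult\<close> together
  with the chain rule applies.\<close>

lemma gsmooth_mult:
  assumes "gsmooth S m1" "gsmooth S m2"
  shows "gsmooth S (\<lambda>x. m1 x \<otimes> m2 x)"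
proof -
  have cont: "continuous_on S (\<lambda>x. m1 x \<otimes> m2 x)"
    by (intro continuous_on_mult gsmooth_continuous assms)
  have "smooth_on (S \<inter> (\<lambda>x. m1 x \<otimes> m2 x) -` W) (\<lambda>x. \<theta> (m1 x \<otimes> m2 x))" if W: "(W, \<theta>) \<in> A" for W \<theta>
  proof (rule smooth_on_local)
    fix x assume x: "x \<in> S \<inter> (\<lambda>x. m1 x \<otimes> m2 x) -` W"
    obtain U \<phi> where U: "(U, \<phi>) \<in> A" "m1 x \<in> U" by (rule chart_at)
    obtain V \<psi> where V: "(V, \<psi>) \<in> A" "m2 x \<in> V" by (rule chart_at)
    let ?D = "{(a, b). a \<in> \<phi> ` U \<and> b \<in> \<psi> ` V \<and> inv_into U \<phi> a \<otimes> inv_into V \<psi> b \<in> W}"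
    let ?T = "(S \<inter> m1 -` U) \<inter> (S \<inter> m2 -` V) \<inter> (S \<inter> (\<lambda>x. m1 x \<otimes> m2 x) -` W)"
    have oT: "open ?T"
      using chart_open[OF U(1)] chart_open[OF V(1)] chart_open[OF W]
      by (intro open_Int[OF open_Int, of "S \<inter> m1 -` U"] gsmooth_open_preimage[OF assms(1)]
          gsmooth_open_preimage[OF assms(2)] continuous_open_preimage[OF cont] gsmooth_open[OF
              assms(1)]) auto
    have "continuous_on (\<phi> ` U \<times> \<psi> ` V) (\<lambda>p. inv_into U \<phi> (fst p) \<otimes> inv_into V \<psi> (snd p))"
      by (intro continuous_on_mult continuous_on_compose2[OF continuous_chart_inv[OF U(1)]]
          continuous_on_compose2[OF continuous_chart_inv[OF V(1)]] continuous_intros) auto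
    then have "open ((\<phi> ` U \<times> \<psi> ` V) \<inter> (\<lambda>p. inv_into U \<phi> (fst p) \<otimes> inv_into V \<psi> (snd p)) -` W)"
      using chart_open[OF U(1)] chart_open[OF V(1)] chart_open[OF W]
      by (intro continuous_open_preimage open_Times) auto
    also have "(\<phi> ` U \<times> \<psi> ` V) \<inter> (\<lambda>p. inv_into U \<phi> (fst p) \<otimes> inv_into V \<psi> (snd p)) -` W = ?D"
      by auto
    finally have oD: "open ?D" .
    have "smooth_on ?T (\<lambda>x. (\<phi> (m1 x), \<psi> (m2 x)))"
      by (intro smooth_on_Pair oT smooth_on_subset[OF gsmooth_smooth[OF assms(1) U(1)]]
          smooth_on_subset[OF gsmooth_smooth[OF assms(2) V(1)]]) auto
    from smooth_on_compose[OF fin_dim_prod[OF fin_dim_model fin_dim_model] oT oD _ this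
        smooth_mult[OF U(1) V(1) W]]
    have "smooth_on ?T (\<lambda>x. \<theta> (inv_into U \<phi> (\<phi> (m1 x)) \<otimes> inv_into V \<psi> (\<psi> (m2 x))))"
      using U(1) V(1) by (auto simp: image_subset_iff)
    then have "smooth_on ?T (\<lambda>x. \<theta> (m1 x \<otimes> m2 x))"
      by (rule smooth_on_cong[OF oT]) (use U(1) V(1) in auto)
    then show "\<exists>T. x \<in> T \<and> smooth_on T (\<lambda>x. \<theta> (m1 x \<otimes> m2 x))"
      using x U(2) V(2) by (intro exI[of _ ?T]) auto
  qed
  then show ?thesis using cont gsmooth_open[OF assms(1)] by (auto simp: gsmooth_def)
qed

lemma gsmooth_inv:
  assumes "gsmooth S m"
  shows "gsmooth S (\<lambda>x. inv (m x))"
proof -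
  have cont: "continuous_on S (\<lambda>x. inv (m x))"
    by (intro continuous_on_inv gsmooth_continuous assms)
  have "smooth_on (S \<inter> (\<lambda>x. inv (m x)) -` W) (\<lambda>x. \<theta> (inv (m x)))" if W: "(W, \<theta>) \<in> A" for W \<theta>
  proof (rule smooth_on_local)
    fix x assume x: "x \<in> S \<inter> (\<lambda>x. inv (m x)) -` W"
    obtain U \<phi> where U: "(U, \<phi>) \<in> A" "m x \<in> U" by (rule chart_at)
    let ?D = "{a \<in> \<phi> ` U. inv (inv_into U \<phi> a) \<in> W}"
    let ?T = "(S \<inter> m -` U) \<inter> (S \<inter> (\<lambda>x. inv (m x)) -` W)"
    have oT: "open ?T"
      using chart_open[OF U(1)] chart_open[OF W]
      by (intro open_Int[of "S \<inter> m -` U"] gsmooth_open_preimage[OF assms(1)]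
          continuous_open_preimage[OF cont] gsmooth_open[OF assms(1)]) auto
    have "open (\<phi> ` U \<inter> (\<lambda>p. inv (inv_into U \<phi> p)) -` W)"
      using chart_open[OF U(1)] chart_open[OF W] continuous_chart_inv[OF U(1)]
      by (intro continuous_open_preimage continuous_on_inv) auto
    also have "\<phi> ` U \<inter> (\<lambda>p. inv (inv_into U \<phi> p)) -` W = ?D"
      by auto
    finally have oD: "open ?D" .
    have "smooth_on ?T (\<lambda>x. \<phi> (m x))"
      by (rule smooth_on_subset[OF gsmooth_smooth[OF assms(1) U(1)]]) auto
    from smooth_on_compose[OF fin_dim_model oT oD _ this smooth_inv[OF U(1) W]]
    have "smooth_on ?T (\<lambda>x. \<theta> (inv (inv_into U \<phi> (\<phi> (m x)))))"
      using U(1) by (auto simp: image_subset_iff)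
    then have "smooth_on ?T (\<lambda>x. \<theta> (inv (m x)))"
      by (rule smooth_on_cong[OF oT]) (use U(1) in auto)
    then show "\<exists>T. x \<in> T \<and> smooth_on T (\<lambda>x. \<theta> (inv (m x)))"
      using x U(2) by (intro exI[of _ ?T]) auto
  qed
  then show ?thesis using cont gsmooth_open[OF assms(1)] by (auto simp: gsmooth_def)
qed

lemma smooth_fun_gsmooth:
  assumes "smooth_fun A F" "gsmooth S m"
  shows "smooth_on S (\<lambda>x. F (m x))"
proof (rule smooth_on_local)
  fix x assume x: "x \<in> S"
  obtain U \<phi> where U: "(U, \<phi>) \<in> A" "m x \<in> U" by (rule chart_at)
  let ?T = "S \<inter> m -` U"
  have oT: "open ?T" using gsmooth_open_preimage[OF assms(2)] chart_open[OF U(1)] by blast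
  have "smooth_on (\<phi> ` U) (F \<circ> inv_into U \<phi>)" using assms(1) U(1) by (auto simp: smooth_fun_def)
  from smooth_on_compose[OF fin_dim_model oT _ _ gsmooth_smooth[OF assms(2) U(1)] this]
  have "smooth_on ?T (\<lambda>x. (F \<circ> inv_into U \<phi>) (\<phi> (m x)))"
    using chart_open[OF U(1)] by auto
  then have "smooth_on ?T (\<lambda>x. F (m x))"
    by (rule smooth_on_cong[OF oT]) (use U(1) in auto)
  then show "\<exists>T. x \<in> T \<and> smooth_on T (\<lambda>x. F (m x))" using x U(2) by (intro exI[of _ ?T]) auto
qed

lemma smooth_funI:
  assumes "\<And>U \<phi>. (U, \<phi>) \<in> A \<Longrightarrow> smooth_on (\<phi> ` U) (\<lambda>a. F (inv_into U \<phi> a))"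
  shows "smooth_fun A F"
proof -
  have "case p of (U, \<phi>) \<Rightarrow> smooth_on (\<phi> ` U) (F \<circ> inv_into U \<phi>)" if "p \<in> A" for p
    using assms[of "fst p" "snd p"] that by (simp add: split_beta o_def)
  then show ?thesis by (simp add: smooth_fun_def)
qed

lemma smooth_fun_chart:
  "smooth_fun A F \<Longrightarrow> (U, \<phi>) \<in> A \<Longrightarrow> smooth_on (\<phi> ` U) (\<lambda>a. F (inv_into U \<phi> a))"
  by (auto simp: smooth_fun_def o_def)

lemma smooth_fun_continuous:
  assumes "smooth_fun A F"
  shows "continuous_on S F"
proof -
  have "continuous (at x) F" for x
  proof -
    obtain U \<phi> where U: "(U, \<phi>) \<in> A" "x \<in> U" by (rule chart_at)
    have "continuous_on U (\<lambda>g. F (inv_into U \<phi> (\<phi> g)))"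
      using continuous_on_compose2[OF smooth_on_continuous[OF smooth_fun_chart[OF assms U(1)]]
          continuous_chart[OF U(1)] order_refl] .
    then have "continuous_on U F" by (rule continuous_on_eq) (use U(1) in auto)
    then show ?thesis using U chart_open[OF U(1)] continuous_on_eq_continuous_at by blast
  qed
  then show ?thesis by (simp add: continuous_at_imp_continuous_on)
qed

lemma smooth_fun_left:
  assumes "smooth_fun A F"
  shows "smooth_fun A (\<lambda>g. F (h \<otimes> g))"
proof (rule smooth_funI)
  fix U \<phi> assume U: "(U, \<phi>) \<in> A"
  show "smooth_on (\<phi> ` U) (\<lambda>a. F (h \<otimes> inv_into U \<phi> a))"
    using chart_open[OF U] by (intro smooth_fun_gsmooth[OF assms] gsmooth_mult gsmooth_const
        gsmooth_chart[OF U]) auto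
qed

lemma smooth_fun_right:
  assumes "smooth_fun A F"
  shows "smooth_fun A (\<lambda>g. F (g \<otimes> h))"
proof (rule smooth_funI)
  fix U \<phi> assume U: "(U, \<phi>) \<in> A"
  show "smooth_on (\<phi> ` U) (\<lambda>a. F (inv_into U \<phi> a \<otimes> h))"
    using chart_open[OF U] by (intro smooth_fun_gsmooth[OF assms] gsmooth_mult gsmooth_const
        gsmooth_chart[OF U]) auto
qed

lemma smooth_fun_linear:
  assumes "bounded_linear L" "smooth_fun A F"
  shows "smooth_fun A (\<lambda>g. L (F g))"
proof (rule smooth_funI)
  fix U \<phi> assume U: "(U, \<phi>) \<in> A"
  show "smooth_on (\<phi> ` U) (\<lambda>a. L (F (inv_into U \<phi> a)))"
    using chart_open[OF U] smooth_on_linear_compose[OF assms(1) _ smooth_fun_chart[OF assms(2) U]] by blast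
qed

lemma smooth_fun_add:
  assumes "smooth_fun A F" "smooth_fun A H"
  shows "smooth_fun A (\<lambda>g. F g + H g)"
proof (rule smooth_funI)
  fix U \<phi> assume U: "(U, \<phi>) \<in> A"
  show "smooth_on (\<phi> ` U) (\<lambda>a. F (inv_into U \<phi> a) + H (inv_into U \<phi> a))"
    using chart_open[OF U] smooth_on_add[OF _ assms[THEN smooth_fun_chart, OF U]] by blast
qed

lemma smooth_fun_bilinear:
  assumes "bounded_bilinear bil" "smooth_fun A F" "smooth_fun A H"
  shows "smooth_fun A (\<lambda>g. bil (F g) (H g))"
proof (rule smooth_funI)
  fix U \<phi> assume U: "(U, \<phi>) \<in> A"
  show "smooth_on (\<phi> ` U) (\<lambda>a. bil (F (inv_into U \<phi> a)) (H (inv_into U \<phi> a)))"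
    using chart_open[OF U] smooth_on_bilinear[OF assms(1) _ assms(2,3)[THEN smooth_fun_chart, OF U]]
        by blast
qed

lemma smooth_fun_const: "smooth_fun A (\<lambda>g. c)"
  using chart_open smooth_on_const by (intro smooth_funI) blast

lemma chart_compact_nbhd:
  assumes "open N" "x \<in> N" "(U, \<phi>) \<in> A" "x \<in> U"
  obtains T L where "open T" "x \<in> T" "T \<subseteq> L" "compact L" "L \<subseteq> N \<inter> U"
proof -
  have "open (\<phi> ` U \<inter> inv_into U \<phi> -` N)"
    using gsmooth_open_preimage[OF gsmooth_chart[OF assms(3)] assms(1)] .
  moreover have "\<phi> x \<in> \<phi> ` U \<inter> inv_into U \<phi> -` N" using assms by auto
  ultimately obtain T L where TL: "open T" "\<phi> x \<in> T" "T \<subseteq> L" "compact L" "L \<subseteq> \<phi> ` U \<inter> inv_into U \<phi> -` N"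
    using fin_dim_compact_nbhd[OF fin_dim_model] by metis
  show thesis
  proof (rule that)
    show "open (U \<inter> \<phi> -` T)"
      using continuous_open_preimage[OF continuous_chart[OF assms(3)]] chart_open[OF assms(3)] TL(1)
          by blast
    show "x \<in> U \<inter> \<phi> -` T" using TL(2) assms(4) by auto
    show "U \<inter> \<phi> -` T \<subseteq> inv_into U \<phi> ` L"
    proof
      fix y assume "y \<in> U \<inter> \<phi> -` T"
      then have "y = inv_into U \<phi> (\<phi> y)" "\<phi> y \<in> L" using assms(3) TL(3) by auto
      then show "y \<in> inv_into U \<phi> ` L" by blast
    qed
    show "compact (inv_into U \<phi> ` L)"
      using TL(4,5) by (intro compact_continuous_image continuous_on_subset[OF
          continuous_chart_inv[OF assms(3)]]) auto
    show "inv_into U \<phi> ` L \<subseteq> N \<inter> U"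
    proof
      fix y assume "y \<in> inv_into U \<phi> ` L"
      then obtain a where "a \<in> L" "y = inv_into U \<phi> a" by blast
      then show "y \<in> N \<inter> U" using TL(5) chart_inv_mem[of a \<phi> U] by blast
    qed
  qed
qed

text \<open>In a chart, take the flat function of \<open>\<epsilon>\<^sup>2 - q\<close>, where
  \<open>q\<close> is the sum of the squared coordinates relative to \<open>x\<close>. It vanishes
  outside a compact set \<open>K\<close> inside \<open>N\<close> and the chart, so it extends by 0
  to the group.\<close>

lemma bump_exists:
  assumes "open N" "x \<in> N"
  obtains r :: "'g \<Rightarrow> real" where "smooth_fun A r" "\<And>g. 0 \<le> r g" "0 < r x"
    "compact (closure {g. r g \<noteq> 0})" "closure {g. r g \<noteq> 0} \<subseteq> N"
proof -
  obtain U \<phi> where U: "(U, \<phi>) \<in> A" "x \<in> U" by (rule chart_at)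
  obtain B :: "'e set" and c where fr: "frame B c" using fin_dim_model by (rule fin_dim_frame)
  then have fin: "finite B" and bl: "\<And>b. bounded_linear (c b)" by (auto simp: frame_def)
  have oV: "open (\<phi> ` U \<inter> inv_into U \<phi> -` N)"
    using gsmooth_open_preimage[OF gsmooth_chart[OF U(1)] assms(1)] .
  have xV: "\<phi> x \<in> \<phi> ` U \<inter> inv_into U \<phi> -` N" using assms U by auto
  obtain \<epsilon> where \<epsilon>: "\<epsilon> > 0" "{y. \<forall>b\<in>B. \<bar>c b (y - \<phi> x)\<bar> \<le> \<epsilon>} \<subseteq> \<phi> ` U \<inter> inv_into U \<phi> -` N"
    using coordinate_box_subset[OF fr oV xV] by blast
  define q where "q y = (\<Sum>b\<in>B. c b (y - \<phi> x) * c b (y - \<phi> x))" for y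
  have q_smooth: "smooth_on UNIV (\<lambda>y. \<epsilon>\<^sup>2 + - q y)"
  proof -
    have "smooth_on UNIV (\<lambda>y. y - \<phi> x)"
      using smooth_on_add[OF open_UNIV smooth_on_ident smooth_on_const, of "- \<phi> x"] by simp
    then have "smooth_on UNIV (\<lambda>y. c b (y - \<phi> x))" for b
      by (rule smooth_on_linear_compose[OF bl open_UNIV])
    then show ?thesis unfolding q_def
      by (intro smooth_on_add smooth_on_const smooth_on_linear_compose[of uminus]
          bounded_linear_minus bounded_linear_ident smooth_on_sum smooth_on_bilinear[OF
              bounded_bilinear_mult])
        auto
  qed
  then have q_cont: "continuous_on UNIV q"
    using continuous_on_minus[OF continuous_on_diff[OF smooth_on_continuous[OF q_smooth]
        continuous_on_const[of _ "\<epsilon>\<^sup>2"]]]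
    by simp
  have q_box: "{y. q y \<le> \<epsilon>\<^sup>2} \<subseteq> {y. \<forall>b\<in>B. \<bar>c b (y - \<phi> x)\<bar> \<le> \<epsilon>}"
  proof (clarify)
    fix y b assume y: "q y \<le> \<epsilon>\<^sup>2" and "b \<in> B"
    then have "c b (y - \<phi> x) * c b (y - \<phi> x) \<le> q y"
      unfolding q_def using fin by (intro member_le_sum) auto
    then show "\<bar>c b (y - \<phi> x)\<bar> \<le> \<epsilon>"
      using y \<epsilon>(1) by (metis abs_le_square_iff abs_of_pos order_trans power2_eq_square)
  qed
  define K where "K = inv_into U \<phi> ` {y. q y \<le> \<epsilon>\<^sup>2}"
  have "closed {y. q y \<le> \<epsilon>\<^sup>2}" by (intro closed_Collect_le q_cont continuous_intros)
  then have "compact {y. q y \<le> \<epsilon>\<^sup>2}"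
    using compact_coordinate_box[OF fr] q_box compact_closed_subset by blast
  then have K: "compact K" unfolding K_def using q_box \<epsilon>(2)
    by (intro compact_continuous_image continuous_on_subset[OF continuous_chart_inv[OF U(1)]]) auto
  have KN: "K \<subseteq> N \<inter> U"
  proof
    fix y assume "y \<in> K"
    then obtain a where "q a \<le> \<epsilon>\<^sup>2" "y = inv_into U \<phi> a" unfolding K_def by blast
    moreover from this have "a \<in> \<phi> ` U \<inter> inv_into U \<phi> -` N" using q_box \<epsilon>(2) by blast
    ultimately show "y \<in> N \<inter> U" using chart_inv_mem[of a \<phi> U] by blast
  qed
  have inK: "g \<in> K" if "g \<in> U" "q (\<phi> g) \<le> \<epsilon>\<^sup>2" for g
  proof -
    have "g = inv_into U \<phi> (\<phi> g)" using that(1) U(1) by simp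
    then show ?thesis unfolding K_def using that(2) by blast
  qed
  define r where "r g = (if g \<in> U then flat 1 (\<epsilon>\<^sup>2 + - q (\<phi> g)) else 0)" for g
  have r0: "r g = 0" if "g \<notin> K" for g
    using inK[of g] that by (auto simp: r_def flat_def)
  have "smooth_fun A r"
  proof (rule smooth_funI, rule smooth_on_local)
    fix W \<theta> b assume W: "(W, \<theta>) \<in> A" and b: "b \<in> \<theta> ` W"
    let ?p = "inv_into W \<theta>"
    have gs: "gsmooth (\<theta> ` W) ?p" by (rule gsmooth_chart[OF W])
    show "\<exists>T. b \<in> T \<and> smooth_on T (\<lambda>a. r (?p a))"
    proof (cases "?p b \<in> U")
      case True
      let ?T = "\<theta> ` W \<inter> ?p -` U"
      have oT: "open ?T" using gsmooth_open_preimage[OF gs] chart_open[OF U(1)] by blast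
      have "smooth_on ?T (\<lambda>a. \<epsilon>\<^sup>2 + - q (\<phi> (?p a)))"
        by (rule smooth_on_compose[OF fin_dim_model oT open_UNIV _ gsmooth_smooth[OF gs U(1)]
            q_smooth]) simp
      then have "smooth_on ?T (\<lambda>a. flat 1 (\<epsilon>\<^sup>2 + - q (\<phi> (?p a))))"
        by (rule smooth_on_compose[OF fin_dim_real oT open_UNIV _ _ smooth_on_flat, rotated]) simp
      then have "smooth_on ?T (\<lambda>a. r (?p a))"
        by (rule smooth_on_cong[OF oT]) (auto simp: r_def)
      then show ?thesis using True b by (intro exI[of _ ?T]) auto
    next
      case False
      \<comment> \<open>A point outside \<open>U\<close> also lies outside \<open>K\<close>, which
        is closed since the group is Hausdorff. Hence \<open>r\<close> vanishes near that point, and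
        the extension by 0 is smooth there.\<close>
      let ?T = "\<theta> ` W \<inter> ?p -` (- K)"
      have oT: "open ?T" using gsmooth_open_preimage[OF gs] K compact_imp_closed open_Compl by blast
      have "smooth_on ?T (\<lambda>a. r (?p a))"
        by (rule smooth_on_cong[OF oT smooth_on_const[OF oT, of 0]]) (auto simp: r0)
      then show ?thesis using False b KN by (intro exI[of _ ?T]) auto
    qed
  qed
  moreover have "0 \<le> r g" for g by (simp add: r_def flat_def)
  moreover have "0 < r x" using U(2) \<epsilon>(1)
    by (simp add: r_def flat_def q_def bounded_linear.linear[OF bl] linear_0)
  moreover have "closure {g. r g \<noteq> 0} \<subseteq> K"
    using r0 K by (intro closure_minimal compact_imp_closed) auto
  moreover from this have "compact (closure {g. r g \<noteq> 0})" using K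
    compact_closed_subset closed_closure by blast
  ultimately show thesis using that KN by blast
qed

end

section \<open>Hilbert space duality\<close>

lemma scaleC_0_left [simp]: "scaleC 0 x = (0::'a::complex_vector)"
  using scaleC_add_left[of 0 0 x] by simp

lemma scaleC_0_right [simp]: "scaleC c 0 = (0::'a::complex_vector)"
  using scaleC_add_right[of c 0 0] by simp

lemma scaleC_minus1: "scaleC (- 1) x = - (x::'a::complex_vector)"
  using scaleC_add_left[of 1 "- 1" x] by (simp add: scaleC_one eq_neg_iff_add_eq_0 add.commute)

lemma csubspace_0: "csubspace V \<Longrightarrow> 0 \<in> V"
  and csubspace_add: "csubspace V \<Longrightarrow> x \<in> V \<Longrightarrow> y \<in> V \<Longrightarrow> x + y \<in> V"
  and csubspace_scaleC: "csubspace V \<Longrightarrow> x \<in> V \<Longrightarrow> scaleC c x \<in> V"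
  by (auto simp: csubspace_def)

lemma csubspace_diff:
  assumes "csubspace V" "x \<in> V" "y \<in> V"
  shows "x - y \<in> V"
  using csubspace_add[OF assms(1,2) csubspace_scaleC[OF assms(1,3)], of "- 1"] by (simp add: scaleC_minus1)

lemma csubspace_scaleR:
  fixes V :: "'a::complex_normed_vector set"
  shows "csubspace V \<Longrightarrow> x \<in> V \<Longrightarrow> r *\<^sub>R x \<in> V"
  by (simp add: scaleR_scaleC csubspace_scaleC)

lemma clinear_on_add: "clinear_on V f \<Longrightarrow> x \<in> V \<Longrightarrow> y \<in> V \<Longrightarrow> f (x + y) = f x + f y"
  and clinear_on_scaleC: "clinear_on V f \<Longrightarrow> x \<in> V \<Longrightarrow> f (scaleC c x) = scaleC c (f x)"
  by (auto simp: clinear_on_def)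

lemma clinear_on_0: "clinear_on V f \<Longrightarrow> csubspace V \<Longrightarrow> f 0 = 0"
  using clinear_on_scaleC[of V f 0 0] by (simp add: csubspace_0)

lemma clinear_on_diff:
  assumes "clinear_on V f" "csubspace V" "x \<in> V" "y \<in> V"
  shows "f (x - y) = f x - f y"
  using clinear_on_add[OF assms(1,3) csubspace_scaleC[OF assms(2,4)], of "- 1"]
    clinear_on_scaleC[OF assms(1,4), of "- 1"] by (simp add: scaleC_minus1)

lemma cinner_add_right: "cinner x (y + z) = cinner x y + cinner x z"
  by (metis cinner_add_left cinner_commute complex_cnj_add)

lemma cinner_scaleC_right: "cinner x (scaleC a y) = cnj a * cinner x y"
  by (metis cinner_commute cinner_scaleC_left complex_cnj_mult)

text \<open>Multiplying \<open>x\<close> by a phase makes the product real and nonnegative; then the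
  real Cauchy-Schwarz inequality applies.\<close>

lemma norm_cinner: "cmod (cinner x y) \<le> norm x * norm y"
proof (cases "cinner x y = 0")
  case False
  define a where "a = cnj (cinner x y) / cmod (cinner x y)"
  have "cmod a = 1" using False by (simp add: a_def norm_divide)
  have "a * cinner x y = complex_of_real (cmod (cinner x y))"
    using False by (simp add: a_def mult.commute complex_norm_square[symmetric] power2_eq_square)
  then have "cmod (cinner x y) = inner (scaleC a x) y"
    by (metis Re_cinner Re_complex_of_real cinner_scaleC_left)
  also have "\<dots> \<le> norm (scaleC a x) * norm y" by (rule norm_cauchy_schwarz)
  finally show ?thesis using \<open>cmod a = 1\<close> by (simp add: norm_scaleC)
qed simp

lemma bounded_linear_cinner_left: "bounded_linear (\<lambda>x. cinner x y)"
  by (rule bounded_linear_intro[where K="norm y"])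
    (simp_all add: cinner_add_left scaleR_scaleC cinner_scaleC_left scaleC_complex_def norm_cinner)

lemma bounded_linear_cinner_right: "bounded_linear (\<lambda>y. cinner x y)"
  by (rule bounded_linear_intro[where K="norm x"])
    (simp_all add: cinner_add_right scaleR_scaleC cinner_scaleC_right scaleC_complex_def norm_cinner
      mult.commute[of "norm _" "norm x"])

lemmas cinner_0_left [simp] = linear_0[OF bounded_linear.linear[OF bounded_linear_cinner_left]]
lemmas cinner_0_right [simp] = linear_0[OF bounded_linear.linear[OF bounded_linear_cinner_right]]
lemmas cinner_diff_left = linear_diff[OF bounded_linear.linear[OF bounded_linear_cinner_left]]
lemmas cinner_sum_left = linear_sum[OF bounded_linear.linear[OF bounded_linear_cinner_left]]

lemma cinner_scaleR_left: "cinner (r *\<^sub>R x) y = of_real r * cinner x y"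
  by (simp add: scaleR_scaleC cinner_scaleC_left)

lemma cinner_scaleR_right: "cinner x (r *\<^sub>R y) = of_real r * cinner x y"
  by (simp add: scaleR_scaleC cinner_scaleC_right)

lemma cinner_self_zero: "cinner x x = 0 \<Longrightarrow> x = 0"
  using Re_cinner[of x x] by simp

lemma cinner_eq_left: "(\<And>y. cinner x y = cinner z y) \<Longrightarrow> x = z"
  using cinner_self_zero[of "x - z"] by (simp add: cinner_diff_left)

text \<open>Test with \<open>y = x\<close>. Vectors that are known only through their pairings are
  estimated in this way.\<close>

lemma norm_le_cinner:
  assumes "0 \<le> C" "\<And>y. cmod (cinner x y) \<le> C * norm y"
  shows "norm x \<le> C"
proof -
  have "norm x * norm x = Re (cinner x x)" by (simp add: Re_cinner dot_square_norm power2_eq_square)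
  also have "\<dots> \<le> C * norm x" using assms(2)[of x] complex_Re_le_cmod order_trans by blast
  finally show ?thesis using assms(1) by (cases "norm x = 0") auto
qed

text \<open>A form of the Riesz representation theorem for functionals that are continuous with respect to
  finitely many seminorms \<open>w \<mapsto> norm (D i w)\<close>. Without completing \<open>V\<close>, minimise
  \<open>\<Sum>i. norm (D i w)\<^sup>2 / 2 - Re (\<eta> w)\<close>: by the parallelogram law the images \<open>D i w\<close> of a minimising
  sequence converge, and their limits represent \<open>\<eta>\<close>.\<close>

lemma functional_representation:
  fixes D :: "'i \<Rightarrow> 'v::complex_vector \<Rightarrow> 'h::complex_hilbert_space" and \<eta> :: "'v \<Rightarrow> complex"
  assumes I: "finite I" and V: "csubspace V" and D: "\<And>i. i \<in> I \<Longrightarrow> clinear_on V (D i)"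
    and \<eta>: "clinear_on V \<eta>" and bound: "\<And>w. w \<in> V \<Longrightarrow> cmod (\<eta> w) \<le> C * (\<Sum>i\<in>I. norm (D i w))"
  obtains y where "\<And>w. w \<in> V \<Longrightarrow> \<eta> w = (\<Sum>i\<in>I. cinner (D i w) (y i))"
proof -
  define q where "q w = (\<Sum>i\<in>I. (norm (D i w))\<^sup>2)" for w
  define J where "J w = q w / 2 - Re (\<eta> w)" for w
  have q0: "q w \<ge> 0" for w by (simp add: q_def sum_nonneg)
  \<comment> \<open>Young's inequality \<open>C * n \<le> n\<^sup>2 / 2 + C\<^sup>2 / 2\<close>,
    summed over \<open>I\<close>, produces this constant.\<close>
  have J_bound: "J w \<ge> - (card I * C\<^sup>2 / 2)" if "w \<in> V" for w
  proof -
    have "Re (\<eta> w) \<le> C * (\<Sum>i\<in>I. norm (D i w))"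
      using bound[OF that] complex_Re_le_cmod order_trans by blast
    also have "\<dots> = (\<Sum>i\<in>I. C * norm (D i w))" by (rule sum_distrib_left)
    also have "\<dots> \<le> (\<Sum>i\<in>I. (norm (D i w))\<^sup>2 / 2 + C\<^sup>2 / 2)"
    proof (rule sum_mono)
      fix i
      have "0 \<le> (norm (D i w) - C)\<^sup>2" by simp
      then show "C * norm (D i w) \<le> (norm (D i w))\<^sup>2 / 2 + C\<^sup>2 / 2"
        by (simp add: power2_eq_square algebra_simps)
    qed
    also have "\<dots> = q w / 2 + card I * C\<^sup>2 / 2"
      by (simp add: q_def sum.distrib sum_divide_distrib)
    finally show ?thesis by (simp add: J_def)
  qed
  define m where "m = Inf (J ` V)"
  have bdd: "bdd_below (J ` V)" using J_bound by (intro bdd_belowI2) auto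
  have m: "m \<le> J w" if "w \<in> V" for w unfolding m_def using bdd that by (simp add: cInf_lower)
  have "\<exists>w\<in>V. J w < m + inverse (Suc n)" for n
  proof -
    have "J ` V \<noteq> {}" using csubspace_0[OF V] by auto
    moreover have "Inf (J ` V) < m + inverse (Suc n)" by (simp add: m_def)
    ultimately obtain z where "z \<in> J ` V" "z < m + inverse (Suc n)" by (rule cInf_lessD[elim_format]) auto
    then show ?thesis by auto
  qed
  then obtain w where w: "\<And>n. w n \<in> V" "\<And>n. J (w n) < m + inverse (Suc n)" by metis
  \<comment> \<open>The midpoint \<open>u\<close> has \<open>J u \<ge> m\<close>, so the distance of
    \<open>a\<close> and \<open>b\<close> is controlled by how far \<open>J a\<close> and
    \<open>J b\<close> exceed the infimum.\<close>
  have q_diff: "q (a - b) \<le> 4 * (J a - m) + 4 * (J b - m)" if ab: "a \<in> V" "b \<in> V" for a b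
  proof -
    define u where "u = scaleC (1/2) (a + b)"
    have u: "u \<in> V" unfolding u_def using V ab by (intro csubspace_scaleC csubspace_add)
    have Du: "D i u = (1/2) *\<^sub>R (D i a + D i b)" if "i \<in> I" for i
      using clinear_on_scaleC[OF D[OF that] csubspace_add[OF V ab], of "1/2"]
        clinear_on_add[OF D[OF that] ab] by (simp add: u_def scaleR_scaleC)
    have \<eta>u: "\<eta> u = (\<eta> a + \<eta> b) / 2"
      using clinear_on_scaleC[OF \<eta> csubspace_add[OF V ab], of "1/2"] clinear_on_add[OF \<eta> ab]
      by (simp add: u_def scaleC_complex_def)
    have "q (a - b) + 4 * q u = 2 * q a + 2 * q b"
    proof -
      have "(norm (D i (a - b)))\<^sup>2 + 4 * (norm (D i u))\<^sup>2 = 2 * (norm (D i a))\<^sup>2 + 2 * (norm (D i b))\<^sup>2"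
        if "i \<in> I" for i
      proof -
        have "(norm (x - y))\<^sup>2 + 4 * (norm ((1/2) *\<^sub>R (x + y)))\<^sup>2 = 2 * (norm x)\<^sup>2 + 2 * (norm y)\<^sup>2" for
            x y :: 'h
          unfolding power2_norm_eq_inner by (simp add: inner_simps inner_commute field_simps)
        then show ?thesis by (simp only: Du[OF that] clinear_on_diff[OF D[OF that] V ab])
      qed
      then show ?thesis
        unfolding q_def sum_distrib_left sum.distrib[symmetric] by (intro sum.cong) auto
    qed
    then have "q (a - b) = 4 * J a + 4 * J b - 8 * J u"
      by (simp add: J_def \<eta>u field_simps)
    then show ?thesis using m[OF u] by simp
  qed
  have conv: "convergent (\<lambda>n. D i (w n))" if i: "i \<in> I" for i
  proof -
    have "Cauchy (\<lambda>n. D i (w n))"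
    proof (rule metric_CauchyI)
      fix e :: real assume e: "e > 0"
      then obtain M where M: "inverse (Suc M) < e\<^sup>2 / 8"
        using reals_Archimedean[of "e\<^sup>2 / 8"] by auto
      have "dist (D i (w k)) (D i (w n)) < e" if "k \<ge> M" "n \<ge> M" for k n
      proof -
        have "inverse (real (Suc k)) \<le> inverse (Suc M)" "inverse (real (Suc n)) \<le> inverse (Suc M)"
          using that by auto
        then have small: "J (w k) - m < e\<^sup>2 / 8" "J (w n) - m < e\<^sup>2 / 8"
          using w(2)[of k] w(2)[of n] M by linarith+
        have "(norm (D i (w k) - D i (w n)))\<^sup>2 \<le> q (w k - w n)"
          unfolding q_def clinear_on_diff[OF D[OF i] V w(1) w(1), symmetric]
          using I i by (intro member_le_sum) auto
        also have "\<dots> < e\<^sup>2" using q_diff[OF w(1) w(1), of k n] small by simp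
        finally show ?thesis using e by (simp add: dist_norm power2_less_imp_less)
      qed
      then show "\<exists>M. \<forall>k\<ge>M. \<forall>n\<ge>M. dist (D i (w k)) (D i (w n)) < e" by blast
    qed
    then show ?thesis by (simp add: Cauchy_convergent_iff)
  qed
  define y where "y i = lim (\<lambda>n. D i (w n))" for i
  have y: "(\<lambda>n. D i (w n)) \<longlonglongrightarrow> y i" if "i \<in> I" for i
    using conv[OF that] by (simp add: y_def convergent_LIMSEQ_iff)
  have Jw: "(\<lambda>n. J (w n)) \<longlonglongrightarrow> m"
  proof (rule tendsto_sandwich)
    show "\<forall>\<^sub>F n in sequentially. m \<le> J (w n)" using m w(1) by simp
    show "\<forall>\<^sub>F n in sequentially. J (w n) \<le> m + inverse (Suc n)"
      using w(2) by (simp add: less_imp_le)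
    show "(\<lambda>n. m + inverse (Suc n)) \<longlonglongrightarrow> m"
      using tendsto_add[OF tendsto_const LIMSEQ_inverse_real_of_nat, of m] by simp
  qed simp
  have Re_eq: "Re (\<eta> v) = (\<Sum>i\<in>I. inner (y i) (D i v))" if v: "v \<in> V" for v
  proof -
    define s where "s = (\<Sum>i\<in>I. inner (y i) (D i v)) - Re (\<eta> v)"
    \<comment> \<open>First variation: \<open>J (w n + scaleC t v)\<close> is at least
      \<open>m\<close> and tends to \<open>m + t * s + t\<^sup>2 * q v / 2\<close> as
      \<open>n\<close> grows.\<close>
    have *: "0 \<le> t * s + t\<^sup>2 * q v / 2" for t
    proof -
      let ?c = "complex_of_real t"
      have tv: "scaleC ?c v \<in> V" using V v by (rule csubspace_scaleC)
      have J_eq: "J (w n + scaleC ?c v) =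
        J (w n) + t * (\<Sum>i\<in>I. inner (D i (w n)) (D i v)) + t\<^sup>2 * q v / 2 - t * Re (\<eta> v)" for n
      proof -
        have "(norm (D i (w n + scaleC ?c v)))\<^sup>2 =
          (norm (D i (w n)))\<^sup>2 + 2 * t * inner (D i (w n)) (D i v) + t\<^sup>2 * (norm (D i v))\<^sup>2" if "i \<in> I" for i
        proof -
          have "(norm (x + t *\<^sub>R y))\<^sup>2 = (norm x)\<^sup>2 + 2 * t * inner x y + t\<^sup>2 * (norm y)\<^sup>2" for x y :: 'h
            unfolding power2_norm_eq_inner by (simp add: inner_simps inner_commute power2_eq_square
                distrib_left)
          moreover have "D i (w n + scaleC ?c v) = D i (w n) + t *\<^sub>R D i v"
            using clinear_on_add[OF D[OF that] w(1)[of n] tv] clinear_on_scaleC[OF D[OF that] v, of ?c]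
            by (simp add: scaleR_scaleC)
          ultimately show ?thesis by simp
        qed
        then have "q (w n + scaleC ?c v) =
          q (w n) + 2 * t * (\<Sum>i\<in>I. inner (D i (w n)) (D i v)) + t\<^sup>2 * q v"
          by (simp add: q_def sum.distrib sum_distrib_left)
        moreover have "\<eta> (w n + scaleC ?c v) = \<eta> (w n) + ?c * \<eta> v"
          using clinear_on_add[OF \<eta> w(1)[of n] tv] clinear_on_scaleC[OF \<eta> v, of ?c]
          by (simp add: scaleC_complex_def)
        ultimately show ?thesis by (simp add: J_def)
      qed
      have lim: "(\<lambda>n. J (w n + scaleC ?c v)) \<longlonglongrightarrow>
         m + t * (\<Sum>i\<in>I. inner (y i) (D i v)) + t\<^sup>2 * q v / 2 - t * Re (\<eta> v)"
        unfolding J_eq by (intro tendsto_intros Jw y)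
      have "m \<le> J (w n + scaleC ?c v)" for n
        using V w(1) tv by (intro m csubspace_add)
      then have "m \<le> m + t * (\<Sum>i\<in>I. inner (y i) (D i v)) + t\<^sup>2 * q v / 2 - t * Re (\<eta> v)"
        by (intro LIMSEQ_le_const[OF lim]) blast
      then show ?thesis by (simp add: s_def algebra_simps)
    qed
    have "s = 0"
    proof -
      \<comment> \<open>The quadratic in \<open>t\<close> would be least at
        \<open>- s / q v\<close>; the denominator \<open>q v + 1\<close> still makes it negative
        unless \<open>s = 0\<close>, and it also covers \<open>q v = 0\<close>.\<close>
      define r where "r = q v + 1"
      have r: "r > 0" "q v = r - 1" using q0[of v] by (auto simp: r_def)
      have "0 \<le> (- s / r) * s + (- s / r)\<^sup>2 * q v / 2" by (rule *)
      also have "\<dots> = s\<^sup>2 * (- r - 1) / (2 * r\<^sup>2)"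
        using r(1) by (simp add: r(2) field_simps power2_eq_square)
      finally have "0 \<le> s\<^sup>2 * (- r - 1)" using r(1) by (simp add: zero_le_divide_iff)
      then have "s\<^sup>2 \<le> 0" using r(1) by (simp add: zero_le_mult_iff)
      then show ?thesis by simp
    qed
    then show ?thesis by (simp add: s_def)
  qed
  have "\<eta> v = (\<Sum>i\<in>I. cinner (D i v) (y i))" if v: "v \<in> V" for v
  proof (rule complex_eqI)
    show "Re (\<eta> v) = Re (\<Sum>i\<in>I. cinner (D i v) (y i))"
      by (simp add: Re_eq[OF v] Re_cinner inner_commute)
    have "Im (\<eta> v) = Re (\<eta> (scaleC (- \<i>) v))"
      by (simp add: clinear_on_scaleC[OF \<eta> v] scaleC_complex_def)
    also have "\<dots> = (\<Sum>i\<in>I. Re (cinner (D i (scaleC (- \<i>) v)) (y i)))"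
      by (simp add: Re_eq[OF csubspace_scaleC[OF V v]] Re_cinner inner_commute)
    also have "\<dots> = (\<Sum>i\<in>I. Im (cinner (D i v) (y i)))"
      using clinear_on_scaleC[OF D v, of _ "- \<i>"] by (intro sum.cong) (auto simp: cinner_scaleC_left)
    finally show "Im (\<eta> v) = Im (\<Sum>i\<in>I. cinner (D i v) (y i))" by simp
  qed
  then show thesis using that by blast
qed

text \<open>The case of a single seminorm, the norm itself.\<close>

lemma riesz:
  fixes F :: "'h::complex_hilbert_space \<Rightarrow> complex"
  assumes "clinear_on UNIV F" "\<And>x. cmod (F x) \<le> C * norm x"
  obtains z where "\<And>x. F x = cinner x z"
proof -
  have "csubspace (UNIV :: 'h set)" by (simp add: csubspace_def)
  from functional_representation[of "{()}" UNIV "\<lambda>_ x. x" F C, OF _ this]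
  show thesis using assms that by (auto simp: clinear_on_def)
qed

text \<open>The Riesz map, conjugate-linear over the complex numbers but bounded and linear over the
  reals, which is all that differentiation sees. Statements about the dual Hilbert space are carried
  over to H by it.\<close>

definition dual_of :: "'h::complex_hilbert_space \<Rightarrow> 'h \<Rightarrow>\<^sub>L complex" where
  "dual_of y = Blinfun (\<lambda>x. cinner x y)"

lemma dual_of_apply [simp]: "blinfun_apply (dual_of y) x = cinner x y"
  by (simp add: dual_of_def bounded_linear_Blinfun_apply bounded_linear_cinner_left)

lemma norm_dual_of: "norm (dual_of y) \<le> norm y"
  by (rule norm_blinfun_bound) (simp_all add: norm_cinner mult.commute)

lemma bounded_linear_dual_of: "bounded_linear dual_of"
  by (rule bounded_linear_intro[where K=1])
    (auto intro!: blinfun_eqI simp: cinner_add_right cinner_scaleR_right blinfun.bilinear_simps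
      scaleR_conv_of_real norm_dual_of)

lemma dual_of_scaleC: "dual_of (scaleC c y) = scaleC (cnj c) (dual_of y)"
  by (rule blinfun_eqI)
    (simp add: scaleC_blinfun_def bounded_linear_Blinfun_apply bounded_linear_scaleC
      scaleC_complex_def cinner_scaleC_right)

lemma hilbert_dual_eq: "hilbert_dual = range dual_of"
proof (intro subset_antisym subsetI)
  fix u :: "'h::complex_hilbert_space \<Rightarrow>\<^sub>L complex" assume "u \<in> hilbert_dual"
  then have "clinear_on UNIV (blinfun_apply u)" by (simp add: hilbert_dual_def)
  moreover have "\<And>x. cmod (u x) \<le> norm u * norm x" by (rule norm_blinfun)
  ultimately obtain z where "\<And>x. u x = cinner x z"
    using riesz[of "blinfun_apply u" "norm u"] by blast
  then have "u = dual_of z" by (intro blinfun_eqI) simp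
  then show "u \<in> range dual_of" by blast
next
  fix u :: "'h::complex_hilbert_space \<Rightarrow>\<^sub>L complex" assume "u \<in> range dual_of"
  then show "u \<in> hilbert_dual"
    by (auto simp: hilbert_dual_def clinear_on_def cinner_add_left cinner_scaleC_left scaleC_complex_def)
qed

text \<open>A bounded left inverse of \<^const>\<open>dual_of\<close> on the whole type of bounded real-linear functionals; it
  lets smoothness of maps into the dual be transferred back.\<close>

lemma dual_of_left_inverse:
  obtains S :: "('h::complex_hilbert_space \<Rightarrow>\<^sub>L complex) \<Rightarrow> 'h"
  where "bounded_linear S" "\<And>y. S (dual_of y) = y"
proof -
  have "\<exists>z. \<forall>x. Re (u x) = inner x z" for u :: "'h \<Rightarrow>\<^sub>L complex"
  proof -
    \<comment> \<open>The complex-linear functional with the same real part as \<open>u\<close>. It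
      brings a merely real-linear \<open>u\<close> within reach of \<open>riesz\<close>.\<close>
    define F where "F x = Complex (Re (u x)) (- Re (u (scaleC \<i> x)))" for x
    have ux: "u (scaleC c x) = Re c *\<^sub>R u x + Im c *\<^sub>R u (scaleC \<i> x)" for c x
    proof -
      have "scaleC c x = Re c *\<^sub>R x + Im c *\<^sub>R scaleC \<i> x"
        by (simp add: scaleR_scaleC scaleC_scaleC scaleC_add_left[symmetric] mult.commute[of _ \<i>]
            complex_eq[of c, symmetric])
      then show ?thesis by (simp add: blinfun.bilinear_simps)
    qed
    have "F (scaleC c x) = c * F x" for c x
    proof -
      have "u (scaleC \<i> (scaleC c x)) = - Im c *\<^sub>R u x + Re c *\<^sub>R u (scaleC \<i> x)"
        unfolding scaleC_scaleC using ux[of "\<i> * c" x] by simp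
      then show ?thesis using ux[of c x] by (simp add: F_def complex_eq_iff algebra_simps)
    qed
    moreover have "F (x + y) = F x + F y" for x y
      by (simp add: F_def scaleC_add_right blinfun.add_right complex_eq_iff)
    ultimately have "clinear_on UNIV F" by (simp add: clinear_on_def scaleC_complex_def)
    moreover have "cmod (F x) \<le> (2 * norm u) * norm x" for x
    proof -
      have "\<bar>Re (u x)\<bar> \<le> norm u * norm x"
        using norm_blinfun[of u x] abs_Re_le_cmod[of "u x"] by linarith
      moreover have "\<bar>Re (u (scaleC \<i> x))\<bar> \<le> norm u * norm x"
        using norm_blinfun[of u "scaleC \<i> x"] abs_Re_le_cmod[of "u (scaleC \<i> x)"]
        by (simp add: norm_scaleC)
      moreover have "cmod (F x) \<le> \<bar>Re (F x)\<bar> + \<bar>Im (F x)\<bar>" by (rule cmod_le)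
      ultimately show ?thesis by (simp add: F_def)
    qed
    ultimately obtain z where "\<And>x. F x = cinner x z"
      using riesz[of F "2 * norm u"] by blast
    then have "Re (u x) = inner x z" for x by (metis F_def Re_cinner complex.sel(1))
    then show ?thesis by blast
  qed
  then have "\<exists>S :: ('h \<Rightarrow>\<^sub>L complex) \<Rightarrow> 'h. \<forall>u x. Re (blinfun_apply u x) = inner x (S u)" by
      (intro choice) blast
  then obtain S :: "('h \<Rightarrow>\<^sub>L complex) \<Rightarrow> 'h" where S: "\<And>u x. Re (blinfun_apply u x) = inner x (S u)" by blast
  have eqI: "S u = z" if "\<And>x. Re (blinfun_apply u x) = inner x z" for u z
    using that[of "S u - z"] S[of u "S u - z"] inner_eq_zero_iff[of "S u - z"] by
        (simp add: inner_diff_right)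
  show thesis
  proof (rule that)
    show "bounded_linear S"
    proof (rule bounded_linear_intro[where K=1])
      show "S (u + v) = S u + S v" for u v
        by (rule eqI) (simp add: blinfun.bilinear_simps S inner_add_right)
      show "S (r *\<^sub>R u) = r *\<^sub>R S u" for r u
        by (rule eqI) (simp add: blinfun.bilinear_simps S)
      show "norm (S u) \<le> norm u * 1" for u
      proof -
        have "norm (S u) * norm (S u) = Re (u (S u))" by (simp add: S dot_square_norm power2_eq_square)
        also have "\<dots> \<le> norm u * norm (S u)"
          using norm_blinfun[of u "S u"] complex_Re_le_cmod[of "u (S u)"] by linarith
        finally show ?thesis by (cases "norm (S u) = 0") auto
      qed
    qed
    show "S (dual_of y) = y" for y by (rule eqI) (simp add: Re_cinner)
  qed
qed

section \<open>Continuity with respect to seminorms\<close>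

lemma topspace_seminorm_topology [simp]: "topspace (seminorm_topology V P) = V"
  unfolding seminorm_topology_def topology_generated_by_topspace by auto

text \<open>Generating sets are balls around arbitrary centres. The triangle inequality recentres
  such a ball at any of its points \<open>x\<close>, and finite intersections collect finitely many
  seminorms with the smallest radius.\<close>

lemma openin_seminorm_topology_nbhd:
  assumes V: "csubspace V" and P: "\<And>p. p \<in> P \<Longrightarrow> seminorm_on V p"
    and "openin (seminorm_topology V P) U" "x \<in> U"
  obtains F \<epsilon> where "finite F" "F \<subseteq> P" "\<epsilon> > 0" "{y \<in> V. \<forall>p\<in>F. p (y - x) < \<epsilon>} \<subseteq> U"
proof -
  let ?S = "insert V {{y \<in> V. p (y - x) < \<epsilon>} | p x \<epsilon>. p \<in> P \<and> x \<in> V \<and> 0 < \<epsilon>}"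
  have "generate_topology_on ?S U"
    using assms(3) unfolding seminorm_topology_def openin_topology_generated_by_iff .
  then have "\<forall>x\<in>U. \<exists>F \<epsilon>. finite F \<and> F \<subseteq> P \<and> \<epsilon> > 0 \<and> {y \<in> V. \<forall>p\<in>F. p (y - x) < \<epsilon>} \<subseteq> U"
  proof induction
    case Empty
    then show ?case by simp
  next
    case (Int a b)
    show ?case
    proof
      fix x assume "x \<in> a \<inter> b"
      then obtain F \<epsilon> F' \<epsilon>' where *: "finite F" "F \<subseteq> P" "\<epsilon> > 0" "{y \<in> V. \<forall>p\<in>F. p (y - x) < \<epsilon>} \<subseteq> a"
        "finite F'" "F' \<subseteq> P" "\<epsilon>' > 0" "{y \<in> V. \<forall>p\<in>F'. p (y - x) < \<epsilon>'} \<subseteq> b"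
        using Int.IH by (meson IntD1 IntD2)
      then show "\<exists>F \<epsilon>. finite F \<and> F \<subseteq> P \<and> \<epsilon> > 0 \<and> {y \<in> V. \<forall>p\<in>F. p (y - x) < \<epsilon>} \<subseteq> a \<inter> b"
        by (intro exI[of _ "F \<union> F'"] exI[of _ "min \<epsilon> \<epsilon>'"]) auto
    qed
  next
    case (UN K)
    then show ?case by (meson Union_iff Union_upper order_trans)
  next
    case (Basis s)
    show ?case
    proof
      fix x assume x: "x \<in> s"
      show "\<exists>F \<epsilon>. finite F \<and> F \<subseteq> P \<and> \<epsilon> > 0 \<and> {y \<in> V. \<forall>p\<in>F. p (y - x) < \<epsilon>} \<subseteq> s"
      proof (cases "s = V")
        case True
        then show ?thesis by (intro exI[of _ "{}"] exI[of _ 1]) auto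
      next
        case False
        then obtain p x0 \<epsilon> where s: "s = {y \<in> V. p (y - x0) < \<epsilon>}" "p \<in> P" "x0 \<in> V"
          using Basis by blast
        have "{y \<in> V. \<forall>q\<in>{p}. q (y - x) < \<epsilon> - p (x - x0)} \<subseteq> s"
        proof
          fix y assume y: "y \<in> {y \<in> V. \<forall>q\<in>{p}. q (y - x) < \<epsilon> - p (x - x0)}"
          then have "p ((y - x) + (x - x0)) \<le> p (y - x) + p (x - x0)"
            using P[OF s(2)] x s csubspace_diff[OF V] unfolding seminorm_on_def by blast
          then show "y \<in> s" using y s by simp
        qed
        moreover have "\<epsilon> - p (x - x0) > 0" using x s by simp
        ultimately show ?thesis using s(2) by (intro exI[of _ "{p}"] exI[of _ "\<epsilon> - p (x - x0)"]) auto
      qed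
    qed
  qed
  then show thesis using assms(4) that by blast
qed

lemma continuous_functional_bound:
  assumes V: "csubspace V" and P: "\<And>p. p \<in> P \<Longrightarrow> seminorm_on V p"
    and \<eta>: "\<eta> \<in> top_dual (seminorm_topology V P)"
  obtains F C where "finite F" "F \<subseteq> P" "0 \<le> C" "\<And>v. v \<in> V \<Longrightarrow> cmod (\<eta> v) \<le> C * (\<Sum>p\<in>F. p v)"
proof -
  have lin: "clinear_on V \<eta>" and cont: "continuous_map (seminorm_topology V P) euclidean \<eta>"
    using \<eta> by (auto simp: top_dual_def)
  \<comment> \<open>Nonnegativity is a consequence of the axioms:
    \<open>0 = p (v - v) \<le> 2 * p v\<close>.\<close>
  have p0: "p v \<ge> 0" if "p \<in> P" "v \<in> V" for p v
  proof -
    have "p (scaleC 0 v) = 0" using P[OF that(1)] that(2) unfolding seminorm_on_def by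
        (metis mult_zero_left norm_zero)
    moreover have "p (v + scaleC (- 1) v) \<le> p v + p (scaleC (- 1) v)" "p (scaleC (- 1) v) = cmod
        (- 1) * p v"
      using P[OF that(1)] that(2) csubspace_scaleC[OF V that(2)] unfolding seminorm_on_def by blast+
    ultimately show ?thesis by (simp add: scaleC_minus1)
  qed
  have "openin (seminorm_topology V P) {v \<in> V. \<eta> v \<in> ball 0 1}"
    using openin_continuous_map_preimage[OF cont, of "ball 0 1"] by simp
  moreover have "0 \<in> {v \<in> V. \<eta> v \<in> ball 0 1}"
    using csubspace_0[OF V] clinear_on_0[OF lin V] by simp
  ultimately obtain F \<epsilon> where F: "finite F" "F \<subseteq> P" "\<epsilon> > 0" "{y \<in> V. \<forall>p\<in>F. p (y - 0) < \<epsilon>} \<subseteq>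
      {v \<in> V. \<eta> v \<in> ball 0 1}"
    by (rule openin_seminorm_topology_nbhd[OF V P, rotated 1]) auto
  show thesis
  proof (rule that[OF F(1,2)])
    show "0 \<le> 1 / \<epsilon>" using F(3) by simp
    fix v assume v: "v \<in> V"
    define s where "s = (\<Sum>p\<in>F. p v)"
    have s0: "s \<ge> 0" unfolding s_def using p0 F(2) v by (intro sum_nonneg) auto
    show "cmod (\<eta> v) \<le> 1 / \<epsilon> * (\<Sum>p\<in>F. p v)" unfolding s_def[symmetric]
    proof (rule field_le_epsilon)
      fix \<delta> :: real assume \<delta>: "\<delta> > 0"
      \<comment> \<open>This factor brings every seminorm of the scaled vector below
        \<open>\<epsilon>\<close>. The term \<open>\<epsilon> * \<delta>\<close> keeps the
        denominator positive when \<open>s = 0\<close> and reappears as the error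
        \<open>\<delta>\<close>, which is arbitrary.\<close>
      define t where "t = \<epsilon> / (s + \<epsilon> * \<delta>)"
      have pos: "s + \<epsilon> * \<delta> > 0" using s0 \<delta> F(3) by (simp add: add_nonneg_pos)
      have t: "t > 0" using pos F(3) by (simp add: t_def)
      have "p (scaleC t v) < \<epsilon>" if "p \<in> F" for p
      proof -
        have "p v \<le> s" unfolding s_def using F(1,2) that p0 v by (intro member_le_sum) auto
        have "p (scaleC t v) = t * p v" using P[of p] F(2) that v t unfolding seminorm_on_def by auto
        also have "\<dots> \<le> t * s" using \<open>p v \<le> s\<close> t by simp
        also have "\<dots> < \<epsilon>" using pos F(3) \<delta> by (simp add: t_def field_simps)
        finally show ?thesis .
      qed
      then have "scaleC t v \<in> {v \<in> V. \<eta> v \<in> ball 0 1}"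
        using F(4) csubspace_scaleC[OF V v] by auto
      then have "t * cmod (\<eta> v) < 1"
        using clinear_on_scaleC[OF lin v, of t] t by (simp add: scaleC_complex_def norm_mult)
      then show "cmod (\<eta> v) \<le> 1 / \<epsilon> * s + \<delta>"
        using pos F(3) by (simp add: t_def field_simps)
    qed
  qed
qed

lemma continuous_map_seminorm_topology:
  fixes f :: "'v::complex_vector \<Rightarrow> 'b::real_normed_vector"
  assumes F: "finite F" "F \<subseteq> P" and C: "0 \<le> C" and p0: "\<And>p. p \<in> F \<Longrightarrow> p 0 = 0"
    and bound: "\<And>x y. x \<in> V \<Longrightarrow> y \<in> V \<Longrightarrow> norm (f y - f x) \<le> C * (\<Sum>p\<in>F. p (y - x))"
  shows "continuous_map (seminorm_topology V P) euclidean f"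
  unfolding continuous_map_def
proof (intro conjI allI impI)
  show "f \<in> topspace (seminorm_topology V P) \<rightarrow> topspace euclidean" by simp
  fix O' :: "'b set" assume "openin euclidean O'"
  then have O': "open O'" by simp
  have "\<exists>T. openin (seminorm_topology V P) T \<and> x \<in> T \<and> T \<subseteq> {x \<in> V. f x \<in> O'}"
    if x: "x \<in> V" "f x \<in> O'" for x
  proof -
    obtain e where e: "e > 0" "ball (f x) e \<subseteq> O'" using O' x openE by blast
    \<comment> \<open>The added ones cover \<open>C = 0\<close> and empty \<open>F\<close>, and they
      make the final inequality strict.\<close>
    define \<delta> where "\<delta> = e / ((C + 1) * (card F + 1))"
    have \<delta>: "\<delta> > 0" using e C by (simp add: \<delta>_def add_nonneg_pos)
    define T where "T = V \<inter> (\<Inter>p\<in>F. {y \<in> V. p (y - x) < \<delta>})"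
    have "openin (seminorm_topology V P) {y \<in> V. p (y - x) < \<delta>}" if "p \<in> F" for p
      unfolding seminorm_topology_def
      by (rule topology_generated_by_Basis) (use that F x \<delta> in blast)
    moreover have "openin (seminorm_topology V P) V"
      by (metis openin_topspace topspace_seminorm_topology)
    ultimately have "openin (seminorm_topology V P) T"
      unfolding T_def using F(1)
      by (cases "F = {}") (auto intro!: openin_Int openin_Inter)
    moreover have "p (x - x) < \<delta>" if "p \<in> F" for p using p0[OF that] \<delta> by simp
    then have "x \<in> T" unfolding T_def using x by blast
    moreover have "T \<subseteq> {x \<in> V. f x \<in> O'}"
    proof
      fix y assume y: "y \<in> T"
      have sm: "(\<Sum>p\<in>F. p (y - x)) \<le> card F * \<delta>"
        using y by (intro sum_bounded_above) (auto simp: T_def intro: less_imp_le)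
      have "norm (f y - f x) \<le> C * (\<Sum>p\<in>F. p (y - x))" using bound[of x y] x y by (simp add: T_def)
      also have "\<dots> \<le> C * (card F * \<delta>)" using sm C by (intro mult_left_mono)
      also have "\<dots> \<le> C * ((card F + 1) * \<delta>)" using \<delta> C by (intro mult_left_mono) auto
      also have "\<dots> < (C + 1) * ((card F + 1) * \<delta>)"
        using \<delta> by (intro mult_strict_right_mono) (auto simp: add_nonneg_pos)
      also have "\<dots> = e" using C by (simp add: \<delta>_def)
      finally show "y \<in> {x \<in> V. f x \<in> O'}" using e(2) y by (auto simp: T_def dist_norm norm_minus_commute)
    qed
    ultimately show ?thesis by blast
  qed
  then show "openin (seminorm_topology V P) {x \<in> topspace (seminorm_topology V P). f x \<in> O'}"
    by (subst openin_subopen) auto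
qed

section \<open>Smearing a unitary representation\<close>

locale lie_group_rep = lie_group G A
  for G :: "('g::{t2_space,second_countable_topology}) monoid" (structure)
    and A :: "('g, 'e::real_normed_vector) chart set" +
  fixes \<mu> :: "'g measure" and \<pi> :: "'g \<Rightarrow> 'h::complex_hilbert_space \<Rightarrow>\<^sub>L 'h"
  assumes haar: "left_haar_measure G \<mu>" and rep: "unitary_rep G \<pi>"
begin

lemma sets_haar [measurable_cong]: "sets \<mu> = sets borel"
  using haar by (simp add: left_haar_measure_def)

lemma space_haar [simp]: "space \<mu> = UNIV"
  using sets_eq_imp_space_eq[OF sets_haar] by simp

lemma haar_compact: "compact K \<Longrightarrow> emeasure \<mu> K < \<infinity>"
  using haar by (simp add: left_haar_measure_def)

lemma compact_sets: "compact K \<Longrightarrow> K \<in> sets \<mu>"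
  by (simp add: sets_haar compact_imp_closed borel_closed)

lemma norm_integral_le:
  fixes F :: "'g \<Rightarrow> 'b::{banach, second_countable_topology}"
  assumes "integrable \<mu> F" "integrable \<mu> H" "\<And>g. norm (F g) \<le> H g"
  shows "norm (\<integral>g. F g \<partial>\<mu>) \<le> (\<integral>g. H g \<partial>\<mu>)"
proof -
  have "norm (\<integral>g. F g \<partial>\<mu>) \<le> (\<integral>g. norm (F g) \<partial>\<mu>)" by simp
  also have "\<dots> \<le> (\<integral>g. H g \<partial>\<mu>)" using assms by (intro integral_mono integrable_norm)
  finally show ?thesis .
qed

lemma continuous_measurable: "continuous_on UNIV F \<Longrightarrow> F \<in> borel_measurable \<mu>"
  using borel_measurable_continuous_onI measurable_cong_sets[OF sets_haar refl] by blast

text \<open>Invariance of \<open>\<mu>\<close> is stated for images, whereas \<open>distr\<close>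
  uses preimages; a preimage under \<open>h\<close> is an image under \<open>inv h\<close>.\<close>

lemma distr_left_mult: "distr \<mu> \<mu> (\<lambda>x. h \<otimes> x) = \<mu>"
proof (rule measure_eqI)
  fix X assume "X \<in> sets (distr \<mu> \<mu> (\<lambda>x. h \<otimes> x))"
  then have X: "X \<in> sets borel" using sets_haar by simp
  have cont: "continuous_on UNIV (\<lambda>x. h \<otimes> x)"
    by (intro continuous_on_mult continuous_intros)
  then have "(\<lambda>x. h \<otimes> x) \<in> borel_measurable \<mu>" by (rule continuous_measurable)
  then have meas: "(\<lambda>x. h \<otimes> x) \<in> measurable \<mu> \<mu>"
    using measurable_cong_sets[OF refl sets_haar] by blast
  have "(\<lambda>x. h \<otimes> x) -` X = (\<lambda>x. inv h \<otimes> x) ` X"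
  proof (intro subset_antisym subsetI)
    fix x assume "x \<in> (\<lambda>x. h \<otimes> x) -` X"
    moreover have "x = inv h \<otimes> (h \<otimes> x)" by (simp add: m_assoc[symmetric])
    ultimately show "x \<in> (\<lambda>x. inv h \<otimes> x) ` X" by blast
  qed (auto simp: m_assoc[symmetric])
  then show "emeasure (distr \<mu> \<mu> (\<lambda>x. h \<otimes> x)) X = emeasure \<mu> X"
    using haar X sets_haar by (simp add: emeasure_distr[OF meas] left_haar_measure_def)
qed simp

lemma integral_left_mult:
  fixes F :: "'g \<Rightarrow> complex"
  assumes "continuous_on UNIV F"
  shows "(\<integral>g. F (h \<otimes> g) \<partial>\<mu>) = (\<integral>g. F g \<partial>\<mu>)"
proof -
  have "continuous_on UNIV (\<lambda>x. h \<otimes> x)"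
    by (intro continuous_on_mult continuous_intros)
  then have meas: "(\<lambda>x. h \<otimes> x) \<in> measurable \<mu> \<mu>"
    using continuous_measurable measurable_cong_sets[OF refl sets_haar] by blast
  show ?thesis
    using integral_distr[OF meas continuous_measurable[OF assms]] by (simp add: distr_left_mult)
qed

section \<open>Continuous functions of compact support, test functions, unitarity\<close>

definition cc :: "('g \<Rightarrow> 'b::real_normed_vector) \<Rightarrow> bool" where
  "cc F \<longleftrightarrow> continuous_on UNIV F \<and> (\<exists>K. compact K \<and> (\<forall>g. g \<notin> K \<longrightarrow> F g = 0))"

lemma cc_integrable:
  fixes F :: "'g \<Rightarrow> 'b::{banach, second_countable_topology}"
  assumes "cc F"
  shows "integrable \<mu> F"
proof -
  obtain K where K: "compact K" "\<And>g. g \<notin> K \<Longrightarrow> F g = 0" and F: "continuous_on UNIV F"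
    using assms by (auto simp: cc_def)
  have "bounded (F ` K)"
    using compact_continuous_image[OF continuous_on_subset[OF F] K(1)] compact_imp_bounded by blast
  then obtain B where B: "\<And>g. g \<in> K \<Longrightarrow> norm (F g) \<le> B" by (auto simp: bounded_iff)
  show ?thesis
    by (rule integrableI_bounded_set[where A=K and B=B])
      (use K B compact_sets haar_compact continuous_measurable[OF F] in auto)
qed

lemma cc_bilinear:
  assumes "bounded_bilinear bil" "cc F" "continuous_on UNIV H"
  shows "cc (\<lambda>g. bil (F g) (H g))"
  using assms unfolding cc_def
  by (auto intro: bounded_bilinear.continuous_on[OF assms(1)] simp: bounded_bilinear.zero_left[OF assms(1)])

lemma cc_times: "cc F \<Longrightarrow> continuous_on UNIV H \<Longrightarrow> cc (\<lambda>g. F g * H g :: complex)"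
  by (rule cc_bilinear[OF bounded_bilinear_mult])

lemma cc_scaleR: "cc F \<Longrightarrow> continuous_on UNIV (c :: 'g \<Rightarrow> real) \<Longrightarrow> cc (\<lambda>g. c g *\<^sub>R F g)"
  by (rule cc_bilinear[OF bounded_bilinear.flip[OF bounded_bilinear_scaleR]])

lemma cc_add: assumes "cc F" "cc H" shows "cc (\<lambda>g. F g + H g)"
proof -
  obtain K L where "compact K" "\<And>g. g \<notin> K \<Longrightarrow> F g = 0" "compact L" "\<And>g. g \<notin> L \<Longrightarrow> H g = 0"
    using assms unfolding cc_def by metis
  then show ?thesis using assms unfolding cc_def
    by (intro conjI exI[of _ "K \<union> L"] continuous_intros compact_Un) auto
qed

lemma cc_zero: "cc (\<lambda>g. 0)"
  by (auto simp: cc_def)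

lemma cc_sum: "(\<And>i. i \<in> I \<Longrightarrow> cc (F i)) \<Longrightarrow> cc (\<lambda>g. \<Sum>i\<in>I. F i g)"
  by (induction I rule: infinite_finite_induct) (auto intro: cc_add cc_zero)

lemma cc_left:
  assumes "cc F"
  shows "cc (\<lambda>g. F (h \<otimes> g))"
proof -
  obtain K where K: "compact K" "\<And>g. g \<notin> K \<Longrightarrow> F g = 0" and F: "continuous_on UNIV F"
    using assms by (auto simp: cc_def)
  have "compact ((\<lambda>k. inv h \<otimes> k) ` K)"
    by (intro compact_continuous_image K continuous_on_mult continuous_intros)
  moreover have "F (h \<otimes> g) = 0" if "g \<notin> (\<lambda>k. inv h \<otimes> k) ` K" for g
  proof (rule K(2), rule notI)
    assume "h \<otimes> g \<in> K"
    moreover have "g = inv h \<otimes> (h \<otimes> g)" by (simp add: m_assoc[symmetric])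
    ultimately show False using that by blast
  qed
  moreover have "continuous_on UNIV (\<lambda>g. F (h \<otimes> g))"
    by (intro continuous_on_compose2[OF F] continuous_on_mult continuous_intros) auto
  ultimately show ?thesis unfolding cc_def by blast
qed

lemma test_function_smooth: "f \<in> test_functions A \<Longrightarrow> smooth_fun A f"
  by (simp add: test_functions_def)

lemma test_function_support:
  assumes "f \<in> test_functions A"
  obtains K where "compact K" "\<And>g. g \<notin> K \<Longrightarrow> f g = 0"
  using assms closure_subset[of "{g. f g \<noteq> 0}"] by (auto simp: test_functions_def intro: that)

lemma test_functionsI:
  assumes "smooth_fun A f" "compact K" "\<And>g. g \<notin> K \<Longrightarrow> f g = 0"
  shows "f \<in> test_functions A"
proof -
  have "closure {g. f g \<noteq> 0} \<subseteq> K"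
    using assms by (intro closure_minimal compact_imp_closed) auto
  then show ?thesis
    using assms compact_closed_subset[OF assms(2) closed_closure] by (simp add: test_functions_def)
qed

lemma test_function_cc: "f \<in> test_functions A \<Longrightarrow> cc f"
  unfolding cc_def using smooth_fun_continuous[OF test_function_smooth] test_function_support by metis

lemma pi_one [simp]: "\<pi> \<one> = id_blinfun"
  and pi_mult: "\<pi> (g \<otimes> h) = \<pi> g o\<^sub>L \<pi> h"
  and pi_scaleC: "\<pi> g (scaleC c x) = scaleC c (\<pi> g x)"
  and pi_cinner: "cinner (\<pi> g x) (\<pi> g y) = cinner x y"
  and pi_continuous: "continuous_on UNIV (\<lambda>g. \<pi> g x)"
  using rep unfolding unitary_rep_def by blast+

lemma pi_mult_apply: "\<pi> (g \<otimes> h) x = \<pi> g (\<pi> h x)"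
  by (simp add: pi_mult)

lemma pi_inv [simp]: "\<pi> (inv g) (\<pi> g x) = x" "\<pi> g (\<pi> (inv g) x) = x"
  using pi_mult_apply[of "inv g" g x] pi_mult_apply[of g "inv g" x] by auto

lemma pi_cinner_inv: "cinner (\<pi> g x) y = cinner x (\<pi> (inv g) y)"
  by (metis pi_cinner pi_inv(2))

lemma norm_pi [simp]: "norm (\<pi> g x) = norm x"
  by (metis Re_cinner norm_eq_sqrt_inner pi_cinner)

lemma continuous_pi: "continuous_on S f \<Longrightarrow> continuous_on S (\<lambda>g. \<pi> (f g) x)"
  using continuous_on_compose2[OF pi_continuous] by blast

lemma continuous_coefficient: "continuous_on UNIV (\<lambda>g. cinner (\<pi> g x) y)"
  by (rule bounded_linear.continuous_on[OF bounded_linear_cinner_left pi_continuous])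

text \<open>The vector pi(F) x, the integral of F(g) pi(g) x, in the weak sense. For
  \<open>cc F\<close> it exists by the Riesz theorem, see \<open>cinner_smear\<close>.\<close>

definition smear :: "('g \<Rightarrow> complex) \<Rightarrow> 'h \<Rightarrow> 'h" where
  "smear F x = (SOME z. \<forall>y. cinner z y = (\<integral>g. F g * cinner (\<pi> g x) y \<partial>\<mu>))"

lemma cc_coefficient_integrable: "cc F \<Longrightarrow> integrable \<mu> (\<lambda>g. F g * cinner (\<pi> g x) y)"
  by (intro cc_integrable cc_times continuous_coefficient)

lemma coefficient_integral_bound:
  assumes "cc F"
  shows "cmod (\<integral>g. F g * cinner (\<pi> g x) y \<partial>\<mu>) \<le> (\<integral>g. cmod (F g) \<partial>\<mu>) * norm x * norm y"
proof -
  have "cmod (\<integral>g. F g * cinner (\<pi> g x) y \<partial>\<mu>) \<le> (\<integral>g. cmod (F g) * (norm x * norm y) \<partial>\<mu>)"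
  proof (rule norm_integral_le)
    show "integrable \<mu> (\<lambda>g. cmod (F g) * (norm x * norm y))"
      using cc_integrable[OF assms] by (intro integrable_mult_left integrable_norm)
    show "cmod (F g * cinner (\<pi> g x) y) \<le> cmod (F g) * (norm x * norm y)" for g
      using norm_cinner[of "\<pi> g x" y] by (simp add: norm_mult mult_left_mono)
  qed (rule cc_coefficient_integrable[OF assms])
  then show ?thesis by (simp add: mult.assoc)
qed

lemma cinner_smear:
  assumes "cc F"
  shows "cinner (smear F x) y = (\<integral>g. F g * cinner (\<pi> g x) y \<partial>\<mu>)"
proof -
  \<comment> \<open>The integral is conjugate-linear in \<open>y\<close>, so the Riesz theorem is
    applied to its conjugate.\<close>
  let ?\<Phi> = "\<lambda>y. cnj (\<integral>g. F g * cinner (\<pi> g x) y \<partial>\<mu>)"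
  have "clinear_on UNIV ?\<Phi>"
    using cc_coefficient_integrable[OF assms, of x]
    by (simp add: clinear_on_def cinner_add_right cinner_scaleC_right distrib_left
        scaleC_complex_def mult.left_commute[of "F _"])
  moreover have "cmod (?\<Phi> y) \<le> ((\<integral>g. cmod (F g) \<partial>\<mu>) * norm x) * norm y" for y
    using coefficient_integral_bound[OF assms, of x y] by simp
  ultimately obtain z where z: "\<And>y. ?\<Phi> y = cinner y z" using riesz[of ?\<Phi>] by blast
  have "\<forall>y. cinner z y = (\<integral>g. F g * cinner (\<pi> g x) y \<partial>\<mu>)"
    using z by (metis cinner_commute complex_cnj_cnj)
  then show ?thesis unfolding smear_def by (rule someI2) blast
qed

lemma norm_smear:
  assumes "cc F"
  shows "norm (smear F x) \<le> (\<integral>g. cmod (F g) \<partial>\<mu>) * norm x"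
  using coefficient_integral_bound[OF assms]
  by (intro norm_le_cinner) (auto simp: cinner_smear[OF assms])

lemma norm_smear_le:
  assumes "cc F" "compact K" "\<And>g. g \<notin> K \<Longrightarrow> F g = 0" "\<And>g. g \<in> K \<Longrightarrow> cmod (F g) \<le> b"
  shows "norm (smear F x) \<le> b * measure \<mu> K * norm x"
proof -
  have K: "K \<in> sets \<mu>" using assms(2) by (rule compact_sets)
  have "(\<integral>g. cmod (F g) \<partial>\<mu>) \<le> (\<integral>g. b * indicator K g \<partial>\<mu>)"
  proof (rule integral_mono)
    show "integrable \<mu> (\<lambda>g. cmod (F g))" using cc_integrable[OF assms(1)] by (rule integrable_norm)
    show "integrable \<mu> (\<lambda>g. b * indicator K g)"
      using K haar_compact[OF assms(2)] by (intro integrable_mult_right integrable_real_indicator)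
    show "cmod (F g) \<le> b * indicator K g" for g
      using assms(3,4)[of g] by (cases "g \<in> K") auto
  qed
  also have "\<dots> = b * measure \<mu> K" using K by simp
  finally show ?thesis using norm_smear[OF assms(1), of x] by (meson mult_right_mono norm_ge_zero
      order_trans)
qed

lemma smear_eqI:
  assumes "cc F" "\<And>y. cinner z y = (\<integral>g. F g * cinner (\<pi> g x) y \<partial>\<mu>)"
  shows "smear F x = z"
  by (rule cinner_eq_left) (simp add: cinner_smear[OF assms(1)] assms(2))

lemma smear_add:
  assumes "cc F" "cc H"
  shows "smear (\<lambda>g. F g + H g) x = smear F x + smear H x"
  by (rule smear_eqI[OF cc_add[OF assms]])
    (use assms[THEN cc_coefficient_integrable] in \<open>simp add: cinner_add_left cinner_smear assms
        distrib_right\<close>)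

lemma smear_scaleC:
  assumes "cc F"
  shows "smear (\<lambda>g. c * F g) x = scaleC c (smear F x)"
proof (rule smear_eqI)
  show "cc (\<lambda>g. c * F g)" using cc_times[OF assms continuous_on_const, of c] by (simp add: mult.commute)
qed (simp add: cinner_scaleC_left cinner_smear assms mult.assoc)

lemma smear_scaleR:
  assumes "cc F"
  shows "smear (\<lambda>g. r *\<^sub>R F g) x = r *\<^sub>R smear F x"
  using smear_scaleC[OF assms, of "of_real r"] by (simp add: scaleR_scaleC scaleR_conv_of_real[symmetric])

lemma cc_minus: "cc F \<Longrightarrow> cc H \<Longrightarrow> cc (\<lambda>g. F g - H g)"
  using cc_add[OF _ cc_scaleR[of H "\<lambda>_. - 1"], of F] by simp

lemma smear_diff:
  assumes "cc F" "cc H"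
  shows "smear (\<lambda>g. F g - H g) x = smear F x - smear H x"
  using smear_add[OF assms(1) cc_scaleR[OF assms(2), of "\<lambda>_. - 1"]] smear_scaleR[OF assms(2), of
      "- 1"] by simp

lemma smear_sum:
  assumes "\<And>i. i \<in> I \<Longrightarrow> cc (F i)"
  shows "smear (\<lambda>g. \<Sum>i\<in>I. F i g) x = (\<Sum>i\<in>I. smear (F i) x)"
  by (rule smear_eqI[OF cc_sum[OF assms]])
    (use assms cc_coefficient_integrable in \<open>simp_all add: cinner_sum_left cinner_smear sum_distrib_right\<close>)

lemma smear_arg_diff:
  assumes "cc F"
  shows "smear F (x - y) = smear F x - smear F y"
  by (rule smear_eqI[OF assms])
    (use cc_coefficient_integrable[OF assms] in
      \<open>simp add: cinner_diff_left cinner_smear assms blinfun.diff_right right_diff_distrib\<close>)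

text \<open>Left invariance, by the substitution of \<open>k \<otimes> g\<close> for
  \<open>g\<close>. The action moves onto the function, so differentiating the orbit of a smeared
  vector means differentiating translates of \<open>F\<close>.\<close>

lemma pi_smear:
  assumes "cc F"
  shows "\<pi> k (smear F x) = smear (\<lambda>g. F (inv k \<otimes> g)) x"
proof (rule smear_eqI[OF cc_left[OF assms], symmetric])
  fix y
  have "cinner (\<pi> k (smear F x)) y = (\<integral>g. F g * cinner (\<pi> (k \<otimes> g) x) y \<partial>\<mu>)"
    unfolding pi_cinner_inv[of k] cinner_smear[OF assms] pi_mult_apply pi_cinner_inv[of k "\<pi> _ x"] ..
  also have "\<dots> = (\<integral>g. (\<lambda>g. F (inv k \<otimes> g) * cinner (\<pi> g x) y) (k \<otimes> g) \<partial>\<mu>)"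
    by (simp add: m_assoc[symmetric])
  also have "\<dots> = (\<integral>g. F (inv k \<otimes> g) * cinner (\<pi> g x) y \<partial>\<mu>)"
    using cc_times[OF cc_left[OF assms] continuous_coefficient]
    by (intro integral_left_mult) (simp add: cc_def)
  finally show "cinner (\<pi> k (smear F x)) y = (\<integral>g. F (inv k \<otimes> g) * cinner (\<pi> g x) y \<partial>\<mu>)" .
qed

subsection \<open>Approximate identities\<close>

text \<open>The left translates of \<open>O'\<close> are open, cover the group and have the same
  measure. By the Lindelof property countably many suffice, so if \<open>O'\<close> were null, the
  whole group would be null.\<close>

lemma haar_open_pos:
  assumes "open O'" "O' \<noteq> {}"
  shows "emeasure \<mu> O' \<noteq> 0"
proof
  assume 0: "emeasure \<mu> O' = 0"
  obtain x where x: "x \<in> O'" using assms by blast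
  let ?\<T> = "range (\<lambda>h. (\<lambda>y. h \<otimes> y) ` O')"
  have tr: "(\<lambda>y. h \<otimes> y) ` O' = (\<lambda>y. inv h \<otimes> y) -` O'" for h
  proof (intro subset_antisym subsetI)
    fix y assume "y \<in> (\<lambda>y. inv h \<otimes> y) -` O'"
    moreover have "y = h \<otimes> (inv h \<otimes> y)" by (simp add: m_assoc[symmetric])
    ultimately show "y \<in> (\<lambda>y. h \<otimes> y) ` O'" by blast
  qed (auto simp: m_assoc[symmetric])
  have op: "open S" if "S \<in> ?\<T>" for S
  proof -
    have "continuous_on UNIV (\<lambda>y. inv h \<otimes> y)" for h
      by (intro continuous_on_mult continuous_intros)
    then have "open ((\<lambda>y. inv h \<otimes> y) -` O')" for h using assms(1) continuous_on_open_vimage[of UNIV] by auto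
    then show ?thesis using that tr by auto
  qed
  have cov: "\<Union>?\<T> = UNIV"
  proof -
    have "y \<in> (\<lambda>z. (y \<otimes> inv x) \<otimes> z) ` O'" for y
      using x by (intro image_eqI[of _ _ x]) (auto simp: m_assoc)
    then show ?thesis by blast
  qed
  obtain \<F> where \<F>: "\<F> \<subseteq> ?\<T>" "countable \<F>" "\<Union>\<F> = \<Union>?\<T>"
    using Lindelof[of ?\<T>] op by metis
  have "emeasure \<mu> S = 0" if "S \<in> \<F>" for S
    using \<F>(1) that haar assms(1) 0 by (auto simp: left_haar_measure_def)
  moreover have "S \<in> sets \<mu>" if "S \<in> \<F>" for S using op \<F>(1) that sets_haar by auto
  ultimately have "\<Union>\<F> \<in> null_sets \<mu>"
    using \<F>(2) by (intro null_sets_UN'[of \<F> "\<lambda>S. S", simplified]) (auto simp: null_sets_def)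
  then show False using \<F>(3) cov haar by (auto simp: null_sets_def left_haar_measure_def)
qed

text \<open>A bump function supported in \<open>N\<close>, normalised to integral 1. The quantifiers
  matter: one \<open>f\<close> serves all \<open>F\<close> and all \<open>\<epsilon>\<close>,
  because the error depends only on the oscillation of \<open>F\<close> on \<open>N\<close>.\<close>

lemma approximate_identity:
  assumes N: "open N" "\<one> \<in> N"
  obtains f where "f \<in> test_functions A"
    and "\<forall>F \<epsilon>. continuous_on UNIV F \<longrightarrow> (\<forall>g\<in>N. cmod (F g - F \<one>) \<le> \<epsilon>) \<longrightarrow>
       cmod ((\<integral>g. f g * F g \<partial>\<mu>) - F \<one>) \<le> \<epsilon>"
proof -
  obtain r where r: "smooth_fun A r" "\<And>g. 0 \<le> r g" "(0::real) < r \<one>"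
    "compact (closure {g. r g \<noteq> 0})" "closure {g. r g \<noteq> 0} \<subseteq> N"
    by (rule bump_exists[OF N]) (rule that; simp)
  have r0: "r g = 0" if "g \<notin> closure {g. r g \<noteq> 0}" for g
    using that closure_subset[of "{g. r g \<noteq> 0}"] by auto
  have rc: "continuous_on UNIV r" by (rule smooth_fun_continuous[OF r(1)])
  then have ccr: "cc r" unfolding cc_def using r(4) r0 by blast
  define c where "c = (\<integral>g. r g \<partial>\<mu>)"
  have "c \<noteq> 0"
  proof
    assume "c = 0"
    then have "AE g in \<mu>. r g = 0"
      using integral_nonneg_eq_0_iff_AE[OF cc_integrable[OF ccr]] r(2) by (simp add: c_def)
    moreover have "open {g. 0 < r g}" using rc by (intro open_Collect_less continuous_intros) auto
    ultimately have "emeasure \<mu> {g. 0 < r g} = 0"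
      using r(2) sets_haar by (subst (asm) AE_iff_measurable[of "{g. 0 < r g}"]) (auto simp: less_le)
    then show False using haar_open_pos[OF \<open>open {g. 0 < r g}\<close>] r(3) by blast
  qed
  moreover have "c \<ge> 0" unfolding c_def using r(2) by simp
  ultimately have c: "c > 0" by simp
  define f where "f g = complex_of_real (r g / c)" for g
  have "smooth_fun A f"
    unfolding f_def
    by (rule smooth_fun_linear[OF bounded_linear_compose[OF bounded_linear_of_real
        bounded_linear_divide] r(1)])
  moreover have "f g = 0" if "g \<notin> closure {g. r g \<noteq> 0}" for g
    using r0[OF that] by (simp add: f_def)
  ultimately have f: "f \<in> test_functions A"
    by (rule test_functionsI[OF _ r(4)])
  show thesis
  proof (rule that[OF f], intro allI impI)
    fix F :: "'g \<Rightarrow> complex" and \<epsilon> assume F: "continuous_on UNIV F" "\<forall>g\<in>N. cmod (F g - F \<one>) \<le> \<epsilon>"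
    have int_f: "(\<integral>g. f g \<partial>\<mu>) = 1" using c by (simp add: f_def c_def)
    have i1: "integrable \<mu> (\<lambda>g. f g * H g)" if "continuous_on UNIV H" for H
      using cc_integrable[OF cc_times[OF test_function_cc[OF f] that]] .
    have "(\<integral>g. f g * F g \<partial>\<mu>) - F \<one> = (\<integral>g. f g * F g \<partial>\<mu>) - (\<integral>g. f g * F \<one> \<partial>\<mu>)"
      using int_f by simp
    also have "\<dots> = (\<integral>g. f g * F g - f g * F \<one> \<partial>\<mu>)"
      using i1[OF F(1)] i1[OF continuous_on_const] by simp
    also have "\<dots> = (\<integral>g. f g * (F g - F \<one>) \<partial>\<mu>)" by (simp add: right_diff_distrib)
    also have "cmod \<dots> \<le> (\<integral>g. (r g / c) * \<epsilon> \<partial>\<mu>)"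
    proof (rule norm_integral_le)
      show "integrable \<mu> (\<lambda>g. f g * (F g - F \<one>))" using F(1) by (intro i1 continuous_intros)
      show "integrable \<mu> (\<lambda>g. r g / c * \<epsilon>)" using cc_integrable[OF ccr] by simp
      show "cmod (f g * (F g - F \<one>)) \<le> r g / c * \<epsilon>" for g
      proof (cases "g \<in> N")
        case True
        then show ?thesis using bspec[OF F(2) True] r(2)[of g] c
          by (simp add: f_def norm_mult norm_divide mult_left_mono divide_right_mono)
      next
        case False
        then have "r g = 0" using r0 r(5) by blast
        then show ?thesis by (simp add: f_def)
      qed
    qed
    also have "\<dots> = \<epsilon>" using c by (simp add: c_def)
    finally show "cmod ((\<integral>g. f g * F g \<partial>\<mu>) - F \<one>) \<le> \<epsilon>" .
  qed
qed

lemma test_integrals_zero: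
  assumes "continuous_on UNIV F" "\<And>f. f \<in> test_functions A \<Longrightarrow> (\<integral>g. f g * F g \<partial>\<mu>) = 0"
  shows "F \<one> = 0"
proof (rule ccontr)
  assume "F \<one> \<noteq> 0"
  then have e: "cmod (F \<one>) / 2 > 0" by simp
  have "open {g. cmod (F g - F \<one>) < cmod (F \<one>) / 2}"
    using assms(1) by (intro open_Collect_less continuous_intros) auto
  moreover have "\<one> \<in> {g. cmod (F g - F \<one>) < cmod (F \<one>) / 2}" using e by simp
  ultimately obtain f where f: "f \<in> test_functions A"
    "\<forall>F' \<epsilon>. continuous_on UNIV F' \<longrightarrow>
       (\<forall>g\<in>{g. cmod (F g - F \<one>) < cmod (F \<one>) / 2}. cmod (F' g - F' \<one>) \<le> \<epsilon>) \<longrightarrow>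
       cmod ((\<integral>g. f g * F' g \<partial>\<mu>) - F' \<one>) \<le> \<epsilon>"
    by (rule approximate_identity)
  have "cmod ((\<integral>g. f g * F g \<partial>\<mu>) - F \<one>) \<le> cmod (F \<one>) / 2"
    by (rule f(2)[rule_format, OF assms(1)]) simp
  then show False using assms(2)[OF f(1)] e by simp
qed

text \<open>Take \<open>N\<close> where \<open>\<pi> g x\<close> is close to \<open>x\<close>. The
  same \<open>f\<close> then works for the coefficients with every \<open>y\<close>, with error
  \<open>\<epsilon> * norm y\<close>, and \<open>norm_le_cinner\<close> turns this into a norm
  bound.\<close>

lemma smear_approximates:
  assumes "\<epsilon> > 0"
  obtains f where "f \<in> test_functions A" "norm (smear f x - x) \<le> \<epsilon>"
proof -
  have "open {g. norm (\<pi> g x - x) < \<epsilon>}"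
    by (intro open_Collect_less continuous_intros continuous_pi)
  moreover have "\<one> \<in> {g. norm (\<pi> g x - x) < \<epsilon>}" using assms by simp
  ultimately obtain f where f: "f \<in> test_functions A"
    "\<forall>F' \<epsilon>'. continuous_on UNIV F' \<longrightarrow>
       (\<forall>g\<in>{g. norm (\<pi> g x - x) < \<epsilon>}. cmod (F' g - F' \<one>) \<le> \<epsilon>') \<longrightarrow>
       cmod ((\<integral>g. f g * F' g \<partial>\<mu>) - F' \<one>) \<le> \<epsilon>'"
    by (rule approximate_identity)
  have "cmod (cinner (smear f x - x) y) \<le> \<epsilon> * norm y" for y
  proof -
    have "cmod ((\<integral>g. f g * cinner (\<pi> g x) y \<partial>\<mu>) - cinner (\<pi> \<one> x) y) \<le> \<epsilon> * norm y"
    proof (rule f(2)[rule_format, OF continuous_coefficient])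
      fix g assume "g \<in> {g. norm (\<pi> g x - x) < \<epsilon>}"
      then have "norm (\<pi> g x - x) * norm y \<le> \<epsilon> * norm y" by (intro mult_right_mono) auto
      then show "cmod (cinner (\<pi> g x) y - cinner (\<pi> \<one> x) y) \<le> \<epsilon> * norm y"
        using norm_cinner[of "\<pi> g x - x" y] by (simp add: cinner_diff_left)
    qed
    then show ?thesis by (simp add: cinner_diff_left cinner_smear[OF test_function_cc[OF f(1)]])
  qed
  then have "norm (smear f x - x) \<le> \<epsilon>" using assms by (intro norm_le_cinner) auto
  then show thesis using f(1) that by blast
qed

end

section \<open>Smooth families of test functions\<close>

lemma smooth_on_fst: "open S \<Longrightarrow> smooth_on S fst"
  and smooth_on_snd: "open S \<Longrightarrow> smooth_on S snd"
  by (simp_all add: smooth_on_bounded_linear bounded_linear_fst bounded_linear_snd)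

context lie_group
begin

text \<open>Smoothness is joint in the parameter and the group variable. Locally in the parameter
  one compact set contains all supports; this permits differentiation under the integral and passes
  to derivatives of the family.\<close>

definition smooth_family :: "'e set \<Rightarrow> ('e \<Rightarrow> 'g \<Rightarrow> complex) \<Rightarrow> bool" where
  "smooth_family S \<Psi> \<longleftrightarrow> open S \<and>
     (\<forall>V \<psi>. (V, \<psi>) \<in> A \<longrightarrow> smooth_on (S \<times> \<psi> ` V) (\<lambda>(a, b). \<Psi> a (inv_into V \<psi> b))) \<and>
     (\<forall>a\<in>S. \<exists>N K. open N \<and> a \<in> N \<and> N \<subseteq> S \<and> compact K \<and> (\<forall>a'\<in>N. \<forall>g. g \<notin> K \<longrightarrow> \<Psi> a' g = 0))"

lemma smooth_family_open: "smooth_family S \<Psi> \<Longrightarrow> open S"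
  by (simp add: smooth_family_def)

lemma smooth_family_chart:
  "smooth_family S \<Psi> \<Longrightarrow> (V, \<psi>) \<in> A \<Longrightarrow> smooth_on (S \<times> \<psi> ` V) (\<lambda>(a, b). \<Psi> a (inv_into V \<psi> b))"
  unfolding smooth_family_def by blast

lemma smooth_family_support:
  assumes "smooth_family S \<Psi>" "a \<in> S"
  obtains N K where "open N" "a \<in> N" "N \<subseteq> S" "compact K" "\<And>a' g. a' \<in> N \<Longrightarrow> g \<notin> K \<Longrightarrow> \<Psi> a' g = 0"
  using assms unfolding smooth_family_def by metis

definition family_deriv :: "'e \<Rightarrow> ('e \<Rightarrow> 'g \<Rightarrow> complex) \<Rightarrow> 'e \<Rightarrow> 'g \<Rightarrow> complex" where
  "family_deriv \<xi> \<Psi> a g = frechet_derivative (\<lambda>a. \<Psi> a g) (at a) \<xi>"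

lemma family_has_derivative:
  assumes "smooth_family S \<Psi>" "a \<in> S"
  shows "((\<lambda>a. \<Psi> a g) has_derivative (\<lambda>\<xi>. family_deriv \<xi> \<Psi> a g)) (at a)"
proof -
  obtain V \<psi> where V: "(V, \<psi>) \<in> A" "g \<in> V" by (rule chart_at)
  have "(\<lambda>(a, b). \<Psi> a (inv_into V \<psi> b)) differentiable (at (a, \<psi> g))"
    using V(2) assms(2) by (intro smooth_on_differentiable[OF smooth_family_chart[OF assms(1) V(1)]]) auto
  from frechet_derivative_partial(1)[OF this]
  have "(\<lambda>a. \<Psi> a g) differentiable (at a)"
    using V by (auto simp: differentiable_def)
  then show ?thesis unfolding family_deriv_def using frechet_derivative_works by blast
qed

lemma smooth_family_deriv:
  assumes "smooth_family S \<Psi>"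
  shows "smooth_family S (family_deriv \<xi> \<Psi>)"
  unfolding smooth_family_def
proof (intro conjI allI impI ballI)
  show S: "open S" using assms by (rule smooth_family_open)
  fix V \<psi> assume V: "(V, \<psi>) \<in> A"
  have "open (S \<times> \<psi> ` V)" using S chart_open[OF V] by (intro open_Times) auto
  from smooth_on_partial(1)[OF this smooth_family_chart[OF assms V], of \<xi>]
  show "smooth_on (S \<times> \<psi> ` V) (\<lambda>(a, b). family_deriv \<xi> \<Psi> a (inv_into V \<psi> b))"
    by (simp add: family_deriv_def)
next
  fix a assume "a \<in> S"
  then obtain N K where N: "open N" "a \<in> N" "N \<subseteq> S" "compact K"
    "\<And>a' g. a' \<in> N \<Longrightarrow> g \<notin> K \<Longrightarrow> \<Psi> a' g = 0"
    by (rule smooth_family_support[OF assms]) blast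
  have "family_deriv \<xi> \<Psi> a' g = 0" if "a' \<in> N" "g \<notin> K" for a' g
    unfolding family_deriv_def
    using frechet_derivative_cong_open[OF N(1) that(1), of "\<lambda>a. \<Psi> a g" "\<lambda>_. 0"] N(5) that
    by (simp add: frechet_derivative_const)
  then show "\<exists>N K. open N \<and> a \<in> N \<and> N \<subseteq> S \<and> compact K \<and>
      (\<forall>a'\<in>N. \<forall>g. g \<notin> K \<longrightarrow> family_deriv \<xi> \<Psi> a' g = 0)"
    using N(1-4) by blast
qed

lemma smooth_family_continuous:
  assumes "smooth_family S \<Psi>"
  shows "continuous_on (S \<times> UNIV) (\<lambda>(a, g). \<Psi> a g)"
proof -
  have S: "open S" using assms by (rule smooth_family_open)
  have "isCont (\<lambda>(a, g). \<Psi> a g) (a, g)" if "a \<in> S" for a g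
  proof -
    obtain V \<psi> where V: "(V, \<psi>) \<in> A" "g \<in> V" by (rule chart_at)
    have "continuous_on (S \<times> V) (\<lambda>p. (fst p, \<psi> (snd p)))"
      by (intro continuous_intros continuous_on_compose2[OF continuous_chart[OF V(1)]]) auto
    then have "continuous_on (S \<times> V) (\<lambda>p. case (fst p, \<psi> (snd p)) of (a, b) \<Rightarrow> \<Psi> a (inv_into V \<psi> b))"
      by (rule continuous_on_compose2[OF smooth_on_continuous[OF smooth_family_chart[OF assms V(1)]]]) auto
    then have "continuous_on (S \<times> V) (\<lambda>(a, g). \<Psi> a g)"
      by (rule continuous_on_eq) (use V(1) in auto)
    moreover have "open (S \<times> V)" using S chart_open[OF V(1)] by (intro open_Times) auto
    ultimately show ?thesis using V(2) that continuous_on_eq_continuous_at by blast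
  qed
  then show ?thesis by (auto intro!: continuous_at_imp_continuous_on)
qed

lemma smooth_family_smooth_fun:
  assumes "smooth_family S \<Psi>" "a \<in> S"
  shows "smooth_fun A (\<Psi> a)"
proof (rule smooth_funI)
  fix V \<psi> assume V: "(V, \<psi>) \<in> A"
  have o: "open (\<psi> ` V)" "open (S \<times> \<psi> ` V)"
    using smooth_family_open[OF assms(1)] chart_open[OF V] by (auto intro: open_Times)
  have "smooth_on (\<psi> ` V) (\<lambda>b. (a, b))" using o by (intro smooth_on_Pair smooth_on_const smooth_on_ident)
  from smooth_on_compose[OF fin_dim_prod[OF fin_dim_model fin_dim_model] o _ this
      smooth_family_chart[OF assms(1) V]]
  show "smooth_on (\<psi> ` V) (\<lambda>b. \<Psi> a (inv_into V \<psi> b))" using assms(2) by auto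
qed

lemma smooth_family_translates:
  assumes f: "smooth_fun A f" "compact K" "\<And>g. g \<notin> K \<Longrightarrow> f g = 0" and U: "(U, \<phi>) \<in> A"
  shows "smooth_family (\<phi> ` U) (\<lambda>a g. f (inv (inv_into U \<phi> a) \<otimes> g))"
  unfolding smooth_family_def
proof (intro conjI allI impI ballI)
  show oU: "open (\<phi> ` U)" using chart_open[OF U] by blast
  fix V \<psi> assume V: "(V, \<psi>) \<in> A"
  have o: "open (\<phi> ` U \<times> \<psi> ` V)" using oU chart_open[OF V] by (intro open_Times) auto
  have "gsmooth (\<phi> ` U \<times> \<psi> ` V) (\<lambda>p. inv (inv_into U \<phi> (fst p)) \<otimes> inv_into V \<psi> (snd p))"
    by (intro gsmooth_mult gsmooth_inv gsmooth_compose[OF fin_dim_model gsmooth_chart[OF U] o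
        smooth_on_fst[OF o]]
        gsmooth_compose[OF fin_dim_model gsmooth_chart[OF V] o smooth_on_snd[OF o]]) auto
  from smooth_fun_gsmooth[OF f(1) this]
  show "smooth_on (\<phi> ` U \<times> \<psi> ` V) (\<lambda>(a, b). f (inv (inv_into U \<phi> a) \<otimes> inv_into V \<psi> b))"
    by (simp add: case_prod_beta')
next
  have oU: "open (\<phi> ` U)" using chart_open[OF U] by blast
  fix a assume "a \<in> \<phi> ` U"
  then obtain T L where TL: "open T" "a \<in> T" "T \<subseteq> L" "compact L" "L \<subseteq> \<phi> ` U"
    using fin_dim_compact_nbhd[OF fin_dim_model oU] by metis
  \<comment> \<open>The support of a translate of \<open>f\<close> is the translate of its support,
    so the product of the parameters in \<open>L\<close> with \<open>K\<close> contains all supports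
    in question.\<close>
  let ?K = "(\<lambda>p. inv_into U \<phi> (fst p) \<otimes> snd p) ` (L \<times> K)"
  have "continuous_on (L \<times> K) (\<lambda>p. inv_into U \<phi> (fst p) \<otimes> snd p)"
    using TL(5) by (intro continuous_on_mult continuous_on_compose2[OF continuous_chart_inv[OF U]]
        continuous_intros) auto
  then have "compact ?K" using TL(4) f(2) by (intro compact_continuous_image compact_Times)
  moreover have "f (inv (inv_into U \<phi> a') \<otimes> g) = 0" if "a' \<in> T" "g \<notin> ?K" for a' g
  proof (rule f(3), rule notI)
    assume "inv (inv_into U \<phi> a') \<otimes> g \<in> K"
    then have "(a', inv (inv_into U \<phi> a') \<otimes> g) \<in> L \<times> K" using that TL(3) by auto
    then have "inv_into U \<phi> a' \<otimes> (inv (inv_into U \<phi> a') \<otimes> g) \<in> ?K" by (rule rev_image_eqI) simp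
    then show False using that(2) by (simp add: m_assoc[symmetric])
  qed
  ultimately show "\<exists>N K. open N \<and> a \<in> N \<and> N \<subseteq> \<phi> ` U \<and> compact K \<and>
      (\<forall>a'\<in>N. \<forall>g. g \<notin> K \<longrightarrow> f (inv (inv_into U \<phi> a') \<otimes> g) = 0)"
    using TL by (intro exI[of _ T] exI[of _ ?K]) auto
qed

end

context lie_group_rep
begin

lemma smooth_family_cc:
  assumes "smooth_family S \<Psi>" "a \<in> S"
  shows "cc (\<Psi> a)"
proof -
  obtain N K where "a \<in> N" "compact K" "\<And>a' g. a' \<in> N \<Longrightarrow> g \<notin> K \<Longrightarrow> \<Psi> a' g = 0"
    using smooth_family_support[OF assms] by metis
  then show ?thesis
    using smooth_fun_continuous[OF smooth_family_smooth_fun[OF assms]] by (auto simp: cc_def)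
qed

text \<open>Differentiation under the integral. The mean value inequality bounds the linearization
  error at each point of the common support by the oscillation of the derivative, which is uniformly
  small there; \<open>norm_smear_le\<close> turns this into a norm estimate.\<close>

lemma smear_family_has_derivative:
  assumes \<Psi>: "smooth_family S \<Psi>" and a: "a \<in> S"
  shows "((\<lambda>a. smear (\<Psi> a) x) has_derivative (\<lambda>\<xi>. smear (family_deriv \<xi> \<Psi> a) x)) (at a)"
  unfolding has_derivative_at_alt
proof (intro conjI allI impI)
  obtain B :: "'e set" and c where fr: "frame B c" using fin_dim_model by (rule fin_dim_frame)
  then have fin: "finite B" and bl: "\<And>b. bounded_linear (c b)" by (auto simp: frame_def)
  have expand: "family_deriv \<xi> \<Psi> a' g = (\<Sum>b\<in>B. c b \<xi> *\<^sub>R family_deriv b \<Psi> a' g)" if "a' \<in> S" for \<xi> a' g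
    by (rule frame_apply[OF fr has_derivative_linear[OF family_has_derivative[OF \<Psi> that]]])
  have ccd: "cc (family_deriv b \<Psi> a')" if "a' \<in> S" for b a'
    using smooth_family_cc[OF smooth_family_deriv[OF \<Psi>] that] .
  have "(\<lambda>\<xi>. smear (family_deriv \<xi> \<Psi> a) x) = (\<lambda>\<xi>. \<Sum>b\<in>B. c b \<xi> *\<^sub>R smear (family_deriv b \<Psi> a) x)"
  proof
    fix \<xi>
    have "family_deriv \<xi> \<Psi> a = (\<lambda>g. \<Sum>b\<in>B. c b \<xi> *\<^sub>R family_deriv b \<Psi> a g)" using expand[OF a] by blast
    then have "smear (family_deriv \<xi> \<Psi> a) x = smear (\<lambda>g. \<Sum>b\<in>B. c b \<xi> *\<^sub>R family_deriv b \<Psi> a g) x"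
      by (rule arg_cong)
    also have "\<dots> = (\<Sum>b\<in>B. smear (\<lambda>g. c b \<xi> *\<^sub>R family_deriv b \<Psi> a g) x)"
      using ccd[OF a] by (intro smear_sum cc_scaleR) auto
    also have "\<dots> = (\<Sum>b\<in>B. c b \<xi> *\<^sub>R smear (family_deriv b \<Psi> a) x)"
      using smear_scaleR[OF ccd[OF a]] by simp
    finally show "smear (family_deriv \<xi> \<Psi> a) x = (\<Sum>b\<in>B. c b \<xi> *\<^sub>R smear (family_deriv b \<Psi> a) x)" .
  qed
  moreover have "bounded_linear (\<lambda>\<xi>. \<Sum>b\<in>B. c b \<xi> *\<^sub>R smear (family_deriv b \<Psi> a) x)"
    by (intro bounded_linear_sum bounded_linear_compose[OF bounded_linear_scaleR_left bl])
  ultimately show "bounded_linear (\<lambda>\<xi>. smear (family_deriv \<xi> \<Psi> a) x)"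
    by (simp only:)
  fix e :: real assume e: "e > 0"
  obtain N K where N: "open N" "a \<in> N" "N \<subseteq> S" "compact K" "\<And>a' g. a' \<in> N \<Longrightarrow> g \<notin> K \<Longrightarrow> \<Psi> a' g = 0"
    by (rule smooth_family_support[OF \<Psi> a]) blast
  \<comment> \<open>\<open>\<kappa>\<close> converts bounds in the frame directions into an operator
    norm bound, and \<open>M\<close> bounds \<open>measure \<mu> K * norm x\<close>. The summands 1
    keep both positive, so that \<open>\<epsilon>\<close> is well defined.\<close>
  define \<kappa> where "\<kappa> = (\<Sum>b\<in>B. onorm (c b)) + 1"
  have \<kappa>: "\<kappa> > 0" unfolding \<kappa>_def using onorm_pos_le[OF bl] by (simp add: add_nonneg_pos sum_nonneg)
  define M where "M = measure \<mu> K * norm x + 1"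
  have M: "M > 0" unfolding M_def by (simp add: add_nonneg_pos)
  define \<epsilon> where "\<epsilon> = e / (M * \<kappa>)"
  have \<epsilon>: "\<epsilon> > 0" using e M \<kappa> by (simp add: \<epsilon>_def)
  \<comment> \<open>Compactness of \<open>K\<close> makes continuity in the parameter at
    \<open>a\<close> uniform in the group variable.\<close>
  have "\<exists>X. a \<in> X \<and> open X \<and> (\<forall>a'\<in>X \<inter> S. \<forall>g\<in>K. dist (family_deriv b \<Psi> a' g) (family_deriv b \<Psi> a g) \<le>
      \<epsilon>)" for b
  proof -
    have "continuous_on (S \<times> K) (\<lambda>(a, g). family_deriv b \<Psi> a g)"
      by (rule continuous_on_subset[OF smooth_family_continuous[OF smooth_family_deriv[OF \<Psi>]]]) auto
    then show ?thesis by (rule continuous_on_prod_compactE[OF _ N(4) a \<epsilon>]) auto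
  qed
  then obtain X where X: "\<And>b. a \<in> X b" "\<And>b. open (X b)"
    "\<And>b a' g. a' \<in> X b \<Longrightarrow> a' \<in> S \<Longrightarrow> g \<in> K \<Longrightarrow> cmod (family_deriv b \<Psi> a' g - family_deriv b \<Psi> a g) \<le> \<epsilon>"
    unfolding dist_norm by (metis Int_iff)
  have "open (N \<inter> (\<Inter>b\<in>B. X b))" using N(1) X(2) fin by (intro open_Int open_INT) auto
  moreover have "a \<in> N \<inter> (\<Inter>b\<in>B. X b)" using N(2) X(1) by auto
  ultimately obtain d where d: "d > 0" "ball a d \<subseteq> N \<inter> (\<Inter>b\<in>B. X b)" using openE by blast
  have dS: "ball a d \<subseteq> S" using d(2) N(3) by auto
  have est: "cmod (\<Psi> y g - \<Psi> a g - family_deriv (y - a) \<Psi> a g) \<le> norm (y - a) * (\<epsilon> * \<kappa>)"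
    if y: "y \<in> ball a d" and g: "g \<in> K" for y g
  proof (rule differentiable_bound_linearization[where S="ball a d" and f="\<lambda>a. \<Psi> a g"
        and f'="\<lambda>a \<xi>. family_deriv \<xi> \<Psi> a g"])
    show "a + t *\<^sub>R (y - a) \<in> ball a d" if "t \<in> {0..1}" for t
    proof -
      have "norm (t *\<^sub>R (y - a)) \<le> norm (y - a)" using that by (simp add: mult_left_le_one_le)
      then show ?thesis using y by (simp add: dist_norm norm_minus_commute)
    qed
    show "((\<lambda>a. \<Psi> a g) has_derivative (\<lambda>\<xi>. family_deriv \<xi> \<Psi> z g)) (at z within ball a d)" if
        "z \<in> ball a d" for z
      using family_has_derivative[OF \<Psi>] dS that has_derivative_at_withinI by blast
    show "onorm ((\<lambda>\<xi>. family_deriv \<xi> \<Psi> z g) - (\<lambda>\<xi>. family_deriv \<xi> \<Psi> a g)) \<le> \<epsilon> * \<kappa>" if z: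
        "z \<in> ball a d" for z
    proof (rule onorm_bound)
      show "0 \<le> \<epsilon> * \<kappa>" using \<epsilon> \<kappa> by simp
      fix \<xi>
      have "((\<lambda>\<xi>. family_deriv \<xi> \<Psi> z g) - (\<lambda>\<xi>. family_deriv \<xi> \<Psi> a g)) \<xi> =
         (\<Sum>b\<in>B. c b \<xi> *\<^sub>R (family_deriv b \<Psi> z g - family_deriv b \<Psi> a g))"
        using expand[OF a, of \<xi> g] expand[of z \<xi> g] z dS by (auto simp: sum_subtractf scaleR_diff_right)
      also have "norm \<dots> \<le> (\<Sum>b\<in>B. (onorm (c b) * norm \<xi>) * \<epsilon>)"
      proof (rule sum_norm_le)
        fix b assume b: "b \<in> B"
        have "z \<in> X b" "z \<in> S" using b z d(2) dS by blast+
        then have "cmod (family_deriv b \<Psi> z g - family_deriv b \<Psi> a g) \<le> \<epsilon>" using X(3) g by blast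
        then show "norm (c b \<xi> *\<^sub>R (family_deriv b \<Psi> z g - family_deriv b \<Psi> a g)) \<le> (onorm (c b) *
            norm \<xi>) * \<epsilon>"
          using onorm[OF bl, of b \<xi>] onorm_pos_le[OF bl, of b] unfolding norm_scaleR
          by (intro mult_mono) auto
      qed
      also have "\<dots> = (\<Sum>b\<in>B. onorm (c b)) * (norm \<xi> * \<epsilon>)" by (simp add: sum_distrib_right mult.assoc)
      also have "\<dots> \<le> \<kappa> * (norm \<xi> * \<epsilon>)" using \<epsilon> by (intro mult_right_mono) (auto simp: \<kappa>_def)
      finally show "norm (((\<lambda>\<xi>. family_deriv \<xi> \<Psi> z g) - (\<lambda>\<xi>. family_deriv \<xi> \<Psi> a g)) \<xi>) \<le> \<epsilon> * \<kappa> * norm \<xi>"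
        by (simp add: mult_ac)
    qed
    show "a \<in> ball a d" using d(1) by simp
  qed
  show "\<exists>d>0. \<forall>y. norm (y - a) < d \<longrightarrow>
      norm (smear (\<Psi> y) x - smear (\<Psi> a) x - smear (family_deriv (y - a) \<Psi> a) x) \<le> e * norm (y - a)"
  proof (intro exI[of _ d] conjI allI impI d(1))
    fix y assume "norm (y - a) < d"
    then have y: "y \<in> ball a d" by (simp add: dist_norm norm_minus_commute)
    let ?R = "\<lambda>g. \<Psi> y g - \<Psi> a g - family_deriv (y - a) \<Psi> a g"
    have ccs: "cc (\<Psi> y)" "cc (\<Psi> a)" "cc (family_deriv (y - a) \<Psi> a)"
      using smooth_family_cc[OF \<Psi>] ccd a y dS by auto
    have z: "?R g = 0" if "g \<notin> K" for g
    proof -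
      have "family_deriv (y - a) \<Psi> a g = 0"
        unfolding family_deriv_def
        using frechet_derivative_cong_open[OF N(1,2), of "\<lambda>a. \<Psi> a g" "\<lambda>_. 0"] N(5) that
        by (simp add: frechet_derivative_const)
      then show ?thesis using N(2,5) that y d(2) by auto
    qed
    have "smear (\<Psi> y) x - smear (\<Psi> a) x - smear (family_deriv (y - a) \<Psi> a) x = smear ?R x"
      using ccs by (simp add: smear_diff cc_minus)
    also have "norm \<dots> \<le> (norm (y - a) * (\<epsilon> * \<kappa>)) * measure \<mu> K * norm x"
      by (rule norm_smear_le[OF _ N(4) z est[OF y]]) (use ccs in \<open>auto intro: cc_minus\<close>)
    also have "\<dots> = (norm (y - a) * (\<epsilon> * \<kappa>)) * (measure \<mu> K * norm x)" by simp
    also have "\<dots> \<le> (norm (y - a) * (\<epsilon> * \<kappa>)) * M"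
      using \<epsilon> \<kappa> by (intro mult_left_mono) (auto simp: M_def)
    also have "\<dots> = e * norm (y - a)" using M \<kappa> by (simp add: \<epsilon>_def)
    finally show "norm (smear (\<Psi> y) x - smear (\<Psi> a) x - smear (family_deriv (y - a) \<Psi> a) x) \<le> e *
        norm (y - a)" .
  qed
qed

lemma smear_family_smooth:
  assumes "smooth_family S \<Psi>"
  shows "smooth_on S (\<lambda>a. smear (\<Psi> a) x)"
proof (rule smooth_on_family[where P="\<lambda>f. \<exists>\<Psi>. smooth_family S \<Psi> \<and> f = (\<lambda>a. smear (\<Psi> a) x)"])
  show "open S" using assms by (rule smooth_family_open)
  show "\<exists>\<Psi>'. smooth_family S \<Psi>' \<and> (\<lambda>a. smear (\<Psi> a) x) = (\<lambda>a. smear (\<Psi>' a) x)" using assms by blast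
next
  fix f a assume "\<exists>\<Psi>. smooth_family S \<Psi> \<and> f = (\<lambda>a. smear (\<Psi> a) x)" "a \<in> S"
  then show "f differentiable at a"
    using smear_family_has_derivative unfolding differentiable_def by blast
next
  fix f \<xi> assume "\<exists>\<Psi>. smooth_family S \<Psi> \<and> f = (\<lambda>a. smear (\<Psi> a) x)"
  then obtain \<Psi> where \<Psi>: "smooth_family S \<Psi>" "f = (\<lambda>a. smear (\<Psi> a) x)" by blast
  have "smear (family_deriv \<xi> \<Psi> a) x = frechet_derivative f (at a) \<xi>" if "a \<in> S" for a
    using frechet_derivative_at[OF smear_family_has_derivative[OF \<Psi>(1) that, of x]] unfolding \<Psi>(2) by metis
  then show "\<exists>f'. (\<exists>\<Psi>. smooth_family S \<Psi> \<and> f' = (\<lambda>a. smear (\<Psi> a) x)) \<and>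
      (\<forall>a\<in>S. f' a = frechet_derivative f (at a) \<xi>)"
    using smooth_family_deriv[OF \<Psi>(1), of \<xi>] by blast
qed

section \<open>The chart at the identity and derivatives of smeared vectors\<close>

definition id_dom :: "'g set" where "id_dom = fst (id_chart G A)"
definition id_map :: "'g \<Rightarrow> 'e" where "id_map = snd (id_chart G A)"
definition id_inv :: "'e \<Rightarrow> 'g" where "id_inv = inv_into id_dom id_map"
definition id_pt :: 'e where "id_pt = id_map \<one>"

lemma id_chart_mem: "(id_dom, id_map) \<in> A" and one_in_id_dom: "\<one> \<in> id_dom"
proof -
  obtain U \<phi> where "(U, \<phi>) \<in> A" "\<one> \<in> U" by (rule chart_at)
  then have "\<exists>c. c \<in> A \<and> \<one> \<in> fst c" by (intro exI[of _ "(U, \<phi>)"]) simp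
  then have "id_chart G A \<in> A \<and> \<one> \<in> fst (id_chart G A)"
    unfolding id_chart_def by (rule someI_ex)
  then show "(id_dom, id_map) \<in> A" "\<one> \<in> id_dom" by (auto simp: id_dom_def id_map_def)
qed

lemma id_pt_mem: "id_pt \<in> id_map ` id_dom"
  using one_in_id_dom by (simp add: id_pt_def)

lemma id_inv_pt [simp]: "id_inv id_pt = \<one>"
  using chart_inv[OF id_chart_mem one_in_id_dom] by (simp add: id_inv_def id_pt_def)

lemma open_id_chart: "open (id_map ` id_dom)" "open id_dom"
  using chart_open[OF id_chart_mem] by auto

lemma gsmooth_id_inv: "gsmooth (id_map ` id_dom) id_inv"
  unfolding id_inv_def by (rule gsmooth_chart[OF id_chart_mem])

lemma lie_rep_eq: "lie_rep G A \<rho> \<xi> v = frechet_derivative (\<lambda>a. \<rho> (id_inv a) v) (at id_pt) \<xi>"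
  by (simp add: lie_rep_def split_beta id_inv_def id_pt_def id_dom_def id_map_def)

text \<open>The right-invariant vector field of \<open>\<xi>\<close>, up to sign, acting on functions.\<close>

definition vfield :: "'e \<Rightarrow> ('g \<Rightarrow> complex) \<Rightarrow> 'g \<Rightarrow> complex" where
  "vfield \<xi> f = family_deriv \<xi> (\<lambda>a g. f (inv (id_inv a) \<otimes> g)) id_pt"

lemma translates_family:
  assumes "f \<in> test_functions A" "(U, \<phi>) \<in> A"
  shows "smooth_family (\<phi> ` U) (\<lambda>a g. f (inv (inv_into U \<phi> a) \<otimes> g))"
  using test_function_support[OF assms(1)] smooth_family_translates[OF test_function_smooth[OF
      assms(1)] _ _ assms(2)]
  by metis

lemma id_translates_family:
  "f \<in> test_functions A \<Longrightarrow> smooth_family (id_map ` id_dom) (\<lambda>a g. f (inv (id_inv a) \<otimes> g))"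
  unfolding id_inv_def by (rule translates_family[OF _ id_chart_mem])

text \<open>For \<open>a\<close> near \<open>id_pt\<close> the translated point stays in the open
  complement of \<open>K\<close>, so the function that is differentiated vanishes near
  \<open>id_pt\<close>.\<close>

lemma vfield_support:
  assumes "closed K" "\<And>g. g \<notin> K \<Longrightarrow> f g = 0" "g \<notin> K"
  shows "vfield \<xi> f g = 0"
proof -
  have "gsmooth (id_map ` id_dom) (\<lambda>a. inv (id_inv a) \<otimes> g)"
    by (intro gsmooth_mult gsmooth_inv gsmooth_id_inv gsmooth_const open_id_chart)
  then have o: "open (id_map ` id_dom \<inter> (\<lambda>a. inv (id_inv a) \<otimes> g) -` (- K))"
    using assms(1) gsmooth_open_preimage by (metis open_Compl)
  have "id_pt \<in> id_map ` id_dom \<inter> (\<lambda>a. inv (id_inv a) \<otimes> g) -` (- K)"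
    using id_pt_mem assms(3) by simp
  from frechet_derivative_cong_open[OF o this, of "\<lambda>a. f (inv (id_inv a) \<otimes> g)" "\<lambda>_. 0"] assms(2)
  show ?thesis by (simp add: vfield_def family_deriv_def frechet_derivative_const)
qed

lemma vfield_test:
  assumes "f \<in> test_functions A"
  shows "vfield \<xi> f \<in> test_functions A"
proof -
  obtain K where K: "compact K" "\<And>g. g \<notin> K \<Longrightarrow> f g = 0" using test_function_support[OF assms] by blast
  show ?thesis
  proof (rule test_functionsI[OF _ K(1)])
    show "smooth_fun A (vfield \<xi> f)"
      unfolding vfield_def
      by (rule smooth_family_smooth_fun[OF smooth_family_deriv[OF id_translates_family[OF assms]]
          id_pt_mem])
    show "vfield \<xi> f g = 0" if "g \<notin> K" for g
      by (rule vfield_support[OF compact_imp_closed[OF K(1)] K(2) that])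
  qed
qed

text \<open>By \<open>pi_smear\<close> the orbit map in a chart is the smearing of translates of
  \<open>f\<close>, which form a smooth family.\<close>

lemma smear_smooth:
  assumes "f \<in> test_functions A"
  shows "smear f x \<in> pi_smooth A \<pi>"
proof -
  have "smooth_fun A (\<lambda>g. \<pi> g (smear f x))"
  proof (rule smooth_funI)
    fix U \<phi> assume U: "(U, \<phi>) \<in> A"
    show "smooth_on (\<phi> ` U) (\<lambda>a. \<pi> (inv_into U \<phi> a) (smear f x))"
      using smear_family_smooth[OF translates_family[OF assms U]]
      by (simp add: pi_smear[OF test_function_cc[OF assms]])
  qed
  then show ?thesis by (simp add: pi_smooth_def smooth_vectors_def)
qed

abbreviation lie :: "'e \<Rightarrow> 'h \<Rightarrow> 'h" where "lie \<equiv> lie_rep G A (\<lambda>g. blinfun_apply (\<pi> g))"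

text \<open>The derivative falls entirely on the test function. Although \<open>lie \<xi>\<close> is
  unbounded, its composition with \<open>smear f\<close> is thus a bounded operator applied to
  \<open>x\<close>.\<close>

lemma lie_smear:
  assumes "f \<in> test_functions A"
  shows "lie \<xi> (smear f x) = smear (vfield \<xi> f) x"
proof -
  have "((\<lambda>a. \<pi> (id_inv a) (smear f x)) has_derivative (\<lambda>\<xi>. smear (vfield \<xi> f) x)) (at id_pt)"
    using smear_family_has_derivative[OF id_translates_family[OF assms] id_pt_mem]
    by (simp add: vfield_def pi_smear[OF test_function_cc[OF assms]])
  then show ?thesis unfolding lie_rep_eq using frechet_derivative_at by metis
qed

section \<open>The Lie algebra acting on smooth vectors\<close>

abbreviation smooths :: "'h set" where "smooths \<equiv> pi_smooth A \<pi>"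

lemma smooths_iff: "v \<in> smooths \<longleftrightarrow> smooth_fun A (\<lambda>g. \<pi> g v)"
  by (simp add: pi_smooth_def smooth_vectors_def)

lemma csubspace_smooths: "csubspace smooths"
  by (auto simp: csubspace_def smooths_iff blinfun.add_right pi_scaleC intro: smooth_fun_const
      smooth_fun_add
      smooth_fun_linear[OF bounded_linear_scaleC])

lemmas smooths_0 = csubspace_0[OF csubspace_smooths]
  and smooths_add = csubspace_add[OF csubspace_smooths]
  and smooths_scaleC = csubspace_scaleC[OF csubspace_smooths]
  and smooths_scaleR = csubspace_scaleR[OF csubspace_smooths]

lemma smooths_sum_list: "(\<And>x. x \<in> set xs \<Longrightarrow> f x \<in> smooths) \<Longrightarrow> sum_list (map f xs) \<in> smooths"
  by (induction xs) (auto intro: smooths_0 smooths_add)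

lemma pi_smooths: "v \<in> smooths \<Longrightarrow> \<pi> h v \<in> smooths"
  using smooth_fun_right unfolding smooths_iff pi_mult_apply[symmetric] by blast

lemma orbit_has_derivative:
  assumes "v \<in> smooths"
  shows "((\<lambda>a. \<pi> (id_inv a) v) has_derivative (\<lambda>\<xi>. lie \<xi> v)) (at id_pt)"
proof -
  have "smooth_on (id_map ` id_dom) (\<lambda>a. \<pi> (id_inv a) v)"
    using smooth_fun_gsmooth[OF _ gsmooth_id_inv] assms smooths_iff by blast
  from smooth_on_has_derivative[OF this id_pt_mem] show ?thesis by (simp add: lie_rep_eq)
qed

lemma lie_eqI: "((\<lambda>a. \<pi> (id_inv a) v) has_derivative D) (at id_pt) \<Longrightarrow> lie \<xi> v = D \<xi>"
  unfolding lie_rep_eq using frechet_derivative_at by metis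

lemma lie_add:
  assumes "v \<in> smooths" "w \<in> smooths"
  shows "lie \<xi> (v + w) = lie \<xi> v + lie \<xi> w"
  by (rule lie_eqI) (use assms[THEN orbit_has_derivative] in \<open>auto simp: blinfun.add_right intro:
      has_derivative_add\<close>)

lemma lie_scaleC:
  assumes "v \<in> smooths"
  shows "lie \<xi> (scaleC c v) = scaleC c (lie \<xi> v)"
  by (rule lie_eqI) (use bounded_linear.has_derivative[OF bounded_linear_scaleC
      orbit_has_derivative[OF assms]] in
      \<open>auto simp: pi_scaleC\<close>)

lemma lie_scaleR: "v \<in> smooths \<Longrightarrow> lie \<xi> (r *\<^sub>R v) = r *\<^sub>R lie \<xi> v"
  by (simp add: scaleR_scaleC lie_scaleC)

lemma lie_0: "lie \<xi> 0 = 0"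
  using lie_scaleC[OF smooths_0, of \<xi> 0] by simp

lemma linear_lie: "v \<in> smooths \<Longrightarrow> linear (\<lambda>\<xi>. lie \<xi> v)"
  using orbit_has_derivative has_derivative_linear by blast

lemma lie_sum_list:
  assumes "\<And>x. x \<in> set xs \<Longrightarrow> f x \<in> smooths"
  shows "lie \<xi> (sum_list (map f xs)) = sum_list (map (\<lambda>x. lie \<xi> (f x)) xs)"
  using assms
proof (induction xs)
  case (Cons x xs)
  then show ?case using lie_add[of "f x" "sum_list (map f xs)"] smooths_sum_list[of xs f] by simp
qed (simp add: lie_0)

text \<open>The orbit map of \<open>lie \<xi> v\<close> at \<open>g\<close> is the derivative at
  \<open>a = id_pt\<close> of \<open>\<pi> (g \<otimes> id_inv a) v\<close>. This expression is
  jointly smooth in \<open>a\<close> and the coordinates of \<open>g\<close>, so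
  \<open>smooth_on_partial\<close> applies.\<close>

lemma lie_smooths:
  assumes v: "v \<in> smooths"
  shows "lie \<xi> v \<in> smooths"
  unfolding smooths_iff
proof (rule smooth_funI)
  fix V \<psi> assume V: "(V, \<psi>) \<in> A"
  let ?E = "id_map ` id_dom" and ?F = "\<lambda>p. \<pi> (inv_into V \<psi> (fst p) \<otimes> id_inv (snd p)) v"
  have oV: "open (\<psi> ` V)" using chart_open[OF V] by blast
  then have o: "open (\<psi> ` V \<times> ?E)" using open_id_chart by (intro open_Times)
  have "gsmooth (\<psi> ` V \<times> ?E) (\<lambda>p. inv_into V \<psi> (fst p) \<otimes> id_inv (snd p))"
    by (intro gsmooth_mult gsmooth_compose[OF fin_dim_model gsmooth_chart[OF V] o smooth_on_fst[OF o]]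
        gsmooth_compose[OF fin_dim_model gsmooth_id_inv o smooth_on_snd[OF o]]) auto
  then have F: "smooth_on (\<psi> ` V \<times> ?E) ?F"
    using smooth_fun_gsmooth v smooths_iff by blast
  have "smooth_on (\<psi> ` V) (\<lambda>b. (b, id_pt))" using oV by (intro smooth_on_Pair smooth_on_const
      smooth_on_ident)
  from smooth_on_compose[OF fin_dim_prod[OF fin_dim_model fin_dim_model] oV o _ this
      smooth_on_partial(2)[OF o F, of \<xi>]]
  have "smooth_on (\<psi> ` V) (\<lambda>b. frechet_derivative (\<lambda>a. \<pi> (inv_into V \<psi> b \<otimes> id_inv a) v) (at id_pt) \<xi>)"
    using id_pt_mem by auto
  moreover have "frechet_derivative (\<lambda>a. \<pi> (inv_into V \<psi> b \<otimes> id_inv a) v) (at id_pt) \<xi> = \<pi>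
      (inv_into V \<psi> b) (lie \<xi> v)" for b
    using frechet_derivative_at[OF bounded_linear.has_derivative[OF blinfun.bounded_linear_right
          orbit_has_derivative[OF v]], of "\<pi> (inv_into V \<psi> b)"] unfolding pi_mult_apply by metis
  ultimately show "smooth_on (\<psi> ` V) (\<lambda>a. \<pi> (inv_into V \<psi> a) (lie \<xi> v))" by simp
qed

text \<open>The inner product of the two orbit maps is constant by unitarity; differentiate it at
  the identity.\<close>

lemma lie_skew:
  assumes "u \<in> smooths" "v \<in> smooths"
  shows "cinner (lie \<xi> u) v = - cinner u (lie \<xi> v)"
proof -
  have bil: "bounded_bilinear (cinner :: 'h \<Rightarrow> _)"
    by unfold_locales (auto simp: cinner_add_left cinner_add_right cinner_scaleR_left cinner_scaleR_right
        scaleR_conv_of_real norm_cinner intro!: exI[of _ 1])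
  have "((\<lambda>a. cinner (\<pi> (id_inv a) u) (\<pi> (id_inv a) v)) has_derivative
     (\<lambda>\<xi>. cinner (\<pi> (id_inv id_pt) u) (lie \<xi> v) + cinner (lie \<xi> u) (\<pi> (id_inv id_pt) v))) (at id_pt)"
    by (rule bounded_bilinear.FDERIV[OF bil assms[THEN orbit_has_derivative]])
  then have "((\<lambda>a. cinner u v) has_derivative (\<lambda>\<xi>. cinner u (lie \<xi> v) + cinner (lie \<xi> u) v)) (at id_pt)"
    by (simp add: pi_cinner)
  then have "(\<lambda>\<xi>. cinner u (lie \<xi> v) + cinner (lie \<xi> u) v) = (\<lambda>\<xi>. 0)"
    using has_derivative_unique has_derivative_const by blast
  then have "cinner u (lie \<xi> v) + cinner (lie \<xi> u) v = 0" by metis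
  then show ?thesis by (simp add: eq_neg_iff_add_eq_0 add.commute)
qed

section \<open>Words in the Lie algebra and their conjugation by the group\<close>

abbreviation word :: "'e list \<Rightarrow> 'h \<Rightarrow> 'h" where "word \<equiv> foldr lie"

lemma word_smooths: "v \<in> smooths \<Longrightarrow> word \<xi>s v \<in> smooths"
  by (induction \<xi>s) (auto intro: lie_smooths)

lemma word_add: "v \<in> smooths \<Longrightarrow> w \<in> smooths \<Longrightarrow> word \<xi>s (v + w) = word \<xi>s v + word \<xi>s w"
  by (induction \<xi>s) (auto simp: lie_add word_smooths)

lemma word_scaleC: "v \<in> smooths \<Longrightarrow> word \<xi>s (scaleC c v) = scaleC c (word \<xi>s v)"
  by (induction \<xi>s) (auto simp: lie_scaleC word_smooths)

lemma word_adjoint: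
  assumes "u \<in> smooths" "v \<in> smooths"
  shows "cinner (word \<xi>s u) v = (- 1) ^ length \<xi>s * cinner u (word (rev \<xi>s) v)"
  using assms(2)
proof (induction \<xi>s arbitrary: v)
  case (Cons \<xi> \<xi>s)
  then show ?case
    using lie_skew[OF word_smooths[OF assms(1)] Cons.prems, of \<xi> \<xi>s] Cons.IH[OF lie_smooths[OF
        Cons.prems]] by simp
qed simp

text \<open>Coordinates of \<open>Ad g \<xi>\<close> in the model space.\<close>

definition adj :: "'g \<Rightarrow> 'e \<Rightarrow> 'e" where
  "adj g \<xi> = frechet_derivative (\<lambda>a. id_map (g \<otimes> id_inv a \<otimes> inv g)) (at id_pt) \<xi>"

lemma smooth_adj: "smooth_fun A (\<lambda>g. adj g \<xi>)"
proof (rule smooth_funI)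
  fix V \<psi> assume V: "(V, \<psi>) \<in> A"
  let ?E = "id_map ` id_dom" and ?m = "\<lambda>p. inv_into V \<psi> (fst p) \<otimes> id_inv (snd p) \<otimes> inv (inv_into V \<psi>
      (fst p))"
  have oV: "open (\<psi> ` V)" using chart_open[OF V] by blast
  then have o: "open (\<psi> ` V \<times> ?E)" using open_id_chart by (intro open_Times)
  have "gsmooth (\<psi> ` V \<times> ?E) (\<lambda>p. inv_into V \<psi> (fst p))"
    by (intro gsmooth_compose[OF fin_dim_model gsmooth_chart[OF V] o smooth_on_fst[OF o]]) auto
  moreover have "gsmooth (\<psi> ` V \<times> ?E) (\<lambda>p. id_inv (snd p))"
    by (intro gsmooth_compose[OF fin_dim_model gsmooth_id_inv o smooth_on_snd[OF o]]) auto
  ultimately have gs: "gsmooth (\<psi> ` V \<times> ?E) ?m" by (intro gsmooth_mult gsmooth_inv)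
  \<comment> \<open>The conjugate can leave the chart at the identity, so the parameters are
    restricted to an open set where it does not. That set contains all \<open>(b, id_pt)\<close>,
    the points at which the derivative is taken.\<close>
  let ?O = "(\<psi> ` V \<times> ?E) \<inter> ?m -` id_dom"
  have oO: "open ?O" using gsmooth_open_preimage[OF gs open_id_chart(2)] .
  have F: "smooth_on ?O (\<lambda>p. id_map (?m p))" by (rule gsmooth_smooth[OF gs id_chart_mem])
  have "smooth_on (\<psi> ` V) (\<lambda>b. (b, id_pt))" using oV by (intro smooth_on_Pair smooth_on_const
      smooth_on_ident)
  moreover have "(\<lambda>b. (b, id_pt)) ` \<psi> ` V \<subseteq> ?O" using id_pt_mem one_in_id_dom by
      (simp add: image_subset_iff)
  ultimately show "smooth_on (\<psi> ` V) (\<lambda>b. adj (inv_into V \<psi> b) \<xi>)"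
    using smooth_on_compose[OF fin_dim_prod[OF fin_dim_model fin_dim_model] oV oO _ _
        smooth_on_partial(2)[OF oO F, of \<xi>],
        of "\<lambda>b. (b, id_pt)"] by (simp add: adj_def)
qed

text \<open>Since x g^-1 = g^-1 (g x g^-1), the orbit map of \<open>\<pi> (inv g) y\<close> is
  \<open>\<pi> (inv g)\<close> applied to the orbit map of \<open>y\<close> along the conjugated
  points. The chain rule brings in \<open>adj g\<close>.\<close>

lemma lie_pi_inv:
  assumes y: "y \<in> smooths"
  shows "lie \<xi> (\<pi> (inv g) y) = \<pi> (inv g) (lie (adj g \<xi>) y)"
proof (rule lie_eqI)
  let ?E = "id_map ` id_dom" and ?m = "\<lambda>a. g \<otimes> id_inv a \<otimes> inv g"
  have gs: "gsmooth ?E ?m"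
    by (intro gsmooth_mult gsmooth_inv gsmooth_const gsmooth_id_inv open_id_chart)
  let ?O = "?E \<inter> ?m -` id_dom"
  have oO: "open ?O" using gsmooth_open_preimage[OF gs open_id_chart(2)] .
  have pt: "id_pt \<in> ?O" using id_pt_mem one_in_id_dom by simp
  have "((\<lambda>a. id_map (?m a)) has_derivative adj g) (at id_pt)"
    using smooth_on_has_derivative[OF gsmooth_smooth[OF gs id_chart_mem] pt] unfolding adj_def .
  moreover have "((\<lambda>a. \<pi> (id_inv a) y) has_derivative (\<lambda>\<xi>. lie \<xi> y)) (at (id_map (?m id_pt)))"
    using orbit_has_derivative[OF y] by (simp add: id_pt_def[symmetric])
  ultimately have "((\<lambda>a. \<pi> (id_inv (id_map (?m a))) y) has_derivative (\<lambda>\<xi>. lie (adj g \<xi>) y)) (at id_pt)"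
    using diff_chain_at[of "\<lambda>a. id_map (?m a)" "adj g" id_pt "\<lambda>a. \<pi> (id_inv a) y" "\<lambda>\<xi>. lie \<xi> y"] by
        (simp add: o_def)
  then have d: "((\<lambda>a. \<pi> (inv g) (\<pi> (id_inv (id_map (?m a))) y)) has_derivative (\<lambda>\<xi>. \<pi> (inv g)
      (lie (adj g \<xi>) y))) (at id_pt)"
    by (rule bounded_linear.has_derivative[OF blinfun.bounded_linear_right])
  show "((\<lambda>a. \<pi> (id_inv a) (\<pi> (inv g) y)) has_derivative (\<lambda>\<xi>. \<pi> (inv g) (lie (adj g \<xi>) y))) (at id_pt)"
  proof (rule has_derivative_transform_within_open[OF d oO pt])
    fix a assume a: "a \<in> ?O"
    then have "id_inv (id_map (?m a)) = ?m a" unfolding id_inv_def using chart_inv[OF id_chart_mem] by simp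
    then show "\<pi> (inv g) (\<pi> (id_inv (id_map (?m a))) y) = \<pi> (id_inv a) (\<pi> (inv g) y)"
      by (simp add: pi_mult_apply)
  qed
qed

text \<open>Iterate \<open>lie_pi_inv\<close>, expanding each \<open>adj g \<xi>\<close> in a frame.
  The coefficients are products of frame coordinates of \<open>adj g\<close>, hence smooth, and the
  list does not depend on \<open>y\<close> or \<open>g\<close>. As \<open>g\<close> is fixed while
  the operators act on vectors, the coefficients are constants for them and are never
  differentiated.\<close>

lemma word_pi_inv:
  obtains ts :: "(('g \<Rightarrow> real) \<times> 'e list) list"
  where "\<And>c w. (c, w) \<in> set ts \<Longrightarrow> smooth_fun A c"
    and "\<And>g y. y \<in> smooths \<Longrightarrow>
      word \<xi>s (\<pi> (inv g) y) = (\<Sum>(c, w)\<leftarrow>ts. c g *\<^sub>R \<pi> (inv g) (word w y))"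
proof -
  obtain B :: "'e set" and k where fr: "frame B k" using fin_dim_model by (rule fin_dim_frame)
  obtain bs where bs: "set bs = B" "distinct bs" using finite_distinct_list fr unfolding frame_def by blast
  have "\<exists>ts. (\<forall>(c, w)\<in>set ts. smooth_fun A c) \<and> (\<forall>g. \<forall>y\<in>smooths.
      word \<xi>s (\<pi> (inv g) y) = (\<Sum>(c, w)\<leftarrow>ts. c g *\<^sub>R \<pi> (inv g) (word w y)))"
  proof (induction \<xi>s)
    case Nil
    show ?case by (rule exI[of _ "[(\<lambda>g. 1, [])]"]) (simp add: smooth_fun_const)
  next
    case (Cons \<xi> \<xi>s)
    then obtain ts :: "(('g \<Rightarrow> real) \<times> 'e list) list" where ts': "\<forall>(c, w)\<in>set ts. smooth_fun A c"
      "\<forall>g. \<forall>y\<in>smooths. word \<xi>s (\<pi> (inv g) y) = (\<Sum>(c, w)\<leftarrow>ts. c g *\<^sub>R \<pi> (inv g) (word w y))"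
      by metis
    have ts: "\<And>c w. (c, w) \<in> set ts \<Longrightarrow> smooth_fun A c"
      "\<And>g y. y \<in> smooths \<Longrightarrow> word \<xi>s (\<pi> (inv g) y) = (\<Sum>(c, w)\<leftarrow>ts. c g *\<^sub>R \<pi> (inv g) (word w y))"
      using ts' by auto
    \<comment> \<open>The effect of one more letter \<open>\<xi>\<close> on a term: for each frame
      vector \<open>b\<close> the coefficient gains the \<open>b\<close>-coordinate of
      \<open>adj g \<xi>\<close>, and the word gains \<open>b\<close> in front.\<close>
    define ex where "ex p = map (\<lambda>b. (\<lambda>g. fst p g * k b (adj g \<xi>), b # snd p)) bs" for p ::
        "('g \<Rightarrow> real) \<times> 'e list"
    let ?ts = "concat (map ex ts)"
    have "smooth_fun A c" if "(c, w) \<in> set ?ts" for c w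
    proof -
      obtain p where p: "p \<in> set ts" "(c, w) \<in> set (ex p)" using \<open>(c, w) \<in> set ?ts\<close> by auto
      then obtain b where "(c, w) = (\<lambda>g. fst p g * k b (adj g \<xi>), b # snd p)" unfolding ex_def
          set_map by blast
      then have c'1: "c = (\<lambda>g. fst p g * k b (adj g \<xi>))" by simp
      have c'2: "smooth_fun A (fst p)" using ts(1)[of "fst p" "snd p"] p(1) by simp
      have "bounded_linear (k b)" using fr by (simp add: frame_def)
      then show ?thesis
        unfolding c'1 by (rule smooth_fun_bilinear[OF bounded_bilinear_mult c'2 smooth_fun_linear[OF
            _ smooth_adj]])
    qed
    moreover have "word (\<xi> # \<xi>s) (\<pi> (inv g) y) = (\<Sum>(c, w)\<leftarrow>?ts. c g *\<^sub>R \<pi> (inv g) (word w y))"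
      if y: "y \<in> smooths" for g y
    proof -
      have step: "lie \<xi> (c *\<^sub>R \<pi> (inv g) z) = (\<Sum>b\<leftarrow>bs. (c * k b (adj g \<xi>)) *\<^sub>R \<pi> (inv g) (lie b z))"
        if z: "z \<in> smooths" for c z
      proof -
        have "lie (adj g \<xi>) z = (\<Sum>b\<in>B. k b (adj g \<xi>) *\<^sub>R lie b z)"
          by (rule frame_apply[OF fr linear_lie[OF z]])
        also have "\<dots> = (\<Sum>b\<leftarrow>bs. k b (adj g \<xi>) *\<^sub>R lie b z)"
          unfolding bs(1)[symmetric] by (rule sum.distinct_set_conv_list[OF bs(2)])
        finally have *: "lie (adj g \<xi>) z = (\<Sum>b\<leftarrow>bs. k b (adj g \<xi>) *\<^sub>R lie b z)" .
        have **: "c *\<^sub>R \<pi> (inv g) (\<Sum>b\<leftarrow>bs. f b *\<^sub>R lie b z) = (\<Sum>b\<leftarrow>bs. (c * f b) *\<^sub>R \<pi> (inv g) (lie b z))" for f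
          by (induction bs) (simp_all add: blinfun.add_right blinfun.scaleR_right scaleR_add_right)
        show ?thesis
          using z by (simp add: lie_scaleR pi_smooths lie_pi_inv * **)
      qed
      have "word (\<xi> # \<xi>s) (\<pi> (inv g) y) = lie \<xi> (\<Sum>(c, w)\<leftarrow>ts. c g *\<^sub>R \<pi> (inv g) (word w y))"
        by (simp add: ts(2)[OF y])
      also have "\<dots> = (\<Sum>p\<leftarrow>ts. lie \<xi> (case p of (c, w) \<Rightarrow> c g *\<^sub>R \<pi> (inv g) (word w y)))"
        using y by (intro lie_sum_list) (auto intro: smooths_scaleR pi_smooths word_smooths)
      also have "\<dots> = (\<Sum>(c, w)\<leftarrow>?ts. c g *\<^sub>R \<pi> (inv g) (word w y))"
        using y by (induction ts) (auto simp: step word_smooths o_def ex_def)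
      finally show ?thesis .
    qed
    ultimately show ?case by (intro exI[of _ ?ts]) blast
  qed
  then show thesis using that by blast
qed

text \<open>Continuity of orbit maps for the Frechet topology. After \<open>word_pi_inv\<close> the
  group element enters only through smooth scalars and through orbits of the fixed vectors
  \<open>word w y\<close>.\<close>

lemma continuous_word_pi_inv:
  assumes y: "y \<in> smooths"
  shows "continuous_on UNIV (\<lambda>g. word \<xi>s (\<pi> (inv g) y))"
proof -
  obtain ts :: "(('g \<Rightarrow> real) \<times> 'e list) list" where ts: "\<And>c w. (c, w) \<in> set ts \<Longrightarrow> smooth_fun A c"
    "\<And>g y. y \<in> smooths \<Longrightarrow> word \<xi>s (\<pi> (inv g) y) = (\<Sum>(c, w)\<leftarrow>ts. c g *\<^sub>R \<pi> (inv g) (word w y))"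
    using word_pi_inv by metis
  have "continuous_on UNIV (\<lambda>g. \<Sum>(c, w)\<leftarrow>ts. c g *\<^sub>R \<pi> (inv g) (word w y))"
    using ts(1)
  proof (induction ts)
    case (Cons p ts)
    obtain c w where p: "p = (c, w)" by force
    have "continuous_on UNIV c" using Cons.prems smooth_fun_continuous by (auto simp: p)
    then have "continuous_on UNIV (\<lambda>g. c g *\<^sub>R \<pi> (inv g) (word w y))"
      by (intro continuous_intros continuous_pi continuous_on_inv)
    moreover have "continuous_on UNIV (\<lambda>g. \<Sum>(c, w)\<leftarrow>ts. c g *\<^sub>R \<pi> (inv g) (word w y))"
      using Cons.prems by (intro Cons.IH) auto
    ultimately show ?case by (simp add: p continuous_on_add)
  qed simp
  then show ?thesis by (simp add: ts(2)[OF y])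
qed

lemma continuous_word_pi:
  assumes "y \<in> smooths"
  shows "continuous_on UNIV (\<lambda>g. word \<xi>s (\<pi> g y))"
  using continuous_on_compose2[OF continuous_word_pi_inv[OF assms] continuous_on_inv[OF
      continuous_on_id]] by simp

lemma vfields_test: "f \<in> test_functions A \<Longrightarrow> foldr vfield \<xi>s f \<in> test_functions A"
  by (induction \<xi>s) (auto intro: vfield_test)

lemma word_smear: "f \<in> test_functions A \<Longrightarrow> word \<xi>s (smear f x) = smear (foldr vfield \<xi>s f) x"
  by (induction \<xi>s) (auto simp: lie_smear vfields_test)

lemma smooths_dense: "closure smooths = UNIV"
proof -
  have "x \<in> closure smooths" for x
    unfolding closure_approachable
  proof (intro allI impI)
    fix e :: real assume "e > 0"
    then obtain f where "f \<in> test_functions A" "norm (smear f x - x) \<le> e / 2"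
      using smear_approximates[of "e / 2" x] by auto
    then show "\<exists>y\<in>smooths. dist y x < e"
      using \<open>e > 0\<close> smear_smooth by (intro bexI[of _ "smear f x"]) (auto simp: dist_norm)
  qed
  then show ?thesis by blast
qed

lemma eq_on_dense:
  fixes F H :: "'h \<Rightarrow> complex"
  assumes "closure D = UNIV" "continuous_on UNIV F" "continuous_on UNIV H" "\<And>v. v \<in> D \<Longrightarrow> F v = H v"
  shows "F x = H x"
proof -
  have "closed {x. F x = H x}" using assms(2,3) by (rule closed_Collect_eq)
  then have "closure D \<subseteq> {x. F x = H x}" using assms(4) by (intro closure_minimal) auto
  then show ?thesis using assms(1) by auto
qed

text \<open>A coefficient of a distribution vector is available only for smooth \<open>v\<close>; by
  density such pairings still determine a vector.\<close>

lemma cinner_eq_smooths: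
  assumes "\<And>v. v \<in> smooths \<Longrightarrow> cinner x v = cinner z v"
  shows "x = z"
  using eq_on_dense[OF smooths_dense, of "cinner x" "cinner z"] assms
  by (intro cinner_eq_left) (simp add: linear_continuous_on bounded_linear_cinner_right)

text \<open>An unbounded operator passes under the integral. For smooth \<open>x\<close> it can be
  moved to the other side by \<open>word_adjoint\<close>, which leaves the definition of
  \<open>smear\<close>. Both sides are continuous in \<open>x\<close>, so density of smooth vectors
  gives the general case.\<close>

lemma cinner_word_smear:
  assumes f: "f \<in> test_functions A" and u: "u \<in> smooths"
  shows "cinner (word \<xi>s (smear f u)) x = (\<integral>g. f g * cinner (word \<xi>s (\<pi> g u)) x \<partial>\<mu>)"
proof (rule eq_on_dense[OF smooths_dense])
  show "continuous_on UNIV (cinner (word \<xi>s (smear f u)))"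
    by (rule linear_continuous_on[OF bounded_linear_cinner_right])
  have cont: "continuous_on UNIV (\<lambda>g. cinner (word \<xi>s (\<pi> g u)) x)" for x
    by (rule bounded_linear.continuous_on[OF bounded_linear_cinner_left continuous_word_pi[OF u]])
  have int: "integrable \<mu> (\<lambda>g. f g * cinner (word \<xi>s (\<pi> g u)) x)" for x
    by (intro cc_integrable cc_times test_function_cc f cont)
  have "cc (\<lambda>g. f g * complex_of_real (norm (word \<xi>s (\<pi> g u))))"
    by (intro cc_times test_function_cc f continuous_on_of_real continuous_on_norm continuous_word_pi u)
  then have int': "integrable \<mu> (\<lambda>g. cmod (f g) * norm (word \<xi>s (\<pi> g u)))"
    using integrable_norm[OF cc_integrable] by (force simp: norm_mult)
  have "bounded_linear (\<lambda>x. \<integral>g. f g * cinner (word \<xi>s (\<pi> g u)) x \<partial>\<mu>)"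
  proof (rule bounded_linear_intro)
    fix x y r
    show "(\<integral>g. f g * cinner (word \<xi>s (\<pi> g u)) (x + y) \<partial>\<mu>) =
      (\<integral>g. f g * cinner (word \<xi>s (\<pi> g u)) x \<partial>\<mu>) + (\<integral>g. f g * cinner (word \<xi>s (\<pi> g u)) y \<partial>\<mu>)"
      using int by (simp add: cinner_add_right distrib_left)
    show "(\<integral>g. f g * cinner (word \<xi>s (\<pi> g u)) (r *\<^sub>R x) \<partial>\<mu>) = r *\<^sub>R (\<integral>g. f g * cinner (word \<xi>s (\<pi> g u)) x \<partial>\<mu>)"
      using int by (simp add: cinner_scaleR_right mult.left_commute[of "f _"] scaleR_conv_of_real)
    have "cmod (\<integral>g. f g * cinner (word \<xi>s (\<pi> g u)) x \<partial>\<mu>) \<le> (\<integral>g. norm x * (cmod (f g) * norm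
        (word \<xi>s (\<pi> g u))) \<partial>\<mu>)"
    proof (rule norm_integral_le[OF int])
      show "norm (f g * cinner (word \<xi>s (\<pi> g u)) x) \<le> norm x * (cmod (f g) * norm (word \<xi>s (\<pi> g u)))" for g
        using mult_left_mono[OF norm_cinner[of "word \<xi>s (\<pi> g u)" x] norm_ge_zero[of "f g"]]
        by (simp add: norm_mult mult_ac)
    qed (use int' in simp)
    then show "norm (\<integral>g. f g * cinner (word \<xi>s (\<pi> g u)) x \<partial>\<mu>) \<le> norm x * (\<integral>g. cmod (f g) * norm
        (word \<xi>s (\<pi> g u)) \<partial>\<mu>)"
      by simp
  qed
  then show "continuous_on UNIV (\<lambda>x. \<integral>g. f g * cinner (word \<xi>s (\<pi> g u)) x \<partial>\<mu>)"
    by (rule linear_continuous_on)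
next
  fix z assume z: "z \<in> smooths"
  show "cinner (word \<xi>s (smear f u)) z = (\<integral>g. f g * cinner (word \<xi>s (\<pi> g u)) z \<partial>\<mu>)"
    using word_adjoint[OF smear_smooth[OF f] z] word_adjoint[OF pi_smooths[OF u] z]
    by (simp add: cinner_smear[OF test_function_cc[OF f]] mult.left_commute[of "f _"])
qed

end

section \<open>Differential operators on test functions\<close>

text \<open>Leibniz rule: differentiating a term either prolongs the derivative of \<open>F\<close>
  or differentiates the coefficient. It matters that one list \<open>ts'\<close> serves all
  \<open>F\<close>, since the bounds drawn from it must be uniform in the test function.\<close>

lemma iterated_deriv_differential_operator:
  fixes ts :: "(('x::real_normed_vector \<Rightarrow> real) \<times> 'x list) list"
  assumes S: "open S" and ts: "\<forall>(\<beta>, \<tau>)\<in>set ts. smooth_on S \<beta>"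
  shows "\<exists>ts'. (\<forall>(\<beta>, \<tau>)\<in>set ts'. smooth_on S \<beta>) \<and>
     (\<forall>F :: 'x \<Rightarrow> 'b::real_normed_vector. smooth_on S F \<longrightarrow> (\<forall>x\<in>S.
        iterated_deriv \<xi>s (\<lambda>x. \<Sum>(\<beta>, \<tau>)\<leftarrow>ts. \<beta> x *\<^sub>R iterated_deriv \<tau> F x) x =
        (\<Sum>(\<beta>, \<tau>)\<leftarrow>ts'. \<beta> x *\<^sub>R iterated_deriv \<tau> F x)))"
proof (induction \<xi>s)
  case Nil
  show ?case using ts by (intro exI[of _ ts]) auto
next
  case (Cons \<xi> \<xi>s)
  then obtain ts' where ts': "\<forall>(\<beta>, \<tau>)\<in>set ts'. smooth_on S \<beta>"
    "\<forall>F :: 'x \<Rightarrow> 'b. smooth_on S F \<longrightarrow> (\<forall>x\<in>S.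
        iterated_deriv \<xi>s (\<lambda>x. \<Sum>(\<beta>, \<tau>)\<leftarrow>ts. \<beta> x *\<^sub>R iterated_deriv \<tau> F x) x =
        (\<Sum>(\<beta>, \<tau>)\<leftarrow>ts'. \<beta> x *\<^sub>R iterated_deriv \<tau> F x))" by blast
  define D where "D = (\<lambda>(\<beta> :: 'x \<Rightarrow> real, \<tau> :: 'x list). (\<lambda>x. frechet_derivative \<beta> (at x) \<xi>, \<tau>))"
  define E where "E = (\<lambda>(\<beta> :: 'x \<Rightarrow> real, \<tau> :: 'x list). (\<beta>, \<xi> # \<tau>))"
  have der: "((\<lambda>x. \<Sum>(\<beta>, \<tau>)\<leftarrow>ts'. \<beta> x *\<^sub>R iterated_deriv \<tau> F x) has_derivative
      (\<lambda>\<xi>. \<Sum>(\<beta>, \<tau>)\<leftarrow>ts'. \<beta> x *\<^sub>R frechet_derivative (iterated_deriv \<tau> F) (at x) \<xi>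
          + frechet_derivative \<beta> (at x) \<xi> *\<^sub>R iterated_deriv \<tau> F x)) (at x)"
    if F: "smooth_on S F" and x: "x \<in> S" for F :: "'x \<Rightarrow> 'b" and x
    using ts'(1)
  proof (induction ts')
    case (Cons p ts')
    obtain \<beta> \<tau> where p: "p = (\<beta>, \<tau>)" by force
    have "smooth_on S \<beta>" using Cons.prems by (simp add: p)
    then have "((\<lambda>x. \<beta> x *\<^sub>R iterated_deriv \<tau> F x) has_derivative
       (\<lambda>\<xi>. \<beta> x *\<^sub>R frechet_derivative (iterated_deriv \<tau> F) (at x) \<xi>
          + frechet_derivative \<beta> (at x) \<xi> *\<^sub>R iterated_deriv \<tau> F x)) (at x)"
      by (intro bounded_bilinear.FDERIV[OF bounded_bilinear_scaleR] smooth_on_has_derivative[OF _ x]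
          smooth_on_iterated_deriv F)
    from has_derivative_add[OF this Cons.IH] Cons.prems show ?case by (simp add: p)
  qed simp
  have eq: "iterated_deriv (\<xi> # \<xi>s) (\<lambda>x. \<Sum>(\<beta>, \<tau>)\<leftarrow>ts. \<beta> x *\<^sub>R iterated_deriv \<tau> F x) x =
      (\<Sum>(\<beta>, \<tau>)\<leftarrow>map E ts' @ map D ts'. \<beta> x *\<^sub>R iterated_deriv \<tau> F x)"
    if F: "smooth_on S F" and x: "x \<in> S" for F :: "'x \<Rightarrow> 'b" and x
  proof -
    have "iterated_deriv (\<xi> # \<xi>s) (\<lambda>x. \<Sum>(\<beta>, \<tau>)\<leftarrow>ts. \<beta> x *\<^sub>R iterated_deriv \<tau> F x) x =
       frechet_derivative (\<lambda>x. \<Sum>(\<beta>, \<tau>)\<leftarrow>ts'. \<beta> x *\<^sub>R iterated_deriv \<tau> F x) (at x) \<xi>"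
      unfolding iterated_deriv.simps
      by (rule fun_cong[OF frechet_derivative_cong_open[OF S x]]) (use ts'(2) F in blast)
    also have "\<dots> = (\<Sum>(\<beta>, \<tau>)\<leftarrow>ts'. \<beta> x *\<^sub>R frechet_derivative (iterated_deriv \<tau> F) (at x) \<xi>
          + frechet_derivative \<beta> (at x) \<xi> *\<^sub>R iterated_deriv \<tau> F x)"
      using fun_cong[OF frechet_derivative_at[OF der[OF F x]], of \<xi>] by simp
    also have "\<dots> = (\<Sum>(\<beta>, \<tau>)\<leftarrow>map E ts' @ map D ts'. \<beta> x *\<^sub>R iterated_deriv \<tau> F x)"
      by (induction ts') (auto simp: D_def E_def algebra_simps)
    finally show ?thesis .
  qed
  have "\<forall>(\<beta>, \<tau>)\<in>set (map E ts' @ map D ts'). smooth_on S \<beta>"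
    using ts'(1) by (auto simp: D_def E_def intro: smooth_on_deriv)
  then show ?case using eq by blast
qed

context lie_group_rep
begin

section \<open>Estimates by seminorms in charts\<close>

definition chart_seminorms :: "(('g \<Rightarrow> complex) \<Rightarrow> real) set" where
  "chart_seminorms = {deriv_seminorm c L \<xi>s | c L \<xi>s. c \<in> A \<and> compact L \<and> L \<noteq> {} \<and> L \<subseteq> fst c}"

text \<open>A supremum of reals is meaningful only for a bounded set. Here boundedness comes from
  continuity on the compact image of \<open>L\<close>.\<close>

lemma deriv_seminorm_bdd:
  assumes "smooth_fun A f" "(U, \<phi>) \<in> A" "compact L" "L \<subseteq> U"
  shows "bdd_above ((\<lambda>a. cmod (iterated_deriv \<xi>s (f \<circ> inv_into U \<phi>) a)) ` \<phi> ` L)"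
proof -
  have "smooth_on (\<phi> ` U) (f \<circ> inv_into U \<phi>)" using smooth_fun_chart[OF assms(1,2)] by (simp add: o_def)
  then have "continuous_on (\<phi> ` U) (\<lambda>a. cmod (iterated_deriv \<xi>s (f \<circ> inv_into U \<phi>) a))"
    by (intro continuous_on_norm smooth_on_continuous smooth_on_iterated_deriv)
  moreover have "compact (\<phi> ` L)"
    using assms(3,4) continuous_chart[OF assms(2)] by (intro compact_continuous_image) (auto intro:
        continuous_on_subset)
  ultimately have "compact ((\<lambda>a. cmod (iterated_deriv \<xi>s (f \<circ> inv_into U \<phi>) a)) ` \<phi> ` L)"
    using compact_continuous_image[OF continuous_on_subset[OF _ image_mono[OF assms(4)]]] by blast
  then show ?thesis by (intro bounded_imp_bdd_above compact_imp_bounded)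
qed

lemma deriv_seminorm_upper:
  assumes "smooth_fun A f" "(U, \<phi>) \<in> A" "compact L" "L \<subseteq> U" "g \<in> L"
  shows "cmod (iterated_deriv \<xi>s (f \<circ> inv_into U \<phi>) (\<phi> g)) \<le> deriv_seminorm (U, \<phi>) L \<xi>s f"
  using cSUP_upper[OF _ deriv_seminorm_bdd[OF assms(1-4)], of "\<phi> g"] assms(5)
  by (simp add: deriv_seminorm_def)

lemma chart_seminorms_nonneg:
  assumes "p \<in> chart_seminorms" "f \<in> test_functions A"
  shows "0 \<le> p f"
proof -
  obtain U \<phi> L \<xi>s where p: "p = deriv_seminorm (U, \<phi>) L \<xi>s" "(U, \<phi>) \<in> A" "compact L" "L \<noteq> {}" "L \<subseteq> U"
    using assms(1) by (auto simp: chart_seminorms_def)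
  then obtain g where "g \<in> L" by blast
  from deriv_seminorm_upper[OF test_function_smooth[OF assms(2)] p(2,3,5) this, of \<xi>s]
  show ?thesis using norm_ge_zero order_trans unfolding p(1) by blast
qed

text \<open>The quantitative form of continuity on test functions. The bound concerns all test
  functions; the compact set containing the support enters later, through the function
  \<open>p\<close> that is chosen for it.\<close>

definition dominated :: "(('g \<Rightarrow> complex) \<Rightarrow> real) \<Rightarrow> bool" where
  "dominated p \<longleftrightarrow> (\<exists>F C. finite F \<and> F \<subseteq> chart_seminorms \<and> 0 \<le> C \<and>
     (\<forall>f\<in>test_functions A. p f \<le> C * (\<Sum>q\<in>F. q f)))"

lemma dominatedE:
  assumes "dominated p"
  obtains F C where "finite F" "F \<subseteq> chart_seminorms" "0 \<le> C"
    "\<And>f. f \<in> test_functions A \<Longrightarrow> p f \<le> C * (\<Sum>q\<in>F. q f)"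
  using assms unfolding dominated_def by blast

lemma dominated_mono:
  "dominated p \<Longrightarrow> (\<And>f. f \<in> test_functions A \<Longrightarrow> p' f \<le> p f) \<Longrightarrow> dominated p'"
  unfolding dominated_def by (meson order_trans)

lemma dominated_chart: "q \<in> chart_seminorms \<Longrightarrow> dominated q"
  unfolding dominated_def by (intro exI[of _ "{q}"] exI[of _ 1]) auto

lemma dominated_zero: "dominated (\<lambda>f. 0)"
  unfolding dominated_def by (intro exI[of _ "{}"] exI[of _ 0]) auto

lemma dominated_add:
  assumes "dominated p" "dominated p'"
  shows "dominated (\<lambda>f. p f + p' f)"
proof -
  obtain F C where F: "finite F" "F \<subseteq> chart_seminorms" "0 \<le> C"
    "\<And>f. f \<in> test_functions A \<Longrightarrow> p f \<le> C * (\<Sum>q\<in>F. q f)" using assms(1) by (rule dominatedE) blast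
  obtain F' C' where F': "finite F'" "F' \<subseteq> chart_seminorms" "0 \<le> C'"
    "\<And>f. f \<in> test_functions A \<Longrightarrow> p' f \<le> C' * (\<Sum>q\<in>F'. q f)" using assms(2) by (rule dominatedE) blast
  have "p f + p' f \<le> (C + C') * (\<Sum>q\<in>F \<union> F'. q f)" if f: "f \<in> test_functions A" for f
  proof -
    have nn: "0 \<le> q f" if "q \<in> F \<union> F'" for q using chart_seminorms_nonneg[OF _ f] that F(2) F'(2) by blast
    have "(\<Sum>q\<in>F. q f) \<le> (\<Sum>q\<in>F \<union> F'. q f)" "(\<Sum>q\<in>F'. q f) \<le> (\<Sum>q\<in>F \<union> F'. q f)"
      using F(1) F'(1) nn by (auto intro!: sum_mono2)
    then have "C * (\<Sum>q\<in>F. q f) \<le> C * (\<Sum>q\<in>F \<union> F'. q f)" "C' * (\<Sum>q\<in>F'. q f) \<le> C' * (\<Sum>q\<in>F \<union> F'. q f)"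
      using F(3) F'(3) by (auto intro: mult_left_mono)
    then show ?thesis using F(4)[OF f] F'(4)[OF f] by (simp add: distrib_right)
  qed
  then show ?thesis unfolding dominated_def
    using F(1-3) F'(1-3) by (intro exI[of _ "F \<union> F'"] exI[of _ "C + C'"]) auto
qed

lemma dominated_scale:
  assumes "dominated p" "0 \<le> r"
  shows "dominated (\<lambda>f. r * p f)"
proof -
  obtain F C where F: "finite F" "F \<subseteq> chart_seminorms" "0 \<le> C"
    "\<And>f. f \<in> test_functions A \<Longrightarrow> p f \<le> C * (\<Sum>q\<in>F. q f)" using assms(1) by (rule dominatedE) blast
  then have "r * p f \<le> (r * C) * (\<Sum>q\<in>F. q f)" if "f \<in> test_functions A" for f
    using that assms(2) mult_left_mono by (fastforce simp: mult.assoc)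
  then show ?thesis unfolding dominated_def
    using F(1-3) assms(2) by (intro exI[of _ F] exI[of _ "r * C"]) auto
qed

lemma dominated_sum: "(\<And>i. i \<in> I \<Longrightarrow> dominated (p i)) \<Longrightarrow> dominated (\<lambda>f. \<Sum>i\<in>I. p i f)"
  by (induction I rule: infinite_finite_induct) (auto intro: dominated_add dominated_zero)

lemma dominated_sum_list: "(\<And>i. i \<in> set xs \<Longrightarrow> dominated (p i)) \<Longrightarrow> dominated (\<lambda>f. \<Sum>i\<leftarrow>xs. p i f)"
  by (induction xs) (auto intro: dominated_add dominated_zero)

definition diff_op :: "(('g \<Rightarrow> complex) \<Rightarrow> 'g \<Rightarrow> complex) \<Rightarrow> bool" where
  "diff_op T \<longleftrightarrow> (\<forall>f\<in>test_functions A. T f \<in> test_functions A) \<and>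
     (\<forall>U \<phi>. (U, \<phi>) \<in> A \<longrightarrow> (\<exists>ts. (\<forall>(\<beta>, \<tau>)\<in>set ts. smooth_on (\<phi> ` U) \<beta>) \<and>
        (\<forall>f\<in>test_functions A. \<forall>b\<in>\<phi> ` U. T f (inv_into U \<phi> b) =
           (\<Sum>(\<beta>, \<tau>)\<leftarrow>ts. \<beta> b *\<^sub>R iterated_deriv \<tau> (f \<circ> inv_into U \<phi>) b))))"

text \<open>A derivative of \<open>T f\<close> in a chart is again a sum of smooth coefficients
  times derivatives of \<open>f\<close>. On the compact image of \<open>L\<close> the coefficients
  are bounded, so seminorms of \<open>f\<close> over the same \<open>L\<close> suffice.\<close>

lemma diff_op_dominated_chart:
  assumes T: "diff_op T" and q: "q \<in> chart_seminorms"
  shows "dominated (\<lambda>f. q (T f))"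
proof -
  obtain U \<phi> L \<xi>s where q: "q = deriv_seminorm (U, \<phi>) L \<xi>s" "(U, \<phi>) \<in> A" "compact L" "L \<noteq> {}" "L \<subseteq> U"
    using q by (auto simp: chart_seminorms_def)
  have oU: "open (\<phi> ` U)" using chart_open[OF q(2)] by blast
  obtain ts where ts: "\<forall>(\<beta>, \<tau>)\<in>set ts. smooth_on (\<phi> ` U) \<beta>"
    "\<forall>f\<in>test_functions A. \<forall>b\<in>\<phi> ` U. T f (inv_into U \<phi> b) =
       (\<Sum>(\<beta>, \<tau>)\<leftarrow>ts. \<beta> b *\<^sub>R iterated_deriv \<tau> (f \<circ> inv_into U \<phi>) b)"
    using T q(2) unfolding diff_op_def by metis
  obtain ts' where ts': "\<forall>(\<beta>, \<tau>)\<in>set ts'. smooth_on (\<phi> ` U) \<beta>"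
    "\<forall>F :: 'e \<Rightarrow> complex. smooth_on (\<phi> ` U) F \<longrightarrow> (\<forall>x\<in>\<phi> ` U.
        iterated_deriv \<xi>s (\<lambda>x. \<Sum>(\<beta>, \<tau>)\<leftarrow>ts. \<beta> x *\<^sub>R iterated_deriv \<tau> F x) x =
        (\<Sum>(\<beta>, \<tau>)\<leftarrow>ts'. \<beta> x *\<^sub>R iterated_deriv \<tau> F x))"
    using iterated_deriv_differential_operator[OF oU ts(1), of \<xi>s] by blast
  have cL: "compact (\<phi> ` L)"
    using q(3,5) continuous_chart[OF q(2)] by (intro compact_continuous_image) (auto intro:
        continuous_on_subset)
  have "\<exists>C\<ge>0. \<forall>a\<in>\<phi> ` L. \<bar>\<beta> a\<bar> \<le> C" if "(\<beta>, \<tau>) \<in> set ts'" for \<beta> \<tau>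
  proof -
    have "continuous_on (\<phi> ` L) \<beta>"
      using ts'(1) that continuous_on_subset[OF smooth_on_continuous image_mono[OF q(5)]] by blast
    then have "bounded (\<beta> ` \<phi> ` L)" using cL compact_continuous_image compact_imp_bounded by blast
    then obtain C where "\<forall>y\<in>\<beta> ` \<phi> ` L. norm y \<le> C" by (auto simp: bounded_iff)
    then show ?thesis by (intro exI[of _ "max C 0"]) (auto simp: le_max_iff_disj)
  qed
  then obtain C where C: "\<And>\<beta> \<tau>. (\<beta>, \<tau>) \<in> set ts' \<Longrightarrow> 0 \<le> C \<beta>" "\<And>\<beta> \<tau> a. (\<beta>, \<tau>) \<in> set ts' \<Longrightarrow> a \<in> \<phi> ` L \<Longrightarrow>
      \<bar>\<beta> a\<bar> \<le> C \<beta>"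
    by metis
  let ?p = "\<lambda>f. \<Sum>p\<leftarrow>ts'. C (fst p) * deriv_seminorm (U, \<phi>) L (snd p) f"
  have "dominated ?p"
  proof (rule dominated_sum_list, rule dominated_scale)
    fix p assume p: "p \<in> set ts'"
    show "dominated (deriv_seminorm (U, \<phi>) L (snd p))"
      using q by (intro dominated_chart) (auto simp: chart_seminorms_def intro!: exI)
    show "0 \<le> C (fst p)" using C(1)[of "fst p" "snd p"] p by simp
  qed
  moreover have "q (T f) \<le> ?p f" if f: "f \<in> test_functions A" for f
    unfolding q(1) deriv_seminorm_def prod.case
  proof (rule cSUP_least)
    show "\<phi> ` L \<noteq> {}" using q(4) by simp
    fix a assume a: "a \<in> \<phi> ` L"
    then obtain g where g: "g \<in> L" "a = \<phi> g" by blast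
    define H where "H = f \<circ> inv_into U \<phi>"
    have F: "smooth_on (\<phi> ` U) H" using smooth_fun_chart[OF test_function_smooth[OF f] q(2)] by
        (simp add: H_def o_def)
    have aU: "a \<in> \<phi> ` U" using a q(5) by auto
    have "iterated_deriv \<xi>s (T f \<circ> inv_into U \<phi>) a =
       iterated_deriv \<xi>s (\<lambda>x. \<Sum>(\<beta>, \<tau>)\<leftarrow>ts. \<beta> x *\<^sub>R iterated_deriv \<tau> H x) a"
      unfolding H_def using ts(2) f by (intro iterated_deriv_cong_open[OF oU _ aU]) auto
    also have "\<dots> = (\<Sum>(\<beta>, \<tau>)\<leftarrow>ts'. \<beta> a *\<^sub>R iterated_deriv \<tau> H a)" using ts'(2) F aU by blast
    also have "cmod \<dots> \<le> ?p f"
    proof -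
      have "norm (\<Sum>(\<beta>, \<tau>)\<leftarrow>zs. \<beta> a *\<^sub>R iterated_deriv \<tau> H a) \<le>
         (\<Sum>p\<leftarrow>zs. C (fst p) * deriv_seminorm (U, \<phi>) L (snd p) f)" if "set zs \<subseteq> set ts'" for zs
        using that
      proof (induction zs)
        case (Cons p zs)
        obtain \<beta> \<tau> where p: "p = (\<beta>, \<tau>)" by force
        have "norm (\<beta> a *\<^sub>R iterated_deriv \<tau> H a) \<le> C \<beta> * deriv_seminorm (U, \<phi>) L \<tau> f"
          unfolding norm_scaleR g(2)
          using Cons.prems C(1)[of \<beta> \<tau>] C(2)[of \<beta> \<tau> "\<phi> g"] g(1)
            deriv_seminorm_upper[OF test_function_smooth[OF f] q(2,3,5) g(1), of \<tau>, folded H_def]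
          by (intro mult_mono) (auto simp: p)
        then show ?case using Cons by (auto simp: p intro!: order_trans[OF norm_triangle_ineq] add_mono)
      qed simp
      then show ?thesis by blast
    qed
    finally show "cmod (iterated_deriv \<xi>s (T f \<circ> inv_into U \<phi>) a) \<le>
      (\<Sum>p\<leftarrow>ts'. C (fst p) * (SUP a\<in>\<phi> ` L. cmod (iterated_deriv (snd p) (f \<circ> inv_into U \<phi>) a)))"
      by (simp add: deriv_seminorm_def)
  qed
  ultimately show ?thesis by (rule dominated_mono)
qed

lemma diff_op_test: "diff_op T \<Longrightarrow> f \<in> test_functions A \<Longrightarrow> T f \<in> test_functions A"
  by (simp add: diff_op_def)

lemma diff_op_dominated:
  assumes T: "diff_op T" and "dominated p"
  shows "dominated (\<lambda>f. p (T f))"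
proof -
  obtain F C where F: "finite F" "F \<subseteq> chart_seminorms" "0 \<le> C"
    "\<And>f. f \<in> test_functions A \<Longrightarrow> p f \<le> C * (\<Sum>q\<in>F. q f)" using assms(2) by (rule dominatedE) blast
  have "dominated (\<lambda>f. C * (\<Sum>q\<in>F. q (T f)))"
    using F(2,3) diff_op_dominated_chart[OF T] by (intro dominated_scale dominated_sum) auto
  then show ?thesis by (rule dominated_mono) (use F(4) diff_op_test[OF T] in blast)
qed

lemma diff_op_scaleR:
  assumes c: "smooth_fun A c"
  shows "diff_op (\<lambda>f g. c g *\<^sub>R f g)"
  unfolding diff_op_def
proof (intro conjI ballI allI impI)
  fix f assume f: "f \<in> test_functions A"
  obtain K where K: "compact K" "\<And>g. g \<notin> K \<Longrightarrow> f g = 0" using test_function_support[OF f] by blast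
  show "(\<lambda>g. c g *\<^sub>R f g) \<in> test_functions A"
    by (rule test_functionsI[OF smooth_fun_bilinear[OF bounded_bilinear_scaleR c
        test_function_smooth[OF f]] K(1)])
      (simp add: K(2))
next
  fix U \<phi> assume U: "(U, \<phi>) \<in> A"
  show "\<exists>ts. (\<forall>(\<beta>, \<tau>)\<in>set ts. smooth_on (\<phi> ` U) \<beta>) \<and>
      (\<forall>f\<in>test_functions A. \<forall>b\<in>\<phi> ` U. c (inv_into U \<phi> b) *\<^sub>R f (inv_into U \<phi> b) =
         (\<Sum>(\<beta>, \<tau>)\<leftarrow>ts. \<beta> b *\<^sub>R iterated_deriv \<tau> (f \<circ> inv_into U \<phi>) b))"
    by (intro exI[of _ "[(\<lambda>b. c (inv_into U \<phi> b), [])]"]) (simp add: smooth_fun_chart[OF c U])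
qed

text \<open>In a chart, translating by a group element near the identity moves the coordinate point
  smoothly. By the chain rule \<open>vfield \<xi>\<close> differentiates the coordinate expression
  of \<open>f\<close> in a smoothly varying direction \<open>\<beta>\<close>; expanding
  \<open>\<beta>\<close> along a frame gives a first-order operator with smooth
  coefficients.\<close>

lemma diff_op_vfield: "diff_op (vfield \<xi>)"
  unfolding diff_op_def
proof (intro conjI ballI allI impI)
  show "f \<in> test_functions A \<Longrightarrow> vfield \<xi> f \<in> test_functions A" for f by (rule vfield_test)
  obtain B :: "'e set" and k where fr: "frame B k" using fin_dim_model by (rule fin_dim_frame)
  then obtain bs where bs: "set bs = B" "distinct bs" using finite_distinct_list unfolding frame_def
      by blast
  fix U \<phi> assume U: "(U, \<phi>) \<in> A"
  let ?E = "id_map ` id_dom" and ?m = "\<lambda>p. inv (id_inv (snd p)) \<otimes> inv_into U \<phi> (fst p)"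
  have oU: "open (\<phi> ` U)" "open U" using chart_open[OF U] by auto
  then have o: "open (\<phi> ` U \<times> ?E)" using open_id_chart by (intro open_Times)
  have "gsmooth (\<phi> ` U \<times> ?E) (\<lambda>p. inv_into U \<phi> (fst p))"
    by (intro gsmooth_compose[OF fin_dim_model gsmooth_chart[OF U] o smooth_on_fst[OF o]]) auto
  moreover have "gsmooth (\<phi> ` U \<times> ?E) (\<lambda>p. id_inv (snd p))"
    by (intro gsmooth_compose[OF fin_dim_model gsmooth_id_inv o smooth_on_snd[OF o]]) auto
  ultimately have gs: "gsmooth (\<phi> ` U \<times> ?E) ?m" by (intro gsmooth_mult gsmooth_inv)
  let ?O = "(\<phi> ` U \<times> ?E) \<inter> ?m -` U"
  have oO: "open ?O" using gsmooth_open_preimage[OF gs oU(2)] .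
  have M: "smooth_on ?O (\<lambda>p. \<phi> (?m p))" by (rule gsmooth_smooth[OF gs U])
  \<comment> \<open>The coordinate expression of the vector field: the velocity of the chart point
    \<open>b\<close> under translation.\<close>
  define \<beta> where "\<beta> b = frechet_derivative (\<lambda>a. \<phi> (?m (b, a))) (at id_pt) \<xi>" for b
  have pt: "(b, id_pt) \<in> ?O" if "b \<in> \<phi> ` U" for b using that id_pt_mem chart_inv_mem[OF that] by simp
  have "smooth_on (\<phi> ` U) (\<lambda>b. (b, id_pt))" using oU by (intro smooth_on_Pair smooth_on_const
      smooth_on_ident)
  then have \<beta>: "smooth_on (\<phi> ` U) \<beta>"
    using smooth_on_compose[OF fin_dim_prod[OF fin_dim_model fin_dim_model] oU(1) oO _ _
        smooth_on_partial(2)[OF oO M, of \<xi>],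
        of "\<lambda>b. (b, id_pt)"] pt id_pt_mem unfolding \<beta>_def by (simp add: image_subset_iff)
  have "vfield \<xi> f (inv_into U \<phi> b) = (\<Sum>(\<beta>, \<tau>)\<leftarrow>map (\<lambda>j. (\<lambda>b. k j (\<beta> b), [j])) bs.
       \<beta> b *\<^sub>R iterated_deriv \<tau> (f \<circ> inv_into U \<phi>) b)" if f: "f \<in> test_functions A" and b: "b \<in> \<phi> `
           U" for f b
  proof -
    let ?F = "f \<circ> inv_into U \<phi>"
    have F: "(?F has_derivative frechet_derivative ?F (at b)) (at b)"
      using smooth_on_has_derivative[OF smooth_fun_chart[OF test_function_smooth[OF f] U] b] by
          (simp add: o_def)
    have "(\<lambda>a. \<phi> (?m (b, a))) differentiable (at id_pt)"
      using frechet_derivative_partial(2)[OF smooth_on_differentiable[OF M pt[OF b]]]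
      by (rule differentiableI)
    then have "((\<lambda>a. \<phi> (?m (b, a))) has_derivative frechet_derivative (\<lambda>a. \<phi> (?m (b, a)))
        (at id_pt)) (at id_pt)"
      by (rule frechet_derivative_works[THEN iffD1])
    moreover have bb: "\<phi> (?m (b, id_pt)) = b" using b by (simp add: f_inv_into_f)
    ultimately have d: "((\<lambda>a. ?F (\<phi> (?m (b, a)))) has_derivative
        (\<lambda>\<xi>. frechet_derivative ?F (at b) (frechet_derivative (\<lambda>a. \<phi> (?m (b, a))) (at id_pt) \<xi>)))
            (at id_pt)"
      using diff_chain_at[of "\<lambda>a. \<phi> (?m (b, a))" _ id_pt ?F "frechet_derivative ?F (at b)"] F by
          (simp only: o_def)
    have oT: "open (?E \<inter> (\<lambda>a. ?m (b, a)) -` U)"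
    proof -
      have "gsmooth ?E (\<lambda>a. ?m (b, a))"
        unfolding fst_conv snd_conv by (intro gsmooth_mult gsmooth_inv gsmooth_id_inv gsmooth_const
            open_id_chart)
      then show ?thesis using oU(2) by (rule gsmooth_open_preimage)
    qed
    have ptT: "id_pt \<in> ?E \<inter> (\<lambda>a. ?m (b, a)) -` U" using pt[OF b] by simp
    have "((\<lambda>a. f (inv (id_inv a) \<otimes> inv_into U \<phi> b)) has_derivative
        (\<lambda>\<xi>. frechet_derivative ?F (at b) (frechet_derivative (\<lambda>a. \<phi> (?m (b, a))) (at id_pt) \<xi>)))
            (at id_pt)"
      by (rule has_derivative_transform_within_open[OF d oT ptT]) (use U in auto)
    from fun_cong[OF frechet_derivative_at[OF this], of \<xi>]
    have "vfield \<xi> f (inv_into U \<phi> b) = frechet_derivative ?F (at b) (\<beta> b)"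
      unfolding vfield_def family_deriv_def \<beta>_def by simp
    also have "\<dots> = (\<Sum>j\<in>B. k j (\<beta> b) *\<^sub>R frechet_derivative ?F (at b) j)"
      by (rule frame_apply[OF fr has_derivative_linear[OF F]])
    also have "\<dots> = (\<Sum>j\<leftarrow>bs. k j (\<beta> b) *\<^sub>R frechet_derivative ?F (at b) j)"
      unfolding bs(1)[symmetric] by (rule sum.distinct_set_conv_list[OF bs(2)])
    finally show ?thesis by (simp add: o_def)
  qed
  moreover have "smooth_on (\<phi> ` U) (\<lambda>b. k j (\<beta> b))" for j
    using fr by (intro smooth_on_linear_compose[OF _ oU(1) \<beta>]) (simp add: frame_def)
  ultimately show "\<exists>ts. (\<forall>(\<beta>, \<tau>)\<in>set ts. smooth_on (\<phi> ` U) \<beta>) \<and>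
      (\<forall>f\<in>test_functions A. \<forall>b\<in>\<phi> ` U. vfield \<xi> f (inv_into U \<phi> b) =
         (\<Sum>(\<beta>, \<tau>)\<leftarrow>ts. \<beta> b *\<^sub>R iterated_deriv \<tau> (f \<circ> inv_into U \<phi>) b))"
    by (intro exI[of _ "map (\<lambda>j. (\<lambda>b. k j (\<beta> b), [j])) bs"]) auto
qed

lemma dominated_vfields: "dominated p \<Longrightarrow> dominated (\<lambda>f. p (foldr vfield \<xi>s f))"
  by (induction \<xi>s arbitrary: p) (auto dest: diff_op_dominated[OF diff_op_vfield])

text \<open>Cover \<open>K\<close> by finitely many open sets, each inside a compact subset of a
  chart, and add the corresponding seminorms of order 0.\<close>

lemma sup_dominated:
  assumes "compact K"
  obtains p where "dominated p" "\<And>f g. f \<in> test_functions A \<Longrightarrow> g \<in> K \<Longrightarrow> cmod (f g) \<le> p f"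
proof -
  have "\<exists>T q. open T \<and> x \<in> T \<and> q \<in> chart_seminorms \<and> (\<forall>f\<in>test_functions A. \<forall>g\<in>T. cmod (f g) \<le> q f)" for x
  proof -
    obtain U \<phi> where U: "(U, \<phi>) \<in> A" "x \<in> U" by (rule chart_at)
    obtain T L where TL: "open T" "x \<in> T" "T \<subseteq> L" "compact L" "L \<subseteq> UNIV \<inter> U"
      using chart_compact_nbhd[OF open_UNIV UNIV_I U] by metis
    have "deriv_seminorm (U, \<phi>) L [] \<in> chart_seminorms"
      unfolding chart_seminorms_def using TL U by (intro CollectI exI conjI) auto
    moreover have "cmod (f g) \<le> deriv_seminorm (U, \<phi>) L [] f" if "f \<in> test_functions A" "g \<in> T" for f g
    proof -
      have "g \<in> L" "g \<in> U" using that(2) TL by auto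
      then show ?thesis
        using deriv_seminorm_upper[OF test_function_smooth[OF that(1)] U(1) TL(4), of g "[]"] TL(5)
            U(1) by simp
    qed
    ultimately show ?thesis using TL by blast
  qed
  then obtain T q where Tq: "\<And>x. open (T x)" "\<And>x. x \<in> T x" "\<And>x. q x \<in> chart_seminorms"
    "\<And>x f g. f \<in> test_functions A \<Longrightarrow> g \<in> T x \<Longrightarrow> cmod (f g) \<le> q x f" by metis
  obtain X where X: "X \<subseteq> K" "finite X" "K \<subseteq> (\<Union>x\<in>X. T x)"
    using compactE_image[OF assms, of K T] Tq(1,2) by blast
  show thesis
  proof (rule that)
    show "dominated (\<lambda>f. \<Sum>x\<in>X. q x f)" using Tq(3) by (intro dominated_sum dominated_chart)
    fix f g assume f: "f \<in> test_functions A" and "g \<in> K"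
    then obtain x where x: "x \<in> X" "g \<in> T x" using X(3) by blast
    have "cmod (f g) \<le> q x f" using Tq(4)[OF f x(2)] .
    also have "\<dots> \<le> (\<Sum>x\<in>X. q x f)"
      using x(1) X(2) chart_seminorms_nonneg[OF Tq(3) f] by (intro member_le_sum) auto
    finally show "cmod (f g) \<le> (\<Sum>x\<in>X. q x f)" .
  qed
qed

lemma vfields_support:
  assumes "closed K" "\<And>g. g \<notin> K \<Longrightarrow> f g = 0" "g \<notin> K"
  shows "foldr vfield \<xi>s f g = 0"
  using assms(3) by (induction \<xi>s arbitrary: g) (auto intro: vfield_support[OF assms(1)] assms(2))

text \<open>The word turns into vector fields on the test function, which do not enlarge its
  support. The norm is thus at most a supremum over \<open>K\<close> times
  \<open>measure \<mu> K * norm x\<close>, and the supremum is dominated. The function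
  \<open>p\<close> is chosen before \<open>f\<close>.\<close>

lemma word_smear_dominated:
  assumes K: "compact K" and c: "smooth_fun A c"
  obtains p where "dominated p"
    "\<And>f. f \<in> test_functions A \<Longrightarrow> (\<And>g. g \<notin> K \<Longrightarrow> f g = 0) \<Longrightarrow>
       norm (word \<xi>s (smear (\<lambda>g. c g *\<^sub>R f g) x)) \<le> p f"
proof -
  obtain p where p: "dominated p" "\<And>f g. f \<in> test_functions A \<Longrightarrow> g \<in> K \<Longrightarrow> cmod (f g) \<le> p f"
    using sup_dominated[OF K] by metis
  let ?p = "\<lambda>f. (measure \<mu> K * norm x) * p (foldr vfield \<xi>s (\<lambda>g. c g *\<^sub>R f g))"
  show thesis
  proof (rule that)
    show "dominated ?p"
      by (intro dominated_scale diff_op_dominated[OF diff_op_scaleR[OF c], of "\<lambda>f. p (foldr vfield \<xi>s f)"]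
          dominated_vfields p(1)) simp
    fix f assume f: "f \<in> test_functions A" "\<And>g. g \<notin> K \<Longrightarrow> f g = 0"
    let ?cf = "\<lambda>g. c g *\<^sub>R f g"
    have cf: "?cf \<in> test_functions A" using diff_op_test[OF diff_op_scaleR[OF c] f(1)] .
    have v: "foldr vfield \<xi>s ?cf \<in> test_functions A" by (rule vfields_test[OF cf])
    have "norm (smear (foldr vfield \<xi>s ?cf) x) \<le> p (foldr vfield \<xi>s ?cf) * measure \<mu> K * norm x"
    proof (rule norm_smear_le[OF test_function_cc[OF v] K])
      show "foldr vfield \<xi>s ?cf g = 0" if "g \<notin> K" for g
        by (rule vfields_support[OF compact_imp_closed[OF K] _ that]) (simp add: f(2))
    qed (use p(2)[OF v] in simp)
    then show "norm (word \<xi>s (smear ?cf x)) \<le> ?p f" by (simp add: word_smear[OF cf] mult_ac)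
  qed
qed

end

section \<open>Smearing distribution vectors\<close>

lemma tendsto_fun_pointwise:
  fixes f :: "'i \<Rightarrow> 'a \<Rightarrow> 'b::topological_space"
  assumes "\<And>x. ((\<lambda>i. f i x) \<longlongrightarrow> l x) F"
  shows "(f \<longlongrightarrow> l) F"
proof -
  have "limitin (product_topology (\<lambda>i::'a. euclidean) UNIV) f l F"
    using assms by (simp add: limitin_componentwise)
  then show ?thesis by (simp add: euclidean_product_topology)
qed

lemma norm_dual_of_eq: "norm (dual_of y) = norm y"
proof (rule antisym[OF norm_dual_of])
  have "norm y * norm y = Re (cinner y y)" by (simp add: Re_cinner dot_square_norm power2_eq_square)
  also have "\<dots> \<le> norm (dual_of y) * norm y"
    using norm_blinfun[of "dual_of y" y] complex_Re_le_cmod[of "cinner y y"] by simp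
  finally show "norm y \<le> norm (dual_of y)" by (cases "norm y = 0") auto
qed

lemma iterated_deriv_const_zero: "iterated_deriv \<xi>s (\<lambda>_. 0) = (\<lambda>_. 0)"
  by (induction \<xi>s) (auto simp: frechet_derivative_const)

context lie_group_rep
begin

section \<open>Transport of the contragredient representation to H\<close>

abbreviation pi_uea :: "'e uea \<Rightarrow> 'h \<Rightarrow> 'h" where "pi_uea \<equiv> uea_rep G A (\<lambda>g. blinfun_apply (\<pi> g))"
abbreviation dual_uea :: "'e uea \<Rightarrow> ('h \<Rightarrow>\<^sub>L complex) \<Rightarrow> ('h \<Rightarrow>\<^sub>L complex)"
  where "dual_uea \<equiv> uea_rep G A (contragredient G \<pi>)"

lemma contragredient_dual_of: "contragredient G \<pi> g (dual_of y) = dual_of (\<pi> g y)"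
  by (rule blinfun_eqI) (simp add: contragredient_def pi_cinner_inv)

lemma dual_smooth_eq: "dual_smooth G A \<pi> = dual_of ` smooths"
proof -
  have "smooth_fun A (\<lambda>g. dual_of (\<pi> g y)) \<longleftrightarrow> y \<in> smooths" for y
  proof
    obtain S :: "('h \<Rightarrow>\<^sub>L complex) \<Rightarrow> 'h" where S: "bounded_linear S" "\<And>y. S (dual_of y) = y"
      by (rule dual_of_left_inverse) blast
    assume "smooth_fun A (\<lambda>g. dual_of (\<pi> g y))"
    from smooth_fun_linear[OF S(1) this] show "y \<in> smooths" by (simp add: S(2) smooths_iff)
  qed (auto simp: smooths_iff intro: smooth_fun_linear[OF bounded_linear_dual_of])
  then show ?thesis
    by (auto simp: dual_smooth_def smooth_vectors_def hilbert_dual_eq contragredient_dual_of)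
qed

lemma lie_dual_of:
  assumes "y \<in> smooths"
  shows "lie_rep G A (contragredient G \<pi>) \<xi> (dual_of y) = dual_of (lie \<xi> y)"
  unfolding lie_rep_eq[of "contragredient G \<pi>"] contragredient_dual_of
  using fun_cong[OF frechet_derivative_at[OF bounded_linear.has_derivative[OF bounded_linear_dual_of
        orbit_has_derivative[OF assms]]]] by simp

lemma word_dual_of:
  "y \<in> smooths \<Longrightarrow> foldr (lie_rep G A (contragredient G \<pi>)) \<xi>s (dual_of y) = dual_of (word \<xi>s y)"
  by (induction \<xi>s) (auto simp: lie_dual_of word_smooths)

lemma uea_dual_of: "y \<in> smooths \<Longrightarrow> dual_uea D (dual_of y) = dual_of (pi_uea D y)"
proof (induction D)
  case Nil
  show ?case by (simp add: uea_rep_def linear_0[OF bounded_linear.linear[OF bounded_linear_dual_of]])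
next
  case (Cons p D)
  obtain c w where "p = (c, w)" by force
  then show ?case using Cons
    by (simp add: uea_rep_def word_dual_of bounded_linear.linear[OF bounded_linear_dual_of]
        linear_add linear_scale)
qed

lemma word_scaleR: "v \<in> smooths \<Longrightarrow> word \<xi>s (r *\<^sub>R v) = r *\<^sub>R word \<xi>s v"
  by (simp add: scaleR_scaleC word_scaleC)

lemma clinear_on_uea: "clinear_on smooths (pi_uea D)"
proof (induction D)
  case Nil
  show ?case by (simp add: clinear_on_def uea_rep_def)
next
  case (Cons p D)
  obtain c w where p: "p = (c, w)" by force
  have "pi_uea (p # D) v = c *\<^sub>R word w v + pi_uea D v" for v by (simp add: uea_rep_def p)
  then show ?case using Cons
    by (simp add: clinear_on_def word_add word_scaleC scaleR_scaleC scaleC_add_right scaleC_scaleC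
        algebra_simps)
qed

lemma cinner_uea:
  "cinner (pi_uea D v) y = (\<Sum>(w, y)\<leftarrow>map (\<lambda>(c, w). (w, c *\<^sub>R y)) D. cinner (word w v) y)"
  by (induction D) (auto simp: uea_rep_def cinner_add_left cinner_scaleR_left cinner_scaleR_right)

text \<open>\<open>functional_representation\<close> gives one vector for each formal sum
  \<open>D\<close>. Splitting \<open>D\<close> into words and moving the real coefficients into the
  vectors leaves a plain list of words and vectors, so that later arguments are inductions on that
  list.\<close>

lemma word_representation:
  assumes "clinear_on smooths \<eta>" "finite I"
    and "\<And>v. v \<in> smooths \<Longrightarrow> cmod (\<eta> v) \<le> C * (\<Sum>D\<in>I. norm (pi_uea D v))"
  obtains zs where "\<And>v. v \<in> smooths \<Longrightarrow> \<eta> v = (\<Sum>(w, y)\<leftarrow>zs. cinner (word w v) y)"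
proof -
  obtain y where y: "\<And>v. v \<in> smooths \<Longrightarrow> \<eta> v = (\<Sum>D\<in>I. cinner (pi_uea D v) (y D))"
    using functional_representation[OF assms(2) csubspace_smooths clinear_on_uea assms(1,3)] by metis
  obtain Ds where Ds: "set Ds = I" "distinct Ds" using finite_distinct_list assms(2) by blast
  let ?zs = "concat (map (\<lambda>D. map (\<lambda>(c, w). (w, c *\<^sub>R y D)) D) Ds)"
  have "\<eta> v = (\<Sum>(w, y)\<leftarrow>?zs. cinner (word w v) y)" if "v \<in> smooths" for v
  proof -
    have "\<eta> v = (\<Sum>D\<leftarrow>Ds. cinner (pi_uea D v) (y D))"
      unfolding y[OF that] Ds(1)[symmetric] by (rule sum.distinct_set_conv_list[OF Ds(2)])
    also have "\<dots> = (\<Sum>(w, y)\<leftarrow>?zs. cinner (word w v) y)"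
      by (induction Ds) (simp_all add: cinner_uea)
    finally show ?thesis .
  qed
  then show thesis using that by blast
qed

section \<open>Distribution vectors as sums of derivatives\<close>

abbreviation "dual_dist \<equiv> dual_distribution_vectors G A \<pi>"

lemma dual_dist_eq:
  "dual_dist = top_dual (seminorm_topology smooths (range (\<lambda>D v. norm (pi_uea D v))))"
  by (simp add: dual_distribution_vectors_def smooth_vector_topology_def pi_smooth_def)

lemma dual_dist_clinear: "\<eta> \<in> dual_dist \<Longrightarrow> clinear_on smooths \<eta>"
  and dual_dist_zero: "\<eta> \<in> dual_dist \<Longrightarrow> v \<notin> smooths \<Longrightarrow> \<eta> v = 0"
  by (auto simp: dual_dist_eq top_dual_def)

lemma seminorm_uea: "seminorm_on smooths (\<lambda>v. norm (pi_uea D v))"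
  using clinear_on_uea[of D] by (auto simp: seminorm_on_def clinear_on_def norm_triangle_ineq norm_scaleC)

lemma dual_dist_representation:
  assumes "\<eta> \<in> dual_dist"
  obtains zs where "\<And>v. v \<in> smooths \<Longrightarrow> \<eta> v = (\<Sum>(w, y)\<leftarrow>zs. cinner (word w v) y)"
proof -
  have P: "seminorm_on smooths p" if "p \<in> range (\<lambda>D v. norm (pi_uea D v))" for p
    using that seminorm_uea by auto
  obtain F C where F: "finite F" "F \<subseteq> range (\<lambda>D v. norm (pi_uea D v))"
    "\<And>v. v \<in> smooths \<Longrightarrow> cmod (\<eta> v) \<le> C * (\<Sum>p\<in>F. p v)"
    by (rule continuous_functional_bound[OF csubspace_smooths P assms[unfolded dual_dist_eq]]) auto
  \<comment> \<open>Distinct formal sums can give the same seminorm. Choosing one for each seminorm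
    makes the sum over \<open>F\<close> a sum over \<open>I\<close>.\<close>
  obtain I where I: "finite I" "F = (\<lambda>D v. norm (pi_uea D v)) ` I" "inj_on (\<lambda>D v. norm (pi_uea D v)) I"
    using F(1,2) by (auto simp: subset_image_inj dest: finite_imageD)
  show thesis
    by (rule word_representation[OF dual_dist_clinear[OF assms] I(1), of C])
      (use F(3) that in \<open>auto simp: I(2) sum.reindex[OF I(3)]\<close>)
qed

lemma dist_representation:
  assumes "\<zeta> \<in> distribution_vectors G A \<pi>"
  obtains zs where "\<And>v. v \<in> smooths \<Longrightarrow> \<zeta> (dual_of v) = (\<Sum>(w, y)\<leftarrow>zs. cinner y (word w v))"
proof -
  let ?P = "range (\<lambda>D v. norm (dual_uea D v))"
  have \<zeta>: "\<zeta> \<in> top_dual (seminorm_topology (dual_of ` smooths) ?P)"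
    using assms by (simp add: distribution_vectors_def smooth_vector_topology_def
        dual_smooth_eq[symmetric] dual_smooth_def)
  have add: "dual_of x + dual_of y = dual_of (x + y)" for x y :: 'h
    by (simp add: linear_add[OF bounded_linear.linear[OF bounded_linear_dual_of]])
  have scale: "scaleC c (dual_of x) = dual_of (scaleC (cnj c) x)" for c and x :: 'h
    by (simp add: dual_of_scaleC)
  have V: "csubspace (dual_of ` smooths)"
    unfolding csubspace_def
    using smooths_0 linear_0[OF bounded_linear.linear[OF bounded_linear_dual_of]]
    by (auto simp: add scale intro: smooths_add smooths_scaleC image_eqI[of _ _ 0])
  have P: "seminorm_on (dual_of ` smooths) p" if p: "p \<in> ?P" for p
  proof -
    obtain D where D: "p = (\<lambda>v. norm (dual_uea D v))" using p by blast
    have "p (dual_of x) = norm (pi_uea D x)" if "x \<in> smooths" for x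
      by (simp add: D uea_dual_of[OF that] norm_dual_of_eq)
    then show ?thesis using seminorm_uea[of D]
      by (auto simp: seminorm_on_def add scale smooths_add smooths_scaleC)
  qed
  obtain F C where F: "finite F" "F \<subseteq> ?P"
    "\<And>v. v \<in> dual_of ` smooths \<Longrightarrow> cmod (\<zeta> v) \<le> C * (\<Sum>p\<in>F. p v)"
    by (rule continuous_functional_bound[OF V P \<zeta>]) auto
  obtain I where I: "finite I" "F = (\<lambda>D v. norm (dual_uea D v)) ` I" "inj_on (\<lambda>D v. norm (dual_uea D v)) I"
    using F(1,2) by (auto simp: subset_image_inj dest: finite_imageD)
  \<comment> \<open>Composed with the conjugate-linear \<open>dual_of\<close>,
    \<open>\<zeta>\<close> is conjugate-linear on H. Conjugating makes it linear for the
    representation, and undoing this swaps the arguments of the inner product.\<close>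
  let ?\<eta> = "\<lambda>v. cnj (\<zeta> (dual_of v))"
  have lin: "clinear_on smooths ?\<eta>"
    using \<zeta> by (auto simp: top_dual_def clinear_on_def add[symmetric] dual_of_scaleC scaleC_complex_def)
  have bound: "cmod (?\<eta> v) \<le> C * (\<Sum>D\<in>I. norm (pi_uea D v))" if "v \<in> smooths" for v
    using F(3)[of "dual_of v"] that by (simp add: I(2) sum.reindex[OF I(3)] uea_dual_of norm_dual_of_eq)
  obtain zs where zs: "\<And>v. v \<in> smooths \<Longrightarrow> ?\<eta> v = (\<Sum>(w, y)\<leftarrow>zs. cinner (word w v) y)"
    by (rule word_representation[OF lin I(1) bound]) blast+
  have "\<zeta> (dual_of v) = (\<Sum>(w, y)\<leftarrow>zs. cinner y (word w v))" if "v \<in> smooths" for v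
  proof -
    have "\<zeta> (dual_of v) = cnj (\<Sum>(w, y)\<leftarrow>zs. cinner (word w v) y)" using zs[OF that] by
        (metis complex_cnj_cnj)
    also have "\<dots> = (\<Sum>(w, y)\<leftarrow>zs. cinner y (word w v))"
      by (induction zs) (auto simp: cinner_commute[of "word _ v"])
    finally show ?thesis .
  qed
  then show thesis using that by blast
qed

lemma dist_zero: "\<zeta> \<in> distribution_vectors G A \<pi> \<Longrightarrow> u \<notin> dual_of ` smooths \<Longrightarrow> \<zeta> u = 0"
  by (simp add: distribution_vectors_def smooth_vector_topology_def dual_smooth_eq[symmetric]
      dual_smooth_def
      top_dual_def)

text \<open>The function \<open>g \<mapsto> \<zeta> (contragredient G \<pi> (inv g) v)\<close> for
  \<open>v = dual_of y\<close>, rewritten by \<open>contragredient_dual_of\<close>.\<close>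

abbreviation coeff :: "(('h \<Rightarrow>\<^sub>L complex) \<Rightarrow> complex) \<Rightarrow> 'h \<Rightarrow> 'g \<Rightarrow> complex" where
  "coeff \<zeta> y g \<equiv> \<zeta> (dual_of (\<pi> (inv g) y))"

text \<open>Apply \<open>word_pi_inv\<close> in the representation of \<open>\<zeta>\<close>, then
  move \<open>\<pi> (inv g)\<close> across the inner product by unitarity. Afterwards the unbounded
  operators act on \<open>y\<close> alone, and \<open>g\<close> occurs only in smooth scalars and in
  orbits of fixed vectors of H.\<close>

lemma coeff_representation:
  assumes "\<zeta> \<in> distribution_vectors G A \<pi>"
  obtains qs :: "(('g \<Rightarrow> real) \<times> 'e list \<times> 'h) list"
  where "\<And>q. q \<in> set qs \<Longrightarrow> smooth_fun A (fst q)"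
    and "\<And>y g. y \<in> smooths \<Longrightarrow>
      coeff \<zeta> y g = (\<Sum>(c, t, x)\<leftarrow>qs. complex_of_real (c g) * cinner (\<pi> g x) (word t y))"
proof -
  obtain zs where zs: "\<And>v. v \<in> smooths \<Longrightarrow> \<zeta> (dual_of v) = (\<Sum>(w, y)\<leftarrow>zs. cinner y (word w v))"
    by (rule dist_representation[OF assms]) blast
  have "\<exists>qs :: (('g \<Rightarrow> real) \<times> 'e list \<times> 'h) list. (\<forall>q\<in>set qs. smooth_fun A (fst q)) \<and> (\<forall>y\<in>smooths. \<forall>g.
     (\<Sum>(w, x)\<leftarrow>zs. cinner x (word w (\<pi> (inv g) y))) =
     (\<Sum>(c, t, x)\<leftarrow>qs. complex_of_real (c g) * cinner (\<pi> g x) (word t y)))"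
  proof (induction zs)
    case Nil
    show ?case by (rule exI[of _ "[]"]) simp
  next
    case (Cons z zs)
    then obtain qs :: "(('g \<Rightarrow> real) \<times> 'e list \<times> 'h) list" where qs: "\<forall>q\<in>set qs. smooth_fun A (fst q)"
      "\<forall>y\<in>smooths. \<forall>g. (\<Sum>(w, x)\<leftarrow>zs. cinner x (word w (\<pi> (inv g) y))) =
         (\<Sum>(c, t, x)\<leftarrow>qs. complex_of_real (c g) * cinner (\<pi> g x) (word t y))" by blast
    obtain w x where z: "z = (w, x)" by force
    obtain ts :: "(('g \<Rightarrow> real) \<times> 'e list) list" where ts: "\<And>c t. (c, t) \<in> set ts \<Longrightarrow> smooth_fun A c"
      "\<And>g y. y \<in> smooths \<Longrightarrow> word w (\<pi> (inv g) y) = (\<Sum>(c, t)\<leftarrow>ts. c g *\<^sub>R \<pi> (inv g) (word t y))"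
      using word_pi_inv by metis
    let ?qs = "map (\<lambda>(c, t). (c, t, x)) ts"
    have "\<forall>q\<in>set (?qs @ qs). smooth_fun A (fst q)" using ts(1) qs(1) by auto
    moreover have "cinner x (word w (\<pi> (inv g) y)) =
        (\<Sum>(c, t, x)\<leftarrow>?qs. complex_of_real (c g) * cinner (\<pi> g x) (word t y))" if "y \<in> smooths" for y g
      unfolding ts(2)[OF that]
      by (induction ts) (auto simp: cinner_add_right cinner_scaleR_right pi_cinner_inv)
    ultimately show ?case using qs(2) by (intro exI[of _ "?qs @ qs"]) (simp add: z)
  qed
  then obtain qs :: "(('g \<Rightarrow> real) \<times> 'e list \<times> 'h) list" where qs: "\<forall>q\<in>set qs. smooth_fun A (fst q)"
    "\<forall>y\<in>smooths. \<forall>g. (\<Sum>(w, x)\<leftarrow>zs. cinner x (word w (\<pi> (inv g) y))) =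
       (\<Sum>(c, t, x)\<leftarrow>qs. complex_of_real (c g) * cinner (\<pi> g x) (word t y))" by blast
  show thesis
  proof (rule that)
    show "coeff \<zeta> y g = (\<Sum>(c, t, x)\<leftarrow>qs. complex_of_real (c g) * cinner (\<pi> g x) (word t y))" if
        "y \<in> smooths" for y g
      using zs[OF pi_smooths[OF that]] qs(2) that by simp
  qed (use qs(1) in blast)
qed

text \<open>Integrating one term of \<open>coeff_representation\<close> against \<open>f\<close>
  pairs the smearing of \<open>x\<close> by \<open>c\<close> times \<open>f\<close> with
  \<open>word t y\<close>. Moving the word back by \<open>word_adjoint\<close> reverses it, adds a
  sign and gives the explicit summand \<open>T\<close>. For each word \<open>w\<close>,
  \<open>word_smear_dominated\<close> for \<open>w @ rev t\<close> estimates the seminorm.\<close>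

lemma smear_distribution_exists:
  assumes "\<zeta> \<in> distribution_vectors G A \<pi>"
  obtains W where "\<And>f. f \<in> test_functions A \<Longrightarrow> W f \<in> smooths"
    and "\<And>y. y \<in> smooths \<Longrightarrow> continuous_on UNIV (coeff \<zeta> y)"
    and "\<And>f y. f \<in> test_functions A \<Longrightarrow> y \<in> smooths \<Longrightarrow> cinner (W f) y = (\<integral>g. f g * coeff \<zeta> y g \<partial>\<mu>)"
    and "\<And>w K. compact K \<Longrightarrow> \<exists>p. dominated p \<and>
      (\<forall>f\<in>test_functions A. (\<forall>g. g \<notin> K \<longrightarrow> f g = 0) \<longrightarrow> norm (word w (W f)) \<le> p f)"
proof -
  obtain qs :: "(('g \<Rightarrow> real) \<times> 'e list \<times> 'h) list" where qs: "\<And>q. q \<in> set qs \<Longrightarrow> smooth_fun A (fst q)"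
    "\<And>y g. y \<in> smooths \<Longrightarrow> coeff \<zeta> y g = (\<Sum>(c, t, x)\<leftarrow>qs. complex_of_real (c g) * cinner (\<pi> g x) (word t y))"
    using coeff_representation[OF assms] by metis
  define T where "T = (\<lambda>f (c, t, x). (- 1) ^ length t *\<^sub>R word (rev t) (smear (\<lambda>g. c g *\<^sub>R f g) x))"
  define W where "W f = (\<Sum>q\<leftarrow>qs. T f q)" for f
  have cf: "(\<lambda>g. c g *\<^sub>R f g) \<in> test_functions A" if "smooth_fun A c" "f \<in> test_functions A" for c f
    using diff_op_test[OF diff_op_scaleR[OF that(1)] that(2)] .
  have Tsm: "T f q \<in> smooths" if "smooth_fun A (fst q)" "f \<in> test_functions A" for f q
  proof -
    obtain c t x where q: "q = (c, t, x)" by (cases q) auto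
    have "smear (\<lambda>g. c g *\<^sub>R f g) x \<in> smooths" using that by (intro smear_smooth cf) (auto simp: q)
    then show ?thesis unfolding T_def q prod.case by (intro smooths_scaleR word_smooths)
  qed
  have cont: "continuous_on UNIV (\<lambda>g. complex_of_real (c g) * cinner (\<pi> g x) z)" if "smooth_fun A c"
      for c x z
    by (intro continuous_intros continuous_on_of_real smooth_fun_continuous[OF that] continuous_coefficient)
  have cont_sum: "continuous_on UNIV (\<lambda>g. \<Sum>(c, t, x)\<leftarrow>qs. complex_of_real (c g) * cinner (\<pi> g x)
      (word t y))" for y
    using qs(1)
  proof (induction qs)
    case (Cons q qs)
    obtain c t x where q: "q = (c, t, x)" by (cases q) auto
    have "smooth_fun A c" using Cons.prems[of q] by (simp add: q)
    then show ?case using Cons by (simp add: q cont continuous_on_add)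
  qed simp
  have pair: "cinner (\<Sum>q\<leftarrow>qs. T f q) y =
     (\<integral>g. f g * (\<Sum>(c, t, x)\<leftarrow>qs. complex_of_real (c g) * cinner (\<pi> g x) (word t y)) \<partial>\<mu>) \<and>
     integrable \<mu> (\<lambda>g. f g * (\<Sum>(c, t, x)\<leftarrow>qs. complex_of_real (c g) * cinner (\<pi> g x) (word t y)))"
    if f: "f \<in> test_functions A" and y: "y \<in> smooths" for f y
    using qs(1)
  proof (induction qs)
    case (Cons q qs)
    obtain c t x where q: "q = (c, t, x)" by (cases q) auto
    have c: "smooth_fun A c" using Cons.prems[of q] by (simp add: q)
    have int: "integrable \<mu> (\<lambda>g. f g * (complex_of_real (c g) * cinner (\<pi> g x) (word t y)))"
      by (intro cc_integrable cc_times test_function_cc[OF f] cont[OF c])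
    have "cinner (T f q) y = (- 1) ^ length t * ((- 1) ^ length t * cinner (smear (\<lambda>g. c g *\<^sub>R f g)
        x) (word t y))"
      using word_adjoint[OF smear_smooth[OF cf[OF c f]] y, of "rev t" x]
      by (simp add: T_def q cinner_scaleR_left)
    also have "\<dots> = cinner (smear (\<lambda>g. c g *\<^sub>R f g) x) (word t y)"
      by (simp add: mult.assoc[symmetric] power_add[symmetric] flip: mult_2)
    also have "\<dots> = (\<integral>g. f g * (complex_of_real (c g) * cinner (\<pi> g x) (word t y)) \<partial>\<mu>)"
      unfolding cinner_smear[OF test_function_cc[OF cf[OF c f]]] by (simp add: scaleR_conv_of_real mult_ac)
    finally show ?case using Cons int by (simp add: q cinner_add_left distrib_left)
  qed simp
  have dom: "\<exists>p. dominated p \<and>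
      (\<forall>f\<in>test_functions A. (\<forall>g. g \<notin> K \<longrightarrow> f g = 0) \<longrightarrow> norm (word w (\<Sum>q\<leftarrow>qs. T f q)) \<le> p f)"
    if K: "compact K" for w K
    using qs(1)
  proof (induction qs)
    case Nil
    have "word w 0 = 0" using word_scaleC[OF smooths_0, of w 0] by simp
    then show ?case using dominated_zero by (intro exI[of _ "\<lambda>f. 0"]) simp
  next
    case (Cons q qs)
    then obtain p where p: "dominated p"
      "\<forall>f\<in>test_functions A. (\<forall>g. g \<notin> K \<longrightarrow> f g = 0) \<longrightarrow> norm (word w (\<Sum>q\<leftarrow>qs. T f q)) \<le> p f" by auto
    obtain c t x where q: "q = (c, t, x)" by (cases q) auto
    have c: "smooth_fun A c" using Cons.prems[of q] by (simp add: q)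
    obtain p' where p': "dominated p'" "\<And>f. f \<in> test_functions A \<Longrightarrow> (\<And>g. g \<notin> K \<Longrightarrow> f g = 0) \<Longrightarrow>
       norm (word (w @ rev t) (smear (\<lambda>g. c g *\<^sub>R f g) x)) \<le> p' f"
      using word_smear_dominated[OF K c, of "w @ rev t" x] by blast
    have "norm (word w (\<Sum>q\<leftarrow>q # qs. T f q)) \<le> p' f + p f"
      if f: "f \<in> test_functions A" and fK: "\<forall>g. g \<notin> K \<longrightarrow> f g = 0" for f
    proof -
      have s: "smear (\<lambda>g. c g *\<^sub>R f g) x \<in> smooths" by (rule smear_smooth[OF cf[OF c f]])
      have "word w (T f q) = (- 1) ^ length t *\<^sub>R word (w @ rev t) (smear (\<lambda>g. c g *\<^sub>R f g) x)"
        by (simp add: T_def q word_scaleR word_smooths s)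
      then have 1: "norm (word w (T f q)) \<le> p' f" using p'(2)[OF f] fK by simp
      have "(\<Sum>q\<leftarrow>qs. T f q) \<in> smooths" using Cons.prems Tsm f by (intro smooths_sum_list) auto
      moreover have "T f q \<in> smooths" using Cons.prems Tsm f by simp
      ultimately have eq: "word w (\<Sum>q\<leftarrow>q # qs. T f q) = word w (T f q) + word w (\<Sum>q\<leftarrow>qs. T f q)"
        by (simp add: word_add)
      have "norm (word w (\<Sum>q\<leftarrow>qs. T f q)) \<le> p f" using p(2) f fK by blast
      then show ?thesis unfolding eq using 1 norm_triangle_ineq[of "word w (T f q)"
          "word w (\<Sum>q\<leftarrow>qs. T f q)"] by linarith
    qed
    then show ?case using dominated_add[OF p'(1) p(1)] by blast
  qed
  show thesis
  proof (rule that)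
    show "W f \<in> smooths" if "f \<in> test_functions A" for f
      unfolding W_def using qs(1) Tsm that by (intro smooths_sum_list) auto
    show "continuous_on UNIV (coeff \<zeta> y)" if "y \<in> smooths" for y
      using cont_sum[of y] by (simp add: qs(2)[OF that])
    show "cinner (W f) y = (\<integral>g. f g * coeff \<zeta> y g \<partial>\<mu>)" if "f \<in> test_functions A" "y \<in> smooths" for f y
      using pair[OF that] by (simp add: W_def qs(2)[OF that(2)])
    show "\<exists>p. dominated p \<and> (\<forall>f\<in>test_functions A. (\<forall>g. g \<notin> K \<longrightarrow> f g = 0) \<longrightarrow> norm (word w (W f)) \<le> p f)"
      if "compact K" for w K unfolding W_def using dom[OF that] .
  qed
qed

text \<open>The vector pi(f) zeta, characterised by its pairings with smooth vectors, which
  determine it by density. It is thus independent of the representation of \<open>\<zeta>\<close>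
  from which it was built.\<close>

definition dsmear :: "(('h \<Rightarrow>\<^sub>L complex) \<Rightarrow> complex) \<Rightarrow> ('g \<Rightarrow> complex) \<Rightarrow> 'h" where
  "dsmear \<zeta> f = (SOME z. z \<in> smooths \<and> (\<forall>y\<in>smooths. cinner z y = (\<integral>g. f g * coeff \<zeta> y g \<partial>\<mu>)))"

lemma csubspace_test: "csubspace (test_functions A)"
proof -
  have "f + h \<in> test_functions A" if f: "f \<in> test_functions A" and h: "h \<in> test_functions A" for f h
  proof -
    obtain K L where "compact K" "\<And>g. g \<notin> K \<Longrightarrow> f g = 0" "compact L" "\<And>g. g \<notin> L \<Longrightarrow> h g = 0"
      using test_function_support[OF f] test_function_support[OF h] by metis
    then show ?thesis using smooth_fun_add[OF f[THEN test_function_smooth] h[THEN test_function_smooth]]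
      by (intro test_functionsI[of _ "K \<union> L"]) (auto simp: plus_fun_def)
  qed
  moreover have "scaleC c f \<in> test_functions A" if f: "f \<in> test_functions A" for c f
  proof -
    obtain K where "compact K" "\<And>g. g \<notin> K \<Longrightarrow> f g = 0" using test_function_support[OF f] by blast
    then show ?thesis using smooth_fun_linear[OF bounded_linear_scaleC f[THEN test_function_smooth], of c]
      by (intro test_functionsI[of _ K]) (auto simp: scaleC_fun_def)
  qed
  moreover have "0 \<in> test_functions A"
    using smooth_fun_const[of 0] by (intro test_functionsI[of _ "{}"]) (auto simp: zero_fun_def)
  ultimately show ?thesis unfolding csubspace_def by blast
qed

lemma left_translate_test:
  assumes "f \<in> test_functions A"
  shows "left_translate G k f \<in> test_functions A"
proof -
  obtain K where K: "compact K" "\<And>g. g \<notin> K \<Longrightarrow> f g = 0" using test_function_support[OF assms] by blast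
  have "compact ((\<lambda>x. k \<otimes> x) ` K)"
    by (intro compact_continuous_image K continuous_on_mult continuous_intros)
  then show ?thesis
  proof (rule test_functionsI[rotated])
    show "smooth_fun A (left_translate G k f)"
      unfolding left_translate_def by (rule smooth_fun_left[OF test_function_smooth[OF assms]])
    fix g assume g: "g \<notin> (\<lambda>x. k \<otimes> x) ` K"
    have "inv k \<otimes> g \<notin> K"
    proof
      assume "inv k \<otimes> g \<in> K"
      moreover have "g = k \<otimes> (inv k \<otimes> g)" by (simp add: m_assoc[symmetric])
      ultimately show False using g by blast
    qed
    then show "left_translate G k f g = 0" by (simp add: left_translate_def K(2))
  qed
qed

section \<open>Linearity, continuity and equivariance of smearing a distribution vector\<close>

context
  fixes \<zeta> assumes \<zeta>: "\<zeta> \<in> distribution_vectors G A \<pi>"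
begin

lemma coeff_continuous: "y \<in> smooths \<Longrightarrow> continuous_on UNIV (coeff \<zeta> y)"
  by (rule smear_distribution_exists[OF \<zeta>]) blast

lemma dsmear_spec:
  assumes "f \<in> test_functions A"
  shows "dsmear \<zeta> f \<in> smooths \<and> (\<forall>y\<in>smooths. cinner (dsmear \<zeta> f) y = (\<integral>g. f g * coeff \<zeta> y g \<partial>\<mu>))"
proof (rule smear_distribution_exists[OF \<zeta>])
  fix W assume W: "\<And>f. f \<in> test_functions A \<Longrightarrow> W f \<in> smooths"
    "\<And>f y. f \<in> test_functions A \<Longrightarrow> y \<in> smooths \<Longrightarrow> cinner (W f) y = (\<integral>g. f g * coeff \<zeta> y g \<partial>\<mu>)"
  show ?thesis unfolding dsmear_def
    by (rule someI[of _ "W f"]) (use W assms in simp)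
qed

lemma dsmear_smooth: "f \<in> test_functions A \<Longrightarrow> dsmear \<zeta> f \<in> smooths"
  and cinner_dsmear: "f \<in> test_functions A \<Longrightarrow> y \<in> smooths \<Longrightarrow>
    cinner (dsmear \<zeta> f) y = (\<integral>g. f g * coeff \<zeta> y g \<partial>\<mu>)"
  using dsmear_spec by blast+

lemma dsmear_eqI:
  "f \<in> test_functions A \<Longrightarrow> (\<And>y. y \<in> smooths \<Longrightarrow> cinner z y = (\<integral>g. f g * coeff \<zeta> y g \<partial>\<mu>)) \<Longrightarrow> dsmear \<zeta> f = z"
  by (rule cinner_eq_smooths) (simp add: cinner_dsmear)

lemma dsmear_dominated:
  assumes "compact K"
  obtains p where "dominated p" "\<And>f. f \<in> test_functions A \<Longrightarrow> (\<And>g. g \<notin> K \<Longrightarrow> f g = 0) \<Longrightarrow> norm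
      (word w (dsmear \<zeta> f)) \<le> p f"
proof (rule smear_distribution_exists[OF \<zeta>])
  fix W assume W: "\<And>f y. f \<in> test_functions A \<Longrightarrow> y \<in> smooths \<Longrightarrow> cinner (W f) y = (\<integral>g. f g * coeff \<zeta> y g \<partial>\<mu>)"
    "\<And>w K. compact K \<Longrightarrow> \<exists>p. dominated p \<and>
      (\<forall>f\<in>test_functions A. (\<forall>g. g \<notin> K \<longrightarrow> f g = 0) \<longrightarrow> norm (word w (W f)) \<le> p f)"
  have "dsmear \<zeta> f = W f" if "f \<in> test_functions A" for f using that W(1) by (intro dsmear_eqI)
  then show thesis using W(2)[OF assms, of w] that by auto
qed

lemma coeff_integrable: "f \<in> test_functions A \<Longrightarrow> y \<in> smooths \<Longrightarrow> integrable \<mu> (\<lambda>g. f g * coeff \<zeta> y g)"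
  by (intro cc_integrable cc_times test_function_cc coeff_continuous)

lemma dsmear_clinear: "clinear_on (test_functions A) (dsmear \<zeta>)"
  unfolding clinear_on_def
proof (intro conjI ballI allI)
  fix f h assume fh: "f \<in> test_functions A" "h \<in> test_functions A"
  show "dsmear \<zeta> (f + h) = dsmear \<zeta> f + dsmear \<zeta> h"
    by (rule dsmear_eqI[OF csubspace_add[OF csubspace_test fh]])
      (use coeff_integrable fh in \<open>simp add: cinner_add_left cinner_dsmear distrib_right\<close>)
next
  fix c f assume f: "f \<in> test_functions A"
  show "dsmear \<zeta> (scaleC c f) = scaleC c (dsmear \<zeta> f)"
    by (rule dsmear_eqI[OF csubspace_scaleC[OF csubspace_test f]])
      (simp add: cinner_scaleC_left cinner_dsmear f scaleC_fun_def scaleC_complex_def mult.assoc)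
qed

text \<open>Left invariance again. This one identity gives both the equivariance of
  \<open>matrix_map\<close> and the invariance of the range of \<open>dsmear\<close> under the
  representation.\<close>

lemma pi_dsmear:
  assumes f: "f \<in> test_functions A"
  shows "\<pi> k (dsmear \<zeta> f) = dsmear \<zeta> (left_translate G k f)"
proof (rule dsmear_eqI[OF left_translate_test[OF f], symmetric])
  fix y assume y: "y \<in> smooths"
  have "cinner (\<pi> k (dsmear \<zeta> f)) y = (\<integral>g. f g * coeff \<zeta> (\<pi> (inv k) y) g \<partial>\<mu>)"
    unfolding pi_cinner_inv[of k] using cinner_dsmear[OF f pi_smooths[OF y]] .
  also have "\<dots> = (\<integral>g. (\<lambda>g. left_translate G k f g * coeff \<zeta> y g) (k \<otimes> g) \<partial>\<mu>)"
    by (simp add: left_translate_def m_assoc[symmetric] inv_mult_group pi_mult_apply)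
  also have "\<dots> = (\<integral>g. left_translate G k f g * coeff \<zeta> y g \<partial>\<mu>)"
    using smooth_fun_continuous[OF test_function_smooth[OF left_translate_test[OF f]]]
    by (intro integral_left_mult continuous_intros coeff_continuous y)
  finally show "cinner (\<pi> k (dsmear \<zeta> f)) y = (\<integral>g. left_translate G k f g * coeff \<zeta> y g \<partial>\<mu>)" .
qed

end

section \<open>The matrix coefficient map\<close>

lemma sum_words_continuous:
  assumes "v \<in> smooths"
  shows "continuous_on UNIV (\<lambda>g. \<Sum>(w, y)\<leftarrow>zs. cinner (word w (\<pi> g v)) y)"
  by (induction zs) (auto intro!: continuous_on_add
      bounded_linear.continuous_on[OF bounded_linear_cinner_left continuous_word_pi[OF assms]])

text \<open>For a functional in word form, smearing a smooth vector commutes with the functional,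
  although the operators inside it are unbounded.\<close>

lemma sum_words_smear:
  assumes f: "f \<in> test_functions A" and v: "v \<in> smooths"
  shows "(\<Sum>(w, y)\<leftarrow>zs. cinner (word w (smear f v)) y) =
     (\<integral>g. f g * (\<Sum>(w, y)\<leftarrow>zs. cinner (word w (\<pi> g v)) y) \<partial>\<mu>)"
proof (induction zs)
  case (Cons z zs)
  obtain w y where z: "z = (w, y)" by force
  have int: "integrable \<mu> (\<lambda>g. f g * H g)" if "continuous_on UNIV H" for H
    by (intro cc_integrable cc_times test_function_cc[OF f] that)
  have "integrable \<mu> (\<lambda>g. f g * cinner (word w (\<pi> g v)) y)"
    by (intro int bounded_linear.continuous_on[OF bounded_linear_cinner_left continuous_word_pi[OF v]])
  then show ?case
    using Cons int[OF sum_words_continuous[OF v]] by (simp add: z cinner_word_smear[OF f v] distrib_left)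
qed simp

lemma continuous_smear:
  assumes "cc F"
  shows "continuous_on UNIV (smear F)"
proof (rule lipschitz_on_continuous_on)
  show "lipschitz_on (\<integral>g. cmod (F g) \<partial>\<mu>) UNIV (smear F)"
    using norm_smear[OF assms] by (intro lipschitz_onI) (auto simp: dist_norm smear_arg_diff[OF
        assms, symmetric])
qed

text \<open>The words fall on \<open>f\<close>, and bounded operators \<open>smear\<close> of fixed
  test functions remain. The expression is therefore continuous in the norm of H, on all of
  H.\<close>

lemma sum_words_smear_continuous:
  assumes f: "f \<in> test_functions A"
  shows "continuous_on UNIV (\<lambda>x. \<Sum>(w, y)\<leftarrow>zs. cinner (word w (smear f x)) y)"
  unfolding word_smear[OF f]
  by (induction zs) (auto intro!: continuous_on_add bounded_linear.continuous_on[OF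
      bounded_linear_cinner_left]
      continuous_smear test_function_cc vfields_test f)

lemma embed_dual_mem: "embed_dual A \<pi> (dual_of y) \<in> dual_dist"
proof -
  \<comment> \<open>\<open>[(1, [])]\<close> is the unit of the enveloping algebra, and its seminorm
    is the norm itself.\<close>
  let ?e = "embed_dual A \<pi> (dual_of y)" and ?p = "\<lambda>v. norm (pi_uea [(1, [])] v)"
  have e: "?e v = cinner v y" if "v \<in> smooths" for v using that by (simp add: embed_dual_def
      zero_extend_def)
  have p: "?p v = norm v" for v by (simp add: uea_rep_def)
  have "clinear_on smooths ?e"
    by (simp add: clinear_on_def e smooths_add smooths_scaleC cinner_add_left cinner_scaleC_left
        scaleC_complex_def)
  moreover have "continuous_map (seminorm_topology smooths (range (\<lambda>D v. norm (pi_uea D v)))) euclidean ?e"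
  proof (rule continuous_map_seminorm_topology[where F="{?p}" and C="norm y"])
    fix v w assume vw: "v \<in> smooths" "w \<in> smooths"
    show "norm (?e w - ?e v) \<le> norm y * (\<Sum>p\<in>{?p}. p (w - v))"
      using norm_cinner[of "w - v" y] by (simp add: e vw p cinner_diff_left mult.commute)
  next
    show "{?p} \<subseteq> range (\<lambda>D v. norm (pi_uea D v))" by auto
    show "q 0 = 0" if "q \<in> {?p}" for q using that by (simp add: p)
  qed auto
  moreover have "?e v = 0" if "v \<notin> smooths" for v using that by (simp add: embed_dual_def zero_extend_def)
  ultimately show ?thesis by (simp add: dual_dist_eq top_dual_def)
qed

text \<open>Weak-* density of the smooth vectors of the dual: in \<open>\<eta> v = \<Sum>\<^sub>i \<langle>D\<^sub>i v, y\<^sub>i\<rangle>\<close> approximate the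
  \<open>y\<^sub>i\<close> by smooth vectors and move the \<open>D\<^sub>i\<close> to the other side.\<close>

lemma dual_dist_limit:
  assumes \<eta>: "\<eta> \<in> dual_dist"
  obtains u where "\<And>n. u n \<in> smooths" "(\<lambda>n::nat. embed_dual A \<pi> (dual_of (u n))) \<longlonglongrightarrow> \<eta>"
proof -
  obtain zs where zs: "\<And>v. v \<in> smooths \<Longrightarrow> \<eta> v = (\<Sum>(w, y)\<leftarrow>zs. cinner (word w v) y)"
    by (rule dual_dist_representation[OF \<eta>]) blast
  have "\<forall>y. \<exists>z. (\<forall>n. z n \<in> smooths) \<and> z \<longlonglongrightarrow> y"
    using smooths_dense closure_sequential by (metis UNIV_I)
  then obtain z where z: "\<And>y n. z y n \<in> smooths" "\<And>y. z y \<longlonglongrightarrow> y" by metis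
  define u where "u n = (\<Sum>(w, y)\<leftarrow>zs. (- 1) ^ length w *\<^sub>R word (rev w) (z y n))" for n
  have u: "u n \<in> smooths" for n
    unfolding u_def using z(1) by (intro smooths_sum_list) (auto intro!: smooths_scaleR word_smooths)
  have eq: "cinner v (u n) = (\<Sum>(w, y)\<leftarrow>zs. cinner (word w v) (z y n))" if "v \<in> smooths" for v n
    unfolding u_def
    by (induction zs) (auto simp: cinner_add_right cinner_scaleR_right word_adjoint[OF that z(1)])
  have "(\<lambda>n. embed_dual A \<pi> (dual_of (u n)) v) \<longlonglongrightarrow> \<eta> v" for v
  proof (cases "v \<in> smooths")
    case True
    have "(\<lambda>n. \<Sum>(w, y)\<leftarrow>zs. cinner (word w v) (z y n)) \<longlonglongrightarrow> (\<Sum>(w, y)\<leftarrow>zs. cinner (word w v) y)"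
      by (induction zs) (auto intro!: tendsto_add bounded_linear.tendsto[OF
          bounded_linear_cinner_right z(2)])
    then show ?thesis using True by (simp add: embed_dual_def zero_extend_def eq zs)
  next
    case False
    then show ?thesis using dual_dist_zero[OF \<eta>] by (simp add: embed_dual_def zero_extend_def)
  qed
  then have "(\<lambda>n. embed_dual A \<pi> (dual_of (u n))) \<longlonglongrightarrow> \<eta>" by (rule tendsto_fun_pointwise)
  then show thesis by (rule that[OF u])
qed

section \<open>The coefficient map and the topology of test functions\<close>

lemma test_topology_in_eq: "test_topology_in A K = seminorm_topology (test_functions_in A K)
    chart_seminorms"
  by (simp add: test_topology_in_def chart_seminorms_def)

lemma test_functions_in_test: "compact K \<Longrightarrow> f \<in> test_functions_in A K \<Longrightarrow> f \<in> test_functions A"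
  using compact_closed_subset closed_closure by (auto simp: test_functions_in_def test_functions_def)

lemma test_functions_in_support: "f \<in> test_functions_in A K \<Longrightarrow> g \<notin> K \<Longrightarrow> f g = 0"
  using closure_subset[of "{g. f g \<noteq> 0}"] by (auto simp: test_functions_in_def)

lemma test_functions_in_diff:
  assumes "compact K" "f \<in> test_functions_in A K" "h \<in> test_functions_in A K"
  shows "h - f \<in> test_functions_in A K"
proof -
  have "h - f \<in> test_functions A"
    using assms test_functions_in_test by (intro csubspace_diff csubspace_test) auto
  moreover have "(h - f) g = 0" if "g \<notin> K" for g
    using assms(2,3)[THEN test_functions_in_support, OF that] by simp
  then have "closure {g. (h - f) g \<noteq> 0} \<subseteq> K"
    using assms(1) by (intro closure_minimal compact_imp_closed) auto
  ultimately show ?thesis by (simp add: test_functions_in_def test_functions_def)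
qed

lemma chart_seminorms_0:
  assumes "p \<in> chart_seminorms"
  shows "p 0 = 0"
proof -
  obtain c :: "('g, 'e) chart" and L \<xi>s where c: "p = deriv_seminorm c L \<xi>s" "L \<noteq> {}"
    using assms unfolding chart_seminorms_def by blast
  obtain U \<phi> where p: "c = (U, \<phi>)" by force
  have "0 \<circ> inv_into U \<phi> = (\<lambda>_. 0 :: complex)" by (simp add: fun_eq_iff)
  then show ?thesis by (simp add: c p deriv_seminorm_def iterated_deriv_const_zero)
qed

definition matrix_map ::
  "(('h \<Rightarrow>\<^sub>L complex) \<Rightarrow> complex) \<Rightarrow> ('h \<Rightarrow> complex) \<Rightarrow> ('g \<Rightarrow> complex) \<Rightarrow> complex" where
  "matrix_map \<zeta> \<eta> = zero_extend (test_functions A) (\<lambda>f. \<eta> (dsmear \<zeta> f))"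

lemma matrix_map_apply: "f \<in> test_functions A \<Longrightarrow> matrix_map \<zeta> \<eta> f = \<eta> (dsmear \<zeta> f)"
  and matrix_map_zero: "f \<notin> test_functions A \<Longrightarrow> matrix_map \<zeta> \<eta> f = 0"
  by (simp_all add: matrix_map_def zero_extend_def)

lemma matrix_map_clinear_on: "clinear_on dual_dist (matrix_map \<zeta>)"
  unfolding clinear_on_def by (auto simp: matrix_map_def zero_extend_def scaleC_fun_def fun_eq_iff)

lemma distribution_zero: "T \<in> distributions A \<Longrightarrow> f \<notin> test_functions A \<Longrightarrow> T f = 0"
  by (simp add: distributions_def top_dual_def test_topology_def)

context
  fixes \<zeta> assumes \<zeta>: "\<zeta> \<in> distribution_vectors G A \<pi>"
begin

lemma matrix_map_dominated:
  assumes \<eta>: "\<eta> \<in> dual_dist" and K: "compact K"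
  obtains p where "dominated p" "\<And>f. f \<in> test_functions A \<Longrightarrow> (\<And>g. g \<notin> K \<Longrightarrow> f g = 0) \<Longrightarrow> cmod
      (matrix_map \<zeta> \<eta> f) \<le> p f"
proof -
  obtain zs where zs: "\<And>v. v \<in> smooths \<Longrightarrow> \<eta> v = (\<Sum>(w, y)\<leftarrow>zs. cinner (word w v) y)"
    by (rule dual_dist_representation[OF \<eta>]) blast
  have "\<exists>p. dominated p \<and> (\<forall>f\<in>test_functions A. (\<forall>g. g \<notin> K \<longrightarrow> f g = 0) \<longrightarrow>
      cmod (\<Sum>(w, y)\<leftarrow>zs. cinner (word w (dsmear \<zeta> f)) y) \<le> p f)"
  proof (induction zs)
    case Nil
    show ?case using dominated_zero by (intro exI[of _ "\<lambda>f. 0"]) simp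
  next
    case (Cons z zs)
    then obtain p where p: "dominated p" "\<forall>f\<in>test_functions A. (\<forall>g. g \<notin> K \<longrightarrow> f g = 0) \<longrightarrow>
      cmod (\<Sum>(w, y)\<leftarrow>zs. cinner (word w (dsmear \<zeta> f)) y) \<le> p f" by blast
    obtain w y where z: "z = (w, y)" by force
    obtain p' where p': "dominated p'" "\<And>f. f \<in> test_functions A \<Longrightarrow> (\<And>g. g \<notin> K \<Longrightarrow> f g = 0) \<Longrightarrow> norm
        (word w (dsmear \<zeta> f)) \<le> p' f"
      by (rule dsmear_dominated[OF \<zeta> K, of w]) blast
    have "cmod (\<Sum>(w, y)\<leftarrow>z # zs. cinner (word w (dsmear \<zeta> f)) y) \<le> norm y * p' f + p f"
      if "f \<in> test_functions A" "\<forall>g. g \<notin> K \<longrightarrow> f g = 0" for f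
    proof -
      have "cmod (cinner (word w (dsmear \<zeta> f)) y) \<le> norm (word w (dsmear \<zeta> f)) * norm y" by
          (rule norm_cinner)
      also have "\<dots> \<le> p' f * norm y" using that by (intro mult_right_mono p'(2)) auto
      finally have 1: "cmod (cinner (word w (dsmear \<zeta> f)) y) \<le> norm y * p' f" by (simp add: mult.commute)
      have 2: "cmod (\<Sum>(w, y)\<leftarrow>zs. cinner (word w (dsmear \<zeta> f)) y) \<le> p f" using p(2) that by blast
      show ?thesis using norm_triangle_mono[OF 1 2] by (simp add: z)
    qed
    moreover have "dominated (\<lambda>f. norm y * p' f + p f)"
      by (intro dominated_add dominated_scale p p') simp
    ultimately show ?case by (intro exI[of _ "\<lambda>f. norm y * p' f + p f"]) simp
  qed
  then obtain p where p: "dominated p" "\<forall>f\<in>test_functions A. (\<forall>g. g \<notin> K \<longrightarrow> f g = 0) \<longrightarrow>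
      cmod (\<Sum>(w, y)\<leftarrow>zs. cinner (word w (dsmear \<zeta> f)) y) \<le> p f" by blast
  show thesis
  proof (rule that[OF p(1)])
    fix f assume f: "f \<in> test_functions A" "\<And>g. g \<notin> K \<Longrightarrow> f g = 0"
    then show "cmod (matrix_map \<zeta> \<eta> f) \<le> p f"
      using p(2) zs[OF dsmear_smooth[OF \<zeta> f(1)]] by (simp add: matrix_map_apply)
  qed
qed

lemma matrix_map_clinear:
  assumes \<eta>: "\<eta> \<in> dual_dist"
  shows "clinear_on (test_functions A) (matrix_map \<zeta> \<eta>)"
  using dual_dist_clinear[OF \<eta>] dsmear_clinear[OF \<zeta>] dsmear_smooth[OF \<zeta>]
  by (simp add: clinear_on_def matrix_map_apply csubspace_add[OF csubspace_test] csubspace_scaleC[OF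
      csubspace_test])

text \<open>The inductive limit topology is generated by the seminorms that are continuous for each
  compact support. The absolute value of the functional is itself such a seminorm, by
  \<open>matrix_map_dominated\<close>, so the functional is continuous with constant 1.\<close>

lemma matrix_map_distribution:
  assumes \<eta>: "\<eta> \<in> dual_dist"
  shows "matrix_map \<zeta> \<eta> \<in> distributions A"
proof -
  let ?M = "matrix_map \<zeta> \<eta>" and ?p = "\<lambda>f. cmod (matrix_map \<zeta> \<eta> f)"
  let ?P = "{p. seminorm_on (test_functions A) p \<and>
           (\<forall>K. compact K \<longrightarrow> continuous_map (test_topology_in A K) euclideanreal p)}"
  note lin = matrix_map_clinear[OF \<eta>]
  have diff: "?M (f - h) = ?M f - ?M h" if "f \<in> test_functions A" "h \<in> test_functions A" for f h
    by (rule clinear_on_diff[OF lin csubspace_test that])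
  have "seminorm_on (test_functions A) ?p"
    using lin by (auto simp: seminorm_on_def clinear_on_def scaleC_complex_def norm_mult norm_triangle_ineq)
  moreover have "continuous_map (test_topology_in A K) euclideanreal ?p" if K: "compact K" for K
  proof -
    obtain p where p: "dominated p" "\<And>f. f \<in> test_functions A \<Longrightarrow> (\<And>g. g \<notin> K \<Longrightarrow> f g = 0) \<Longrightarrow> ?p f \<le> p f"
      by (rule matrix_map_dominated[OF \<eta> K]) blast
    obtain F C where F: "finite F" "F \<subseteq> chart_seminorms" "0 \<le> C"
      "\<And>f. f \<in> test_functions A \<Longrightarrow> p f \<le> C * (\<Sum>q\<in>F. q f)" using p(1) by (rule dominatedE) blast
    show ?thesis unfolding test_topology_in_eq
    proof (rule continuous_map_seminorm_topology[OF F(1-3)])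
      show "q 0 = 0" if "q \<in> F" for q using F(2) that chart_seminorms_0 by blast
      fix f h assume fh: "f \<in> test_functions_in A K" "h \<in> test_functions_in A K"
      have t: "f \<in> test_functions A" "h \<in> test_functions A" "h - f \<in> test_functions A"
        using fh test_functions_in_diff[OF K fh] test_functions_in_test[OF K] by auto
      have "norm (?p h - ?p f) \<le> ?p (h - f)" unfolding diff[OF t(2,1)] real_norm_def by
          (rule norm_triangle_ineq3)
      also have "\<dots> \<le> p (h - f)"
        using test_functions_in_support[OF test_functions_in_diff[OF K fh]] by (intro p(2) t)
      also have "\<dots> \<le> C * (\<Sum>q\<in>F. q (h - f))" by (rule F(4)[OF t(3)])
      finally show "norm (?p h - ?p f) \<le> C * (\<Sum>q\<in>F. q (h - f))" .
    qed
  qed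
  ultimately have pP: "?p \<in> ?P" by blast
  have "continuous_map (test_topology A) euclidean ?M"
    unfolding test_topology_def
  proof (rule continuous_map_seminorm_topology[where F="{?p}" and C=1])
    show "p 0 = 0" if "p \<in> {?p}" for p
      using that clinear_on_0[OF lin csubspace_test] by simp
    show "norm (?M h - ?M f) \<le> 1 * (\<Sum>p\<in>{?p}. p (h - f))" if "f \<in> test_functions A"
        "h \<in> test_functions A" for f h
      using diff[OF that(2,1)] by simp
  qed (use pP in auto)
  then show ?thesis
    using lin matrix_map_zero by (simp add: distributions_def top_dual_def test_topology_def)
qed

text \<open>For fixed \<open>f\<close> the map evaluates \<open>\<eta>\<close> at the fixed vector
  \<open>dsmear \<zeta> f\<close>, which is weak-* continuous.\<close>

lemma matrix_map_continuous: "continuous_on S (matrix_map \<zeta>)"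
proof (rule continuous_on_coordinatewise_then_product)
  fix f
  show "continuous_on S (\<lambda>\<eta>. matrix_map \<zeta> \<eta> f)"
  proof (cases "f \<in> test_functions A")
    case True
    then show ?thesis
      using continuous_on_subset[OF continuous_on_product_coordinates[of "dsmear \<zeta> f"] subset_UNIV]
      by (simp add: matrix_map_apply)
  qed (simp add: matrix_map_zero)
qed

lemma matrix_map_equivariant:
  "matrix_map \<zeta> (act_dual_distribution_vector G A \<pi> h \<eta>) = left_translate_distribution G A h
      (matrix_map \<zeta> \<eta>)"
proof
  fix f
  show "matrix_map \<zeta> (act_dual_distribution_vector G A \<pi> h \<eta>) f = left_translate_distribution G A h
      (matrix_map \<zeta> \<eta>) f"
  proof (cases "f \<in> test_functions A")
    case True
    then show ?thesis
      by (simp add: matrix_map_apply act_dual_distribution_vector_def left_translate_distribution_def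
          dual_action_def zero_extend_def dsmear_smooth[OF \<zeta>] pi_dsmear[OF \<zeta>] left_translate_test)
  qed (simp add: matrix_map_zero left_translate_distribution_def dual_action_def zero_extend_def)
qed

lemma act_distribution_vector_dual_of:
  "y \<in> smooths \<Longrightarrow> act_distribution_vector G A \<pi> g \<zeta> (dual_of y) = coeff \<zeta> y g"
  by (simp add: act_distribution_vector_def dual_action_def zero_extend_def dual_smooth_eq
      contragredient_dual_of)

lemma matrix_map_identified:
  assumes y: "y \<in> smooths"
  shows "identified_with_function A \<mu> (matrix_map \<zeta> (embed_dual A \<pi> (dual_of y)))
     (\<lambda>g. act_distribution_vector G A \<pi> g \<zeta> (dual_of y))"
  unfolding identified_with_function_def act_distribution_vector_dual_of[OF y]
proof (intro ballI conjI)
  fix f assume f: "f \<in> test_functions A"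
  show "integrable \<mu> (\<lambda>g. coeff \<zeta> y g * f g)" using coeff_integrable[OF \<zeta> f y] by (simp add: mult.commute)
  show "matrix_map \<zeta> (embed_dual A \<pi> (dual_of y)) f = (\<integral>g. coeff \<zeta> y g * f g \<partial>\<mu>)"
    using cinner_dsmear[OF \<zeta> f y] dsmear_smooth[OF \<zeta> f]
    by (simp add: matrix_map_apply f embed_dual_def zero_extend_def mult.commute)
qed

lemma matrix_coefficient_map_matrix_map: "matrix_coefficient_map G A \<mu> \<pi> \<zeta> (matrix_map \<zeta>)"
  unfolding matrix_coefficient_map_def
proof (intro conjI ballI allI)
  show "matrix_map \<zeta> ` dual_dist \<subseteq> distributions A" using matrix_map_distribution by blast
  show "continuous_on dual_dist (matrix_map \<zeta>)" by (rule matrix_map_continuous)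
  show "matrix_map \<zeta> (act_dual_distribution_vector G A \<pi> h \<eta>) = left_translate_distribution G A h
      (matrix_map \<zeta> \<eta>)" for h \<eta>
    by (rule matrix_map_equivariant)
next
  fix v assume v: "v \<in> dual_smooth G A \<pi>"
  then show "act_distribution_vector G A \<pi> g \<zeta> v = \<zeta> (contragredient G \<pi> (inv g) v)" for g
    by (simp add: act_distribution_vector_def dual_action_def zero_extend_def)
  obtain y where "y \<in> smooths" "v = dual_of y" using v dual_smooth_eq by blast
  then show "identified_with_function A \<mu> (matrix_map \<zeta> (embed_dual A \<pi> v))
      (\<lambda>g. act_distribution_vector G A \<pi> g \<zeta> v)"
    using matrix_map_identified by simp
qed

section \<open>Uniqueness and injectivity\<close>

lemma matrix_coefficient_map_unique:
  assumes M: "matrix_coefficient_map G A \<mu> \<pi> \<zeta> M" and M': "matrix_coefficient_map G A \<mu> \<pi> \<zeta> M'"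
    and \<eta>: "\<eta> \<in> dual_dist"
  shows "M \<eta> = M' \<eta>"
proof
  fix f
  obtain u where u: "\<And>n. u n \<in> smooths" "(\<lambda>n::nat. embed_dual A \<pi> (dual_of (u n))) \<longlonglongrightarrow> \<eta>"
    by (rule dual_dist_limit[OF \<eta>]) blast
  have lim: "(\<lambda>n. N (embed_dual A \<pi> (dual_of (u n))) f) \<longlonglongrightarrow> N \<eta> f"
    if "matrix_coefficient_map G A \<mu> \<pi> \<zeta> N" for N
  proof -
    have "continuous_on dual_dist N" using that by (simp add: matrix_coefficient_map_def)
    then have "continuous_on dual_dist (\<lambda>\<eta>. N \<eta> f)" by (rule continuous_on_product_then_coordinatewise)
    then show ?thesis
      by (rule continuous_on_tendsto_compose[OF _ u(2) \<eta>]) (simp add: embed_dual_mem)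
  qed
  have "M (embed_dual A \<pi> (dual_of (u n))) f = M' (embed_dual A \<pi> (dual_of (u n))) f" for n
  proof (cases "f \<in> test_functions A")
    case True
    have "dual_of (u n) \<in> dual_smooth G A \<pi>" using u(1) by (simp add: dual_smooth_eq)
    then have int: "N (embed_dual A \<pi> (dual_of (u n))) f =
        (\<integral>g. act_distribution_vector G A \<pi> g \<zeta> (dual_of (u n)) * f g \<partial>\<mu>)"
      if "matrix_coefficient_map G A \<mu> \<pi> \<zeta> N" for N
      using that True unfolding matrix_coefficient_map_def identified_with_function_def by blast
    show ?thesis by (simp only: int[OF M] int[OF M'])
  next
    \<comment> \<open>Equality is claimed for functions on the whole type; off the test functions
      both values are 0 by the convention in \<open>top_dual\<close>.\<close>
    case False
    have "N (embed_dual A \<pi> (dual_of (u n))) \<in> distributions A" if "matrix_coefficient_map G A \<mu> \<pi> \<zeta>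
        N" for N
      using that embed_dual_mem unfolding matrix_coefficient_map_def by blast
    then have 0: "N (embed_dual A \<pi> (dual_of (u n))) f = 0" if "matrix_coefficient_map G A \<mu> \<pi> \<zeta> N" for N
      using that distribution_zero False by blast
    show ?thesis by (simp only: 0[OF M] 0[OF M'])
  qed
  then show "M \<eta> f = M' \<eta> f" using lim[OF M] lim[OF M'] LIMSEQ_unique by simp
qed

text \<open>The closure of the range is a closed invariant subspace. If it were zero, every
  coefficient of \<open>\<zeta>\<close> would integrate to 0 against all test functions. Its value
  at the identity, \<open>\<zeta> (dual_of y)\<close>, would then vanish for every smooth
  \<open>y\<close>, contrary to \<open>\<zeta> \<noteq> 0\<close>.\<close>

lemma dsmear_dense:
  assumes irr: "irreducible_rep \<pi>" and nz: "\<zeta> \<noteq> 0"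
  shows "closure (dsmear \<zeta> ` test_functions A) = UNIV"
proof -
  let ?R = "dsmear \<zeta> ` test_functions A" and ?Z = "closure (dsmear \<zeta> ` test_functions A)"
  note lin = dsmear_clinear[OF \<zeta>]
  have R: "csubspace ?R"
    unfolding csubspace_def
  proof (intro conjI ballI allI)
    show "0 \<in> ?R" using clinear_on_0[OF lin csubspace_test] csubspace_0[OF csubspace_test] by (metis imageI)
    show "x + y \<in> ?R" if "x \<in> ?R" "y \<in> ?R" for x y
      using that by (auto simp: clinear_on_add[OF lin, symmetric] csubspace_add[OF csubspace_test])
    show "scaleC c x \<in> ?R" if "x \<in> ?R" for c x
      using that by (auto simp: clinear_on_scaleC[OF lin, symmetric] csubspace_scaleC[OF csubspace_test])
  qed
  have seq: "\<exists>a. (\<forall>n. a n \<in> ?R) \<and> a \<longlonglongrightarrow> x" if "x \<in> ?Z" for x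
    using that by (rule closure_sequential[THEN iffD1])
  have lim: "x \<in> ?Z" if "\<And>n. a n \<in> ?R" "a \<longlonglongrightarrow> x" for a x
    by (rule closure_sequential[THEN iffD2]) (intro exI[of _ a] conjI allI that)
  have "csubspace ?Z"
    unfolding csubspace_def
  proof (intro conjI ballI allI)
    show "0 \<in> ?Z" by (rule subsetD[OF closure_subset csubspace_0[OF R]])
    show "x + y \<in> ?Z" if "x \<in> ?Z" "y \<in> ?Z" for x y
    proof -
      obtain a where a: "\<forall>n. a n \<in> ?R" "a \<longlonglongrightarrow> x" using seq[OF \<open>x \<in> ?Z\<close>] by (elim exE conjE)
      obtain b where b: "\<forall>n. b n \<in> ?R" "b \<longlonglongrightarrow> y" using seq[OF \<open>y \<in> ?Z\<close>] by (elim exE conjE)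
      show ?thesis by (rule lim[OF csubspace_add[OF R a(1)[rule_format] b(1)[rule_format]]
          tendsto_add[OF a(2) b(2)]])
    qed
    show "scaleC c x \<in> ?Z" if "x \<in> ?Z" for c x
    proof -
      obtain a where a: "\<forall>n. a n \<in> ?R" "a \<longlonglongrightarrow> x" using seq[OF \<open>x \<in> ?Z\<close>] by (elim exE conjE)
      show ?thesis
        by (rule lim[OF csubspace_scaleC[OF R a(1)[rule_format]] bounded_linear.tendsto[OF
            bounded_linear_scaleC a(2)]])
    qed
  qed
  moreover have "\<pi> g x \<in> ?Z" if "x \<in> ?Z" for g x
  proof -
    obtain a where a: "\<forall>n. a n \<in> ?R" "a \<longlonglongrightarrow> x" using seq[OF \<open>x \<in> ?Z\<close>] by (elim exE conjE)
    have "\<pi> g (a n) \<in> ?R" for n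
    proof -
      obtain f where "f \<in> test_functions A" "a n = dsmear \<zeta> f" using a(1) by blast
      then show ?thesis using left_translate_test by (simp add: pi_dsmear[OF \<zeta>])
    qed
    then show ?thesis by (rule lim[OF _ bounded_linear.tendsto[OF blinfun.bounded_linear_right a(2)]])
  qed
  ultimately have "closed ?Z \<and> csubspace ?Z \<and> (\<forall>g. \<forall>x\<in>?Z. \<pi> g x \<in> ?Z)" by simp
  then have "?Z = {0} \<or> ?Z = UNIV"
    using irr unfolding irreducible_rep_def by blast
  moreover have "?Z \<noteq> {0}"
  proof
    assume "?Z = {0}"
    then have 0: "dsmear \<zeta> f = 0" if "f \<in> test_functions A" for f
      using subsetD[OF closure_subset imageI[OF that, of "dsmear \<zeta>"]] by simp
    have "\<zeta> (dual_of y) = 0" if y: "y \<in> smooths" for y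
    proof -
      have "coeff \<zeta> y \<one> = 0"
        by (rule test_integrals_zero[OF coeff_continuous[OF \<zeta> y]]) (simp add: cinner_dsmear[OF \<zeta> _
            y, symmetric] 0)
      then show ?thesis by simp
    qed
    then have "\<zeta> u = 0" for u using dist_zero[OF \<zeta>, of u] by blast
    then show False using nz by (auto simp: zero_fun_def)
  qed
  ultimately show ?thesis by blast
qed

lemma matrix_map_injective:
  assumes irr: "irreducible_rep \<pi>" and nz: "\<zeta> \<noteq> 0"
  shows "inj_on (matrix_map \<zeta>) dual_dist"
proof (rule inj_onI)
  fix \<eta>1 \<eta>2 assume \<eta>: "\<eta>1 \<in> dual_dist" "\<eta>2 \<in> dual_dist" and eq: "matrix_map \<zeta> \<eta>1 = matrix_map \<zeta> \<eta>2"
  obtain zs1 where zs1: "\<And>v. v \<in> smooths \<Longrightarrow> \<eta>1 v = (\<Sum>(w, y)\<leftarrow>zs1. cinner (word w v) y)"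
    by (rule dual_dist_representation[OF \<eta>(1)]) blast
  obtain zs2 where zs2: "\<And>v. v \<in> smooths \<Longrightarrow> \<eta>2 v = (\<Sum>(w, y)\<leftarrow>zs2. cinner (word w v) y)"
    by (rule dual_dist_representation[OF \<eta>(2)]) blast
  let ?zs = "zs1 @ map (\<lambda>(w, y). (w, - y)) zs2"
  \<comment> \<open>The difference of the two functionals in a single word representation. The
    formula agrees with the difference on smooth vectors, and all smeared vectors are
    smooth.\<close>
  define \<delta> where "\<delta> v = (\<Sum>(w, y)\<leftarrow>?zs. cinner (word w v) y)" for v
  have "(\<Sum>(w, y)\<leftarrow>map (\<lambda>(w, y). (w, - y)) zs2. cinner (word w v) y) = - (\<Sum>(w, y)\<leftarrow>zs2. cinner
      (word w v) y)" for v
    by (induction zs2) (auto simp: linear_neg[OF bounded_linear.linear[OF bounded_linear_cinner_right]])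
  then have \<delta>: "\<delta> v = \<eta>1 v - \<eta>2 v" if "v \<in> smooths" for v
    by (simp add: \<delta>_def zs1[OF that] zs2[OF that])
  have \<delta>R: "\<delta> (dsmear \<zeta> f) = 0" if "f \<in> test_functions A" for f
    using fun_cong[OF eq, of f] by (simp add: \<delta> dsmear_smooth[OF \<zeta> that] matrix_map_apply that)
  have \<delta>_smear: "\<delta> (smear f v) = (\<integral>g. f g * \<delta> (\<pi> g v) \<partial>\<mu>)" if "f \<in> test_functions A" "v \<in> smooths" for f v
    unfolding \<delta>_def by (rule sum_words_smear[OF that])
  \<comment> \<open>For x = pi(h) zeta, \<open>\<delta>_smear\<close> gives the integral of f(g)
    times delta(pi(L(g) h) zeta), and each of these values is 0 by \<open>\<delta>R\<close>. Density
    and continuity in \<open>x\<close> give the rest.\<close>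
  have "\<delta> (smear f x) = 0" if f: "f \<in> test_functions A" for f x
  proof (rule eq_on_dense[OF dsmear_dense[OF irr nz], of "\<lambda>x. \<delta> (smear f x)" "\<lambda>x. 0"])
    show "continuous_on UNIV (\<lambda>x. \<delta> (smear f x))" unfolding \<delta>_def by (rule sum_words_smear_continuous[OF f])
    fix v assume "v \<in> dsmear \<zeta> ` test_functions A"
    then obtain h where h: "h \<in> test_functions A" "v = dsmear \<zeta> h" by blast
    have "\<delta> (\<pi> g v) = 0" for g unfolding h(2) pi_dsmear[OF \<zeta> h(1)] by
        (rule \<delta>R[OF left_translate_test[OF h(1)]])
    then show "\<delta> (smear f v) = 0" using \<delta>_smear[OF f] dsmear_smooth[OF \<zeta> h(1)] by (simp add: h(2))
  qed simp
  note \<delta>0 = this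
  have "\<delta> v = 0" if v: "v \<in> smooths" for v
  proof -
    have "continuous_on UNIV (\<lambda>g. \<delta> (\<pi> g v))" unfolding \<delta>_def by (rule sum_words_continuous[OF v])
    moreover have "(\<integral>g. f g * \<delta> (\<pi> g v) \<partial>\<mu>) = 0" if "f \<in> test_functions A" for f
      using \<delta>_smear[OF that v] \<delta>0[OF that] by simp
    ultimately have "\<delta> (\<pi> \<one> v) = 0" by (rule test_integrals_zero)
    then show ?thesis by simp
  qed
  then show "\<eta>1 = \<eta>2"
    using \<delta> dual_dist_zero[OF \<eta>(1)] dual_dist_zero[OF \<eta>(2)] by (intro ext) (metis eq_iff_diff_eq_0)
qed

end

end

theorem theorem1p1:
  fixes G :: "('g::{t2_space,second_countable_topology}) monoid"
    and A :: "('g, 'e::real_normed_vector) chart set"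
    and \<mu> :: "'g measure"
    and \<pi> :: "'g \<Rightarrow> 'h::complex_hilbert_space \<Rightarrow>\<^sub>L 'h"
    and \<zeta> :: "('h \<Rightarrow>\<^sub>L complex) \<Rightarrow> complex"
  assumes "lie_group G A"
    and "left_haar_measure G \<mu>"
    and "separable_space (euclidean :: 'h topology)"
    and "unitary_rep G \<pi>"
    and "\<zeta> \<in> distribution_vectors G A \<pi>"
  shows "\<exists>M. matrix_coefficient_map G A \<mu> \<pi> \<zeta> M \<and>
    clinear_on (dual_distribution_vectors G A \<pi>) M \<and>
    (\<forall>M'. matrix_coefficient_map G A \<mu> \<pi> \<zeta> M' \<longrightarrow>
       (\<forall>\<eta>\<in>dual_distribution_vectors G A \<pi>. M' \<eta> = M \<eta>)) \<and>
    (\<forall>h. \<forall>\<eta>\<in>dual_distribution_vectors G A \<pi>.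
       M (act_dual_distribution_vector G A \<pi> h \<eta>) = left_translate_distribution G A h (M \<eta>)) \<and>
    (irreducible_rep \<pi> \<and> \<zeta> \<noteq> 0 \<longrightarrow> inj_on M (dual_distribution_vectors G A \<pi>))"
proof -
  interpret lie_group G A by (rule assms(1))
  interpret lie_group_rep G A \<mu> \<pi> by unfold_locales (use assms in auto)
  note \<zeta> = assms(5)
  show ?thesis
  proof (intro exI[of _ "matrix_map \<zeta>"] conjI allI ballI impI)
    show M: "matrix_coefficient_map G A \<mu> \<pi> \<zeta> (matrix_map \<zeta>)"
      by (rule matrix_coefficient_map_matrix_map[OF \<zeta>])
    show "M' \<eta> = matrix_map \<zeta> \<eta>"
      if "matrix_coefficient_map G A \<mu> \<pi> \<zeta> M'" "\<eta> \<in> dual_distribution_vectors G A \<pi>" for M' \<eta>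
      by (rule matrix_coefficient_map_unique[OF \<zeta> that(1) M that(2)])
  qed (auto intro: matrix_map_clinear_on matrix_map_equivariant[OF \<zeta>] matrix_map_injective[OF \<zeta>])
qed

end
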